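(* Let $I = [0,1]$. Then the set $C^{AC} := C \cap N \cap H_+^{AC}$ is a dense $G_\delta$ subset of $H_+^{AC}$ and is a conjugacy class of the group $H_+^{AC}$.
   Context: $H_+ = H_+(I)$ is the group (under composition) of increasing self-homeomorphisms of $I$. $H_+^{AC} = H_+^{AC}(I)$ is the subgroup of those $f \in H_+$ such that both $f$ and $f^{-1}$ are absolutely continuous on $I$, equipped with the Polish group topology given by the metric $\rho(f,g) := \int_I |f' - g'|\, d\lambda$, where $\lambda$ is Lebesgue measure. For $f \in H_+$, $\operatorname{Fix}(f) := \{x \in I : f(x) = x\}$. The orbital of $x \in I$ under $f$, denoted $\mathcal{O}_f(x)$, is $\{x\}$ if $x \in \operatorname{Fix}(f)$, and otherwise is the connected component of $I \setminus \operatorname{Fix}(f)$ containing $x$. An orbital $\mathcal{O}_f(x)$ has parity zero if $x \in \operatorname{Fix}(f)$, positive parity if $f(x) > x$, and negative parity if $f(x) < x$ (this does not depend on the choice of $x$ in the orbital). Orbitals are ordered naturally: $J < J'$ if every point of $J$ is less than every point of $J'$. $C$ is the set of all $f \in H_+$ for which the orbitals of nonzero parity form a dense linear order without endpoints (under the natural ordering), and moreover the set of orbitals of positive parity and the set of orbitals of negative parity are each dense subsets of this order (i.e. strictly between any two distinct orbitals of nonzero parity there is an orbital of positive parity and an orbital of negative parity). $N := \{f \in H_+ : \operatorname{Fix}(f) \text{ has Lebesgue measure zero}\}$. *)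

theory Defs
  imports "HOL-Analysis.Analysis" "HOL-Algebra.Bij"
begin

abbreviation I01 :: "real set" where
  "I01 \<equiv> {0..1}"

(* Self-maps of I01 are represented as elements of "Bij I01", that is, as functions that are
   "undefined" outside I01.  Equality of functions is then equality on I01, and the group
   operation of "BijGroup I01" is composition. *)
definition H_plus :: "(real \<Rightarrow> real) set" where
  "H_plus = {f \<in> Bij I01. homeomorphism I01 I01 f (inv_into I01 f) \<and> strict_mono_on I01 f}"

(* P ranges over finite families of pairwise non-overlapping closed subintervals of S, each
   given by its pair of endpoints. *)
definition abs_continuous_on :: "real set \<Rightarrow> (real \<Rightarrow> real) \<Rightarrow> bool" where
  "abs_continuous_on S f \<longleftrightarrow>
     (\<forall>\<epsilon>>0. \<exists>\<delta>>0. \<forall>P :: (real \<times> real) set.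
        finite P \<longrightarrow>
        (\<forall>(a, b)\<in>P. a \<le> b \<and> {a..b} \<subseteq> S) \<longrightarrow>
        disjoint_family_on (\<lambda>(a, b). {a<..<b}) P \<longrightarrow>
        (\<Sum>(a, b)\<in>P. b - a) < \<delta> \<longrightarrow>
        (\<Sum>(a, b)\<in>P. \<bar>f b - f a\<bar>) < \<epsilon>)"

definition H_AC :: "(real \<Rightarrow> real) set" where
  "H_AC = {f \<in> H_plus. abs_continuous_on I01 f \<and> abs_continuous_on I01 (inv_into I01 f)}"

definition H_AC_group :: "(real \<Rightarrow> real) monoid" where
  "H_AC_group = (BijGroup I01)\<lparr>carrier := H_AC\<rparr>"

(* "deriv f x" is arbitrary at the endpoints of I01 and wherever f is not differentiable.
   For f in H_AC these points form a null set, which does not affect the integral;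
   integrating over "lebesgue" (rather than "lborel") makes measurability insensitive to them. *)
definition rho :: "(real \<Rightarrow> real) \<Rightarrow> (real \<Rightarrow> real) \<Rightarrow> real" where
  "rho f g = (LINT x:I01|lebesgue. \<bar>deriv f x - deriv g x\<bar>)"

definition H_AC_topology :: "(real \<Rightarrow> real) topology" where
  "H_AC_topology = Metric_space.mtopology H_AC rho"

definition Fix :: "(real \<Rightarrow> real) \<Rightarrow> real set" where
  "Fix f = {x \<in> I01. f x = x}"

definition orbital :: "(real \<Rightarrow> real) \<Rightarrow> real \<Rightarrow> real set" where
  "orbital f x = (if x \<in> Fix f then {x} else connected_component_set (I01 - Fix f) x)"

definition positive_orbitals :: "(real \<Rightarrow> real) \<Rightarrow> real set set" where
  "positive_orbitals f = {orbital f x | x. x \<in> I01 \<and> f x > x}"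

definition negative_orbitals :: "(real \<Rightarrow> real) \<Rightarrow> real set set" where
  "negative_orbitals f = {orbital f x | x. x \<in> I01 \<and> f x < x}"

definition nonzero_orbitals :: "(real \<Rightarrow> real) \<Rightarrow> real set set" where
  "nonzero_orbitals f = positive_orbitals f \<union> negative_orbitals f"

definition orbital_order :: "(real \<Rightarrow> real) \<Rightarrow> real set rel" where
  "orbital_order f = {(J, J'). J \<in> nonzero_orbitals f \<and> J' \<in> nonzero_orbitals f \<and>
                               (\<forall>x\<in>J. \<forall>y\<in>J'. x < y)}"

definition dense_subset_of_order :: "'a set \<Rightarrow> 'a rel \<Rightarrow> 'a set \<Rightarrow> bool" where
  "dense_subset_of_order A r D \<longleftrightarrow>
     D \<subseteq> A \<and> (\<forall>a\<in>A. \<forall>b\<in>A. (a, b) \<in> r \<longrightarrow> (\<exists>d\<in>D. (a, d) \<in> r \<and> (d, b) \<in> r))"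

(* The relation r is the strict order.  As usual for dense linear orders without endpoints,
   the empty order is excluded; this keeps the identity, which has no orbital of nonzero
   parity, out of the set C below. *)
definition dense_linear_order_without_endpoints :: "'a set \<Rightarrow> 'a rel \<Rightarrow> bool" where
  "dense_linear_order_without_endpoints A r \<longleftrightarrow>
     A \<noteq> {} \<and> r \<subseteq> A \<times> A \<and> strict_linear_order_on A r \<and>
     dense_subset_of_order A r A \<and>
     (\<forall>a\<in>A. \<exists>b\<in>A. (b, a) \<in> r) \<and> (\<forall>a\<in>A. \<exists>b\<in>A. (a, b) \<in> r)"

definition C_set :: "(real \<Rightarrow> real) set" where
  "C_set = {f \<in> H_plus.
     dense_linear_order_without_endpoints (nonzero_orbitals f) (orbital_order f) \<and>
     dense_subset_of_order (nonzero_orbitals f) (orbital_order f) (positive_orbitals f) \<and>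
     dense_subset_of_order (nonzero_orbitals f) (orbital_order f) (negative_orbitals f)}"

definition N_set :: "(real \<Rightarrow> real) set" where
  "N_set = {f \<in> H_plus. Fix f \<in> null_sets lebesgue}"

definition C_AC :: "(real \<Rightarrow> real) set" where
  "C_AC = C_set \<inter> N_set \<inter> H_AC"

definition conjugacy_class :: "('a, 'b) monoid_scheme \<Rightarrow> 'a \<Rightarrow> 'a set" where
  "conjugacy_class G x =
     {g \<otimes>\<^bsub>G\<^esub> x \<otimes>\<^bsub>G\<^esub> inv\<^bsub>G\<^esub> g | g. g \<in> carrier G}"

end

theory Submission
  imports Defs
begin

text \<open>
  An increasing homeomorphism of the interval is absolutely continuous iff it maps null sets to
  null sets, so membership in \<open>H_AC\<close> can be checked piecewise on countable partitions. By
  Radon--Nikodym and Lebesgue differentiation each \<open>f\<close> in \<open>H_AC\<close> is the integral of its derivative;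
  hence \<open>rho\<close> is a metric that dominates the uniform distance.

  For \<open>f\<close> with a null fixed point set, \<open>f\<close> lies in \<open>C_set\<close> iff \<open>f x - x\<close> changes sign at least
  three times near every fixed point. This is a countable intersection of conditions that are open
  in the uniform distance, and it is invariant under conjugation.

  Density: positive polynomials are dense among the derivatives, so let \<open>f x - x\<close> be a nonzero
  polynomial \<open>u\<close>. Composing \<open>u\<close> with a function that agrees with a translation away from \<open>0\<close>, and
  near \<open>0\<close> is a small multiple of a Lipschitz function that oscillates around a null Cantor set,
  gives an element of \<open>C_AC\<close>; the derivative changes only on the small set where \<open>u\<close> is small.

  Conjugacy: a back-and-forth argument matches the orbitals of two elements of \<open>C_AC\<close>, preserving
  order and parity. On one orbital, \<open>f\<close> is conjugate to the translation \<open>x + 1\<close> of the line by a map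
  that is piecewise a power of \<open>f\<close> followed by an affine map, so that null sets are preserved. As the
  orbitals have full measure, the conjugating map extends to the interval and lies in \<open>H_AC\<close>.
\<close>

section \<open>Increasing homeomorphisms and the Lusin condition\<close>

text \<open>The conjugator is glued from countably many orbital pieces whose moduli of absolute
  continuity have no common bound, so no single \<delta> can be exhibited for it. Preservation of
  null sets is qualitative: it survives composition and countable unions with nothing to estimate.
  About the conjugator on the fixed points only one thing is known, that it takes
  \<open>Fix f\<close> into \<open>Fix g\<close>; as both sets are null, this is enough. The
  obstacle to density is that \<open>rho\<close> measures derivatives: a perturbation that is
  uniformly small but oscillates everywhere is far away. Oscillation has to be confined to a set of
  small measure that still contains all fixed points, namely the set where
  \<open>|u| \<le> d\<close>. A polynomial \<open>u\<close> makes this set small, having finitely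
  many zeros, and its finitely many critical points are the only places where null sets and sign
  changes fail to pull back along \<open>u\<close>. The factor on the oscillating function has to be
  small because the sum with the identity must remain increasing.\<close>

lemma H_plus_strict: "f \<in> H_plus \<Longrightarrow> strict_mono_on I01 f"
  and H_plus_ext: "f \<in> H_plus \<Longrightarrow> f \<in> extensional I01"
  and H_plus_Bij: "f \<in> H_plus \<Longrightarrow> f \<in> Bij I01"
  and H_plus_cont: "f \<in> H_plus \<Longrightarrow> continuous_on I01 f"
  and H_plus_image: "f \<in> H_plus \<Longrightarrow> f ` I01 = I01"
  and H_plus_inj: "f \<in> H_plus \<Longrightarrow> inj_on f I01"
  by (auto simp: H_plus_def Bij_def homeomorphism_def bij_betw_def)

lemma H_plus_mem: "f \<in> H_plus \<Longrightarrow> x \<in> I01 \<Longrightarrow> f x \<in> I01"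
  using H_plus_image by blast

lemma H_plus_less: "f \<in> H_plus \<Longrightarrow> x \<in> I01 \<Longrightarrow> y \<in> I01 \<Longrightarrow> f x < f y \<longleftrightarrow> x < y"
  using H_plus_strict strict_mono_on_less by blast

lemma H_plus_le: "f \<in> H_plus \<Longrightarrow> x \<in> I01 \<Longrightarrow> y \<in> I01 \<Longrightarrow> f x \<le> f y \<longleftrightarrow> x \<le> y"
  using H_plus_strict strict_mono_on_less_eq by blast

lemma H_plus_0: "f \<in> H_plus \<Longrightarrow> f 0 = 0" and H_plus_1: "f \<in> H_plus \<Longrightarrow> f 1 = 1"
proof -
  assume f: "f \<in> H_plus"
  obtain x y where "x \<in> I01" "f x = 0" "y \<in> I01" "f y = 1"
    using H_plus_image[OF f] by (metis (no_types) atLeastAtMost_iff imageE zero_le_one order_refl)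
  then show "f 0 = 0" "f 1 = 1"
    using H_plus_le[OF f, of 0 x] H_plus_le[OF f, of y 1] H_plus_mem[OF f, of 0] H_plus_mem[OF f, of 1] by auto
qed

text \<open>Extended by the identity outside the interval, \<open>f\<close> becomes a monotone
  surjection of the real line, and a monotone function with open range is continuous.\<close>

lemma strict_mono_onto_continuous:
  fixes f :: "real \<Rightarrow> real"
  assumes sm: "strict_mono_on I01 f" and im: "f ` I01 = I01"
  shows "continuous_on I01 f"
proof -
  define F where "F = (\<lambda>x. if x \<in> I01 then f x else x)"
  have fI: "f x \<in> I01" if "x \<in> I01" for x using im that by blast
  have "mono F"
  proof (rule monoI)
    fix x y :: real assume xy: "x \<le> y"
    show "F x \<le> F y"
    proof (cases "x \<in> I01 \<and> y \<in> I01")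
      case True
      then show ?thesis using strict_mono_on_leD[OF sm, of x y] xy by (auto simp: F_def)
    next
      case False
      then show ?thesis using xy fI[of x] fI[of y] by (auto simp: F_def)
    qed
  qed
  moreover have "F ` UNIV = UNIV"
  proof -
    have "y \<in> range F" for y
    proof (cases "y \<in> I01")
      case True
      then obtain x where "x \<in> I01" "f x = y" using im by (metis imageE)
      then have "F x = y" by (simp add: F_def)
      then show ?thesis by blast
    next
      case False
      then have "F y = y" by (simp only: F_def if_False)
      then show ?thesis by (metis rangeI)
    qed
    then show ?thesis by blast
  qed
  ultimately have "continuous_on UNIV F"
    by (intro continuous_onI_mono) (auto simp: mono_def)
  then have "continuous_on I01 F" using continuous_on_subset by blast
  then show ?thesis by (rule continuous_on_eq) (simp add: F_def)
qed

lemma strict_mono_on_inv_into: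
  fixes f :: "real \<Rightarrow> real"
  assumes sm: "strict_mono_on A f"
  shows "strict_mono_on (f ` A) (inv_into A f)"
proof (rule strict_mono_onI)
  fix x y assume "x \<in> f ` A" "y \<in> f ` A" "x < y"
  then show "inv_into A f x < inv_into A f y"
    using strict_mono_on_less[OF sm, of "inv_into A f x" "inv_into A f y"]
    by (simp add: inv_into_into f_inv_into_f)
qed

text \<open>Continuity in both directions is automatic: the inverse is again a strictly increasing
  surjection, so \<open>strict_mono_onto_continuous\<close> applies to it as well.\<close>

lemma H_plusI:
  assumes ext: "f \<in> extensional I01" and sm: "strict_mono_on I01 f" and im: "f ` I01 = I01"
  shows "f \<in> H_plus"
proof -
  have inj: "inj_on f I01" using sm strict_mono_on_imp_inj_on by blast
  have "inv_into I01 f ` I01 = I01" using inj im by (metis inv_into_image_cancel order_refl)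
  moreover have "strict_mono_on I01 (inv_into I01 f)"
    using strict_mono_on_inv_into[OF sm] im by simp
  ultimately have "continuous_on I01 (inv_into I01 f)"
    by (intro strict_mono_onto_continuous)
  then have "homeomorphism I01 I01 f (inv_into I01 f)"
    using strict_mono_onto_continuous[OF sm im] inj im \<open>inv_into I01 f ` I01 = I01\<close>
    by (auto simp: homeomorphism_def f_inv_into_f)
  then show ?thesis
    using ext sm inj im by (auto simp: H_plus_def Bij_def bij_betw_def)
qed

lemma H_plus_inv:
  assumes "f \<in> H_plus"
  shows "restrict (inv_into I01 f) I01 \<in> H_plus"
proof (rule H_plusI)
  show "strict_mono_on I01 (restrict (inv_into I01 f) I01)"
    using strict_mono_on_inv_into[OF H_plus_strict[OF assms]] H_plus_image[OF assms]
    by (simp add: strict_mono_on_def)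
  show "restrict (inv_into I01 f) I01 ` I01 = I01"
    using H_plus_image[OF assms] H_plus_inj[OF assms]
    by (metis image_restrict_eq inv_into_image_cancel order_refl)
qed auto

lemma H_plus_f_inv: "f \<in> H_plus \<Longrightarrow> y \<in> I01 \<Longrightarrow> f (inv_into I01 f y) = y"
  by (simp add: H_plus_image f_inv_into_f)

lemma H_plus_inv_f: "f \<in> H_plus \<Longrightarrow> x \<in> I01 \<Longrightarrow> inv_into I01 f (f x) = x"
  by (simp add: H_plus_inj)

lemma H_plus_inv_mem: "f \<in> H_plus \<Longrightarrow> y \<in> I01 \<Longrightarrow> inv_into I01 f y \<in> I01"
  by (metis H_plus_image inv_into_into)

lemma H_plus_image_interval:
  assumes f: "f \<in> H_plus" and x: "x \<in> I01" and y: "y \<in> I01"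
  shows "f ` {x..y} = {f x..f y}"
proof
  show "f ` {x..y} \<subseteq> {f x..f y}"
  proof
    fix z assume "z \<in> f ` {x..y}"
    then obtain t where t: "t \<in> {x..y}" "z = f t" by blast
    then have "t \<in> I01" using x y by auto
    then show "z \<in> {f x..f y}" using t x y H_plus_le[OF f] by auto
  qed
  show "{f x..f y} \<subseteq> f ` {x..y}"
  proof
    fix z assume z: "z \<in> {f x..f y}"
    then have zI: "z \<in> I01" using H_plus_mem[OF f x] H_plus_mem[OF f y] by auto
    let ?t = "inv_into I01 f z"
    have t: "?t \<in> I01" "f ?t = z" using H_plus_inv_mem[OF f zI] H_plus_f_inv[OF f zI] by auto
    then have "?t \<in> {x..y}" using z H_plus_le[OF f x t(1)] H_plus_le[OF f t(1) y] by auto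
    then show "z \<in> f ` {x..y}" using t by force
  qed
qed

lemma H_plus_compose:
  assumes f: "f \<in> H_plus" and g: "g \<in> H_plus"
  shows "compose I01 f g \<in> H_plus"
proof (rule H_plusI)
  show "compose I01 f g \<in> extensional I01" by (simp add: compose_def)
  show "strict_mono_on I01 (compose I01 f g)"
    by (rule strict_mono_onI) (auto simp: compose_eq H_plus_less[OF f] H_plus_less[OF g] H_plus_mem[OF g, simplified])
  show "compose I01 f g ` I01 = I01"
  proof -
    have "compose I01 f g ` I01 = f ` (g ` I01)" by (force simp: compose_def)
    then show ?thesis by (simp only: H_plus_image[OF f] H_plus_image[OF g])
  qed
qed

text \<open>Lusin's condition (N) on the unit interval. Only subsets of \<open>I01\<close> are
  tested, because elements of \<open>H_plus\<close> are \<open>undefined\<close> elsewhere.\<close>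

definition lusin_N :: "(real \<Rightarrow> real) \<Rightarrow> bool" where
  "lusin_N f \<longleftrightarrow> (\<forall>E\<subseteq>I01. negligible E \<longrightarrow> negligible (f ` E))"

lemma lusin_N_cong: "(\<And>x. x \<in> I01 \<Longrightarrow> f x = g x) \<Longrightarrow> lusin_N f \<longleftrightarrow> lusin_N g"
proof -
  assume "\<And>x. x \<in> I01 \<Longrightarrow> f x = g x"
  then have "f ` E = g ` E" if "E \<subseteq> I01" for E using that by (intro image_cong) auto
  then show ?thesis by (simp add: lusin_N_def)
qed

text \<open>A null set lies in countably many non-overlapping intervals of total length below
  \<delta>. An increasing homeomorphism maps \<open>[a, b]\<close> onto \<open>[f a, f b]\<close>,
  so absolute continuity bounds the measure of the images of every finite subfamily by \<epsilon>,
  and continuity of measure passes to the whole union.\<close>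

lemma abs_continuous_imp_lusin_N:
  assumes f: "f \<in> H_plus" and ac: "abs_continuous_on I01 f"
  shows "lusin_N f"
  unfolding lusin_N_def
proof (intro allI impI)
  fix E assume E: "E \<subseteq> I01" "negligible E"
  show "negligible (f ` E)"
    unfolding negligible_outer_le
  proof (intro allI impI)
    fix \<epsilon> :: real assume "\<epsilon> > 0"
    then obtain \<delta> where \<delta>: "\<delta> > 0"
      and ac: "\<And>P :: (real \<times> real) set. finite P \<Longrightarrow> \<forall>(a, b)\<in>P. a \<le> b \<and> {a..b} \<subseteq> I01 \<Longrightarrow>
        disjoint_family_on (\<lambda>(a, b). {a<..<b}) P \<Longrightarrow> (\<Sum>(a, b)\<in>P. b - a) < \<delta> \<Longrightarrow>
        (\<Sum>(a, b)\<in>P. \<bar>f b - f a\<bar>) < \<epsilon>"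
      using ac unfolding abs_continuous_on_def by meson
    have E': "E \<subseteq> cbox 0 1" "0 < \<delta>/2" using E(1) \<delta> by auto
    \<comment> \<open>Half of \<delta> leaves room for the strict inequality demanded later, since
      the outer bound is only non-strict.\<close>
    obtain \<D> where D: "countable \<D>"
       "\<And>K. K \<in> \<D> \<Longrightarrow> K \<subseteq> cbox 0 1 \<and> K \<noteq> {} \<and> (\<exists>c d. K = cbox c d)"
       "pairwise (\<lambda>A B. interior A \<inter> interior B = {}) \<D>"
       "E \<subseteq> \<Union>\<D>" "\<Union>\<D> \<in> lmeasurable" "measure lebesgue (\<Union>\<D>) \<le> measure lebesgue E + \<delta>/2"
      by (rule measurable_outer_intervals_bounded[OF negligible_imp_measurable[OF E(2)] E']) blast
    have mE: "measure lebesgue E = 0" using E by (simp add: negligible_imp_measure0)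
    have DK: "K = {Inf K..Sup K}" "Inf K \<le> Sup K" "K \<subseteq> I01" "Inf K \<in> I01" "Sup K \<in> I01" if "K \<in> \<D>" for K
      using D(2)[OF that] by auto
    have fK: "f ` K = {f (Inf K)..f (Sup K)}" "f (Inf K) \<le> f (Sup K)" if "K \<in> \<D>" for K
      using H_plus_image_interval[OF f DK(4,5)[OF that]] arg_cong[OF DK(1)[OF that], of "(`) f"] H_plus_le[OF f DK(4,5)[OF that]] DK(2)[OF that] by auto
    have DKm: "K \<in> lmeasurable" "convex K" if "K \<in> \<D>" for K
      using D(2)[OF that] by auto
    have intK: "interior K = {Inf K<..<Sup K}" if "K \<in> \<D>" for K
      using D(2)[OF that] by auto
    have fin: "measure lebesgue (\<Union>((`) f ` \<D>')) \<le> \<epsilon>" if fD: "\<D>' \<subseteq> \<D>" "finite \<D>'" for \<D>'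
    proof -
      define P where "P = (\<lambda>K. (Inf K, Sup K)) ` \<D>'"
      \<comment> \<open>Absolute continuity sums over a set of end point pairs, while the cover is a
        set of intervals; injectivity lets the two sums be identified.\<close>
      have inj: "inj_on (\<lambda>K. (Inf K, Sup K)) \<D>'"
      proof (rule inj_onI)
        fix K L assume KL: "K \<in> \<D>'" "L \<in> \<D>'" "(Inf K, Sup K) = (Inf L, Sup L)"
        have "K = {Inf K..Sup K}" using DK(1) KL(1) fD(1) by blast
        also have "\<dots> = {Inf L..Sup L}" using KL(3) by simp
        also have "\<dots> = L" using DK(1) KL(2) fD(1) by blast
        finally show "K = L" .
      qed
      have "(\<Sum>(a, b)\<in>P. \<bar>f b - f a\<bar>) < \<epsilon>"
      proof (rule ac)
        show "finite P" using fD P_def by simp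
        show "\<forall>(a, b)\<in>P. a \<le> b \<and> {a..b} \<subseteq> I01"
          using DK fD(1) by (force simp: P_def)
        show "disjoint_family_on (\<lambda>(a, b). {a<..<b}) P"
          unfolding disjoint_family_on_def
        proof (intro ballI impI)
          fix p q assume "p \<in> P" "q \<in> P" and ne: "p \<noteq> q"
          then obtain K L where KL: "K \<in> \<D>'" "p = (Inf K, Sup K)" "L \<in> \<D>'" "q = (Inf L, Sup L)"
            by (auto simp: P_def)
          then have "K \<noteq> L" using ne by auto
          then have "interior K \<inter> interior L = {}" using D(3) KL fD(1) unfolding pairwise_def by blast
          then show "(case p of (a, b) \<Rightarrow> {a<..<b}) \<inter> (case q of (a, b) \<Rightarrow> {a<..<b}) = {}"
            using intK[of K] intK[of L] KL(1,3) fD(1) unfolding KL(2,4) case_prod_conv by (metis subsetD)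
        qed
        have "(\<Sum>(a, b)\<in>P. b - a) = (\<Sum>K\<in>\<D>'. Sup K - Inf K)"
          by (simp add: P_def sum.reindex[OF inj] o_def)
        also have "\<dots> = (\<Sum>K\<in>\<D>'. measure lebesgue K)"
        proof (rule sum.cong)
          fix K assume "K \<in> \<D>'"
          then have "K \<in> \<D>" using fD by auto
          then show "Sup K - Inf K = measure lebesgue K" 
            using arg_cong[OF DK(1), of K "measure lebesgue"] DK(2) by simp
        qed simp
        also have "\<dots> = measure lebesgue (\<Union>\<D>')"
        proof (rule measure_negligible_finite_Union[symmetric])
          show "finite \<D>'" by fact
          show "\<And>S. S \<in> \<D>' \<Longrightarrow> S \<in> lmeasurable" using DKm fD by blast
          \<comment> \<open>Distinct intervals share at most an end point: their intersection is
            convex with empty interior, hence null.\<close>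
          show "pairwise (\<lambda>S T. negligible (S \<inter> T)) \<D>'"
            unfolding pairwise_def
          proof (intro ballI impI)
            fix K L assume KL: "K \<in> \<D>'" "L \<in> \<D>'" "K \<noteq> L"
            then have "interior K \<inter> interior L = {}" using D(3) fD(1) unfolding pairwise_def by blast
            then have "interior (K \<inter> L) = {}" by simp
            moreover have "convex (K \<inter> L)" using DKm KL fD by (intro convex_Int) auto
            ultimately show "negligible (K \<inter> L)" by (simp add: negligible_convex_interior)
          qed
        qed
        also have "\<dots> \<le> measure lebesgue (\<Union>\<D>)"
        proof (rule measure_mono_fmeasurable)
          show "\<Union>\<D>' \<subseteq> \<Union>\<D>" using fD by auto
          have "K \<in> sets lebesgue" if "K \<in> \<D>'" for K
            using DKm fD that by blast
          then show "\<Union>\<D>' \<in> sets lebesgue" using fD by auto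
        qed fact
        also have "\<dots> \<le> \<delta>/2" using D(6) mE by simp
        also have "\<dots> < \<delta>" using \<delta> by simp
        finally show "(\<Sum>(a, b)\<in>P. b - a) < \<delta>" .
      qed
      then have *: "(\<Sum>K\<in>\<D>'. \<bar>f (Sup K) - f (Inf K)\<bar>) < \<epsilon>"
        by (simp add: P_def sum.reindex[OF inj] o_def)
      have "measure lebesgue (\<Union>((`) f ` \<D>')) \<le> (\<Sum>K\<in>\<D>'. measure lebesgue (f ` K))"
        using fD fK by (intro measure_UNION_le) (auto simp: subset_iff)
      also have "\<dots> = (\<Sum>K\<in>\<D>'. \<bar>f (Sup K) - f (Inf K)\<bar>)"
        using fK fD by (intro sum.cong) auto
      finally show ?thesis using * by simp
    qed
    have lm: "\<Union>((`) f ` \<D>) \<in> lmeasurable"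
    proof (rule bounded_set_imp_lmeasurable)
      have "\<Union>((`) f ` \<D>) \<subseteq> I01"
        using H_plus_mem[OF f] DK(3) by blast
      then show "bounded (\<Union>((`) f ` \<D>))" using bounded_subset bounded_closed_interval by blast
      show "\<Union>((`) f ` \<D>) \<in> sets lebesgue"
        using D(1) fK(1) by (intro sets.countable_Union) auto
    qed
    have "measure lebesgue (\<Union>((`) f ` \<D>)) \<le> \<epsilon>"
    proof (rule ccontr)
      assume "\<not> ?thesis"
      then have e: "0 < measure lebesgue (\<Union>((`) f ` \<D>)) - \<epsilon>" by simp
      have fin': "measure lebesgue (\<Union>D') \<le> \<epsilon>" if "D' \<subseteq> (`) f ` \<D>" "finite D'" for D'
        using fin that by (metis finite_subset_image)
      have lmD: "d \<in> lmeasurable" if "d \<in> (`) f ` \<D>" for d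
        using that fK(1) by auto
      obtain D' where "D' \<subseteq> (`) f ` \<D>" "finite D'" 
        "measure lebesgue (\<Union>((`) f ` \<D>)) - (measure lebesgue (\<Union>((`) f ` \<D>)) - \<epsilon>) < measure lebesgue (\<Union>D')"
        by (rule measure_countable_Union_approachable[OF countable_image[OF D(1)] e lmD fin'])
      then show False using fin'[of D'] by simp
    qed
    moreover have "f ` E \<subseteq> \<Union>((`) f ` \<D>)" using D(4) by blast
    ultimately show "\<exists>T. f ` E \<subseteq> T \<and> T \<in> lmeasurable \<and> measure lebesgue T \<le> \<epsilon>"
      using lm by blast
  qed
qed

section \<open>Densities of absolutely continuous homeomorphisms\<close>

text \<open>The measure that sends \<open>E\<close> to the measure of its image under
  \<open>f\<close> is the image of Lebesgue measure under the inverse of \<open>f\<close>. Lusin's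
  condition says that it is absolutely continuous with respect to Lebesgue measure, and
  \<open>D\<close> is its Radon-Nikodym density.\<close>

lemma lusin_N_density:
  assumes f: "f \<in> H_plus" and N: "lusin_N f"
  obtains D :: "real \<Rightarrow> real" where "D \<in> borel_measurable borel" "\<And>x. 0 \<le> D x"
    "integrable lborel D"
    "\<And>x y. x \<in> I01 \<Longrightarrow> y \<in> I01 \<Longrightarrow> x \<le> y \<Longrightarrow> (LINT t:{x..y}|lebesgue. D t) = f y - f x"
proof -
  define g where "g = inv_into I01 f"
  define \<nu> where "\<nu> = distr (restrict_space lborel I01) borel g"
  have gI: "g x \<in> I01" "f (g x) = x" if "x \<in> I01" for x
    using H_plus_inv_mem[OF f that] H_plus_f_inv[OF f that] by (auto simp: g_def)
  have gf: "g (f x) = x" if "x \<in> I01" for x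
    using H_plus_inv_f[OF f that] by (simp add: g_def)
  have fI: "f x \<in> I01" if "x \<in> I01" for x using H_plus_mem[OF f that] .
  have "continuous_on I01 (restrict g I01)" using H_plus_cont[OF H_plus_inv[OF f]] by (simp add: g_def)
  then have contg: "continuous_on I01 g" by (rule continuous_on_eq) simp
  have mg: "g \<in> measurable (restrict_space lborel I01) borel"
    using borel_measurable_continuous_on_restrict[OF contg]
    by (simp add: measurable_def space_restrict_space sets_restrict_space)
  have pre: "g -` E \<inter> I01 = f ` (E \<inter> I01)" for E
  proof (intro equalityI subsetI)
    fix x assume "x \<in> g -` E \<inter> I01"
    then show "x \<in> f ` (E \<inter> I01)" using gI[of x] by (intro image_eqI[of _ _ "g x"]) auto
  next
    fix x assume "x \<in> f ` (E \<inter> I01)"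
    then obtain t where "t \<in> E" "t \<in> I01" "x = f t" by blast
    then show "x \<in> g -` E \<inter> I01" using gf[of t] fI[of t] by auto
  qed
  have \<nu>E: "emeasure \<nu> E = emeasure lborel (f ` (E \<inter> I01))" and imE: "f ` (E \<inter> I01) \<in> sets borel" if "E \<in> sets borel" for E :: "real set"
  proof -
    have "emeasure \<nu> E = emeasure (restrict_space lborel I01) (g -` E \<inter> I01)"
      using that mg by (simp add: \<nu>_def emeasure_distr space_restrict_space)
    also have "\<dots> = emeasure lborel (f ` (E \<inter> I01))"
      using emeasure_restrict_space[of I01 lborel "g -` E \<inter> I01"] unfolding pre[symmetric] by simp
    finally show "emeasure \<nu> E = emeasure lborel (f ` (E \<inter> I01))" .
    have "g -` E \<inter> space (restrict_space lborel I01) \<in> sets (restrict_space lborel I01)"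
      using measurable_sets[OF mg that] .
    then have "g -` E \<inter> I01 \<in> sets borel"
      by (simp add: space_restrict_space sets_restrict_space_iff)
    then show "f ` (E \<inter> I01) \<in> sets borel" by (simp add: pre)
  qed
  have sets\<nu>: "sets \<nu> = sets lborel" by (simp add: \<nu>_def)
  have fin: "finite_measure \<nu>"
  proof (rule finite_measureI)
    have "emeasure \<nu> (space \<nu>) = emeasure lborel I01"
      using \<nu>E[of UNIV] H_plus_image[OF f] by (simp add: \<nu>_def)
    then show "emeasure \<nu> (space \<nu>) \<noteq> \<infinity>" by simp
  qed
  have ac: "absolutely_continuous lborel \<nu>"
    unfolding absolutely_continuous_def
  proof
    fix E :: "real set" assume E: "E \<in> null_sets lborel"
    then have Eb: "E \<in> sets borel" by auto
    have "negligible E" using E by (simp add: negligible_iff_null_sets null_sets_completionI)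
    then have "negligible (f ` (E \<inter> I01))"
      using N unfolding lusin_N_def by (meson Int_lower1 inf_le2 negligible_subset)
    then have "f ` (E \<inter> I01) \<in> null_sets lborel"
      using imE[OF Eb] by (simp add: negligible_iff_null_sets null_sets_completion_iff)
    then show "E \<in> null_sets \<nu>" using \<nu>E[OF Eb] Eb sets\<nu> by (auto simp: null_sets_def)
  qed
  \<comment> \<open>Finiteness of \<open>\<nu>\<close> permits a real-valued version of the
    density.\<close>
  obtain D where D: "D \<in> borel_measurable lborel"
    "AE x in lborel. RN_deriv lborel \<nu> x = ennreal (D x)" "\<And>x. 0 \<le> D x"
    by (rule sigma_finite_measure.real_RN_deriv[OF sigma_finite_lborel fin ac sets\<nu>]) blast
  have dens: "density lborel (RN_deriv lborel \<nu>) = \<nu>"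
    using sigma_finite_measure.density_RN_deriv[OF sigma_finite_lborel ac sets\<nu>] .
  have \<nu>D: "emeasure \<nu> E = (\<integral>\<^sup>+x. ennreal (D x) * indicator E x \<partial>lborel)" if "E \<in> sets borel" for E :: "real set"
  proof -
    have "emeasure \<nu> E = emeasure (density lborel (RN_deriv lborel \<nu>)) E" by (simp only: dens)
    also have "\<dots> = (\<integral>\<^sup>+x. RN_deriv lborel \<nu> x * indicator E x \<partial>lborel)"
      using that by (subst emeasure_density) auto
    also have "\<dots> = (\<integral>\<^sup>+x. ennreal (D x) * indicator E x \<partial>lborel)"
      using D(2) by (intro nn_integral_cong_AE) auto
    finally show ?thesis .
  qed
  have intD: "integrable lborel D"
  proof (rule integrableI_nonneg)
    have "(\<integral>\<^sup>+x. ennreal (D x) \<partial>lborel) = emeasure lborel I01"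
      using \<nu>D[of UNIV] \<nu>E[of UNIV] H_plus_image[OF f] by simp
    then show "(\<integral>\<^sup>+x. ennreal (D x) \<partial>lborel) < \<infinity>" by simp
  qed (use D in auto)
  have "(LINT t:{x..y}|lebesgue. D t) = f y - f x" if xy: "x \<in> I01" "y \<in> I01" "x \<le> y" for x y
  proof -
    have sub: "{x..y} \<inter> I01 = {x..y}" using xy by auto
    have le: "f x \<le> f y" using H_plus_le[OF f xy(1,2)] xy(3) by simp
    have m: "(\<lambda>t. indicator {x..y} t *\<^sub>R D t) \<in> borel_measurable lborel" using D(1) by simp
    have "(LINT t:{x..y}|lebesgue. D t) = (\<integral>t. indicator {x..y} t *\<^sub>R D t \<partial>lborel)"
      unfolding set_lebesgue_integral_def by (rule integral_completion[OF m])
    also have "\<dots> = enn2real (\<integral>\<^sup>+t. ennreal (indicator {x..y} t *\<^sub>R D t) \<partial>lborel)"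
      by (rule integral_eq_nn_integral) (use m D(3) in auto)
    also have "(\<integral>\<^sup>+t. ennreal (indicator {x..y} t *\<^sub>R D t) \<partial>lborel) = emeasure \<nu> {x..y}"
      by (subst \<nu>D) (auto intro!: nn_integral_cong simp: indicator_def)
    also have "\<dots> = ennreal (f y - f x)"
      using \<nu>E[of "{x..y}"] H_plus_image_interval[OF f xy(1,2)] le by (simp add: sub del: Int_atLeastAtMost)
    finally show ?thesis using le by simp
  qed
  with D intD show ?thesis using that[of D] by simp
qed

text \<open>Absolute continuity of the integral: \<open>D\<close> is split into its truncation at
  \<open>n\<close>, which contributes at most \<open>n\<close> times the total length, and an excess
  whose whole integral is below \<epsilon>/2.\<close>

lemma lusin_N_imp_abs_continuous:
  assumes f: "f \<in> H_plus" and N: "lusin_N f"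
  shows "abs_continuous_on I01 f"
proof -
  obtain D :: "real \<Rightarrow> real" where Dm: "D \<in> borel_measurable borel" and D0: "\<And>x. 0 \<le> D x"
    and Di: "integrable lborel D"
    and Df: "\<And>x y. x \<in> I01 \<Longrightarrow> y \<in> I01 \<Longrightarrow> x \<le> y \<Longrightarrow> (LINT t:{x..y}|lebesgue. D t) = f y - f x"
    using lusin_N_density[OF f N] by blast
  have DL: "integrable lebesgue D" using Di by (simp add: integrable_completion Dm)
  show ?thesis
    unfolding abs_continuous_on_def
  proof (intro allI impI)
    fix \<epsilon> :: real assume e: "\<epsilon> > 0"
    have "(\<lambda>n. LINT t|lebesgue. min (D t) (real n)) \<longlonglongrightarrow> (LINT t|lebesgue. D t)"
    proof (rule integral_dominated_convergence[where w=D])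
      show "AE x in lebesgue. (\<lambda>n. min (D x) (real n)) \<longlonglongrightarrow> D x"
      proof (rule AE_I2, rule tendsto_eventually)
        fix x
        show "\<forall>\<^sub>F n in sequentially. min (D x) (real n) = D x"
          using eventually_ge_at_top[of "nat \<lceil>D x\<rceil>"] 
          by eventually_elim (simp add: min_def le_nat_iff ceiling_le_iff nat_le_iff)
      qed
    qed (use DL D0 in \<open>auto simp: borel_measurable_integrable\<close>)
    then obtain n where n: "\<bar>(LINT t|lebesgue. min (D t) (real n)) - (LINT t|lebesgue. D t)\<bar> < \<epsilon>/2"
      using e by (force dest!: LIMSEQ_D[where r="\<epsilon>/2"])
    have Mi: "integrable lebesgue (\<lambda>t. min (D t) (real n))"
      by (rule Bochner_Integration.integrable_bound[OF DL]) (use DL D0 in \<open>auto simp: borel_measurable_integrable\<close>)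
    have tail: "(LINT t|lebesgue. D t - min (D t) (real n)) < \<epsilon>/2"
      using n by (subst Bochner_Integration.integral_diff[OF DL Mi]) (auto simp: abs_if split: if_splits)
    \<comment> \<open>Using \<open>n + 1\<close> instead of \<open>n\<close> avoids a division by
      zero; \<open>n\<close> times \<delta> is then at most \<epsilon>/2.\<close>
    define \<delta> where "\<delta> = \<epsilon> / (2 * (real n + 1))"
    have d: "\<delta> > 0" using e by (simp add: \<delta>_def)
    show "\<exists>\<delta>>0. \<forall>P :: (real \<times> real) set.
        finite P \<longrightarrow> (\<forall>(a, b)\<in>P. a \<le> b \<and> {a..b} \<subseteq> I01) \<longrightarrow>
        disjoint_family_on (\<lambda>(a, b). {a<..<b}) P \<longrightarrow>
        (\<Sum>(a, b)\<in>P. b - a) < \<delta> \<longrightarrow> (\<Sum>(a, b)\<in>P. \<bar>f b - f a\<bar>) < \<epsilon>"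
    proof (intro exI[of _ \<delta>] conjI d allI impI)
      fix P :: "(real \<times> real) set"
      assume fP: "finite P" and P: "\<forall>(a, b)\<in>P. a \<le> b \<and> {a..b} \<subseteq> I01"
        and dj: "disjoint_family_on (\<lambda>(a, b). {a<..<b}) P" and s: "(\<Sum>(a, b)\<in>P. b - a) < \<delta>"
      define J where "J = (\<lambda>p::real \<times> real. {fst p<..<snd p})"
      have djJ: "disjoint_family_on J P" using dj by (simp add: J_def case_prod_unfold)
      have P': "fst p \<le> snd p" "fst p \<in> I01" "snd p \<in> I01" if "p \<in> P" for p
        using P that by (auto simp: case_prod_unfold subset_iff)
      have mJ: "J p \<in> sets lebesgue" for p by (simp add: J_def)
      have Ds: "set_integrable lebesgue A D" if "A \<in> sets lebesgue" for A
        using that DL unfolding set_integrable_def by (intro integrable_mult_indicator)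
      have one: "\<bar>f (snd p) - f (fst p)\<bar> = (LINT t:J p|lebesgue. D t)" if p: "p \<in> P" for p
      proof -
        have "\<bar>f (snd p) - f (fst p)\<bar> = f (snd p) - f (fst p)"
          using H_plus_le[OF f P'(2,3)[OF p]] P'(1)[OF p] by simp
        also have "\<dots> = (LINT t:{fst p..snd p}|lebesgue. D t)"
          using Df[OF P'(2,3,1)[OF p]] by simp
        \<comment> \<open>Only the open intervals are known to be disjoint, so the end points are
          discarded before the integrals are added.\<close>
        also have "\<dots> = (LINT t:J p|lebesgue. D t)"
        proof (rule set_integral_cong_set)
          have "AE x in lborel. x \<noteq> fst p \<and> x \<noteq> snd p"
            using AE_lborel_singleton[of "fst p"] AE_lborel_singleton[of "snd p"] by eventually_elim simp
          then have "AE x in lebesgue. x \<noteq> fst p \<and> x \<noteq> snd p" by (rule AE_completion)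
          then show "AE x in lebesgue. (x \<in> J p) = (x \<in> {fst p..snd p})"
            by eventually_elim (auto simp: J_def)
        qed (use DL mJ Dm in \<open>auto simp: set_borel_measurable_def borel_measurable_integrable measurable_completion\<close>)
        finally show ?thesis .
      qed
      have U: "(\<Union>p\<in>P. J p) \<in> sets lebesgue" "emeasure lebesgue (\<Union>p\<in>P. J p) < \<infinity>"
      proof -
        show m: "(\<Union>p\<in>P. J p) \<in> sets lebesgue" using fP mJ by auto
        have "bounded (\<Union>p\<in>P. J p)" using fP by (auto simp: J_def)
        then show "emeasure lebesgue (\<Union>p\<in>P. J p) < \<infinity>"
          using m by (metis bounded_set_imp_lmeasurable fmeasurableD2 infinity_ennreal_def less_top)
      qed
      have "(\<Sum>(a, b)\<in>P. \<bar>f b - f a\<bar>) = (\<Sum>p\<in>P. LINT t:J p|lebesgue. D t)"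
        unfolding case_prod_unfold using one by (intro sum.cong) auto
      also have "\<dots> = (LINT t:(\<Union>p\<in>P. J p)|lebesgue. D t)"
        by (subst set_integral_finite_Union) (use fP djJ mJ Ds in auto)
      also have "\<dots> \<le> (LINT t|lebesgue. (D t - min (D t) (real n)) + real n * indicator (\<Union>p\<in>P. J p) t)"
        unfolding set_lebesgue_integral_def
      proof (rule integral_mono)
        show "integrable lebesgue (\<lambda>t. indicat_real (\<Union>p\<in>P. J p) t *\<^sub>R D t)"
          using Ds[OF U(1)] by (simp add: set_integrable_def)
        show "integrable lebesgue (\<lambda>t. D t - min (D t) (real n) + real n * indicat_real (\<Union>p\<in>P. J p) t)"
          using Mi DL U by (intro Bochner_Integration.integrable_add Bochner_Integration.integrable_diff) auto
      qed (use D0 in \<open>auto simp: indicator_def\<close>)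
      also have "\<dots> = (LINT t|lebesgue. D t - min (D t) (real n)) + real n * measure lebesgue (\<Union>p\<in>P. J p)"
        using DL Mi U by (subst Bochner_Integration.integral_add) (auto simp: less_top)
      also have "\<dots> < \<epsilon>/2 + \<epsilon>/2"
      proof (rule add_less_le_mono[OF tail])
        have "measure lebesgue (\<Union>p\<in>P. J p) \<le> (\<Sum>p\<in>P. measure lebesgue (J p))"
          using fP by (intro measure_UNION_le mJ)
        also have "\<dots> = (\<Sum>(a, b)\<in>P. b - a)"
          unfolding case_prod_unfold using P'(1) by (intro sum.cong) (auto simp: J_def)
        also have "\<dots> \<le> \<delta>" using s by simp
        finally have "measure lebesgue (\<Union>p\<in>P. J p) \<le> \<delta>" .
        then have "real n * measure lebesgue (\<Union>p\<in>P. J p) \<le> (real n + 1) * \<delta>"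
          by (intro mult_mono) auto
        also have "(real n + 1) * \<delta> = \<epsilon>/2" by (simp add: \<delta>_def field_simps)
        finally show "real n * measure lebesgue (\<Union>p\<in>P. J p) \<le> \<epsilon>/2" .
      qed
      finally have "(\<Sum>(a, b)\<in>P. \<bar>f b - f a\<bar>) < \<epsilon>/2 + \<epsilon>/2" .
      then show "(\<Sum>(a, b)\<in>P. \<bar>f b - f a\<bar>) < \<epsilon>" by simp
    qed
  qed
qed

section \<open>The group and its metric\<close>

lemma abs_continuous_on_cong:
  assumes "\<And>x. x \<in> S \<Longrightarrow> f x = g x"
  shows "abs_continuous_on S f \<longleftrightarrow> abs_continuous_on S g"
proof -
  have "(\<Sum>(a, b)\<in>P. \<bar>f b - f a\<bar>) = (\<Sum>(a, b)\<in>P. \<bar>g b - g a\<bar>)"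
    if "\<forall>(a, b)\<in>P. a \<le> b \<and> {a..b} \<subseteq> S" for P
  proof (intro sum.cong refl)
    fix p assume "p \<in> P"
    with that have "fst p \<in> S" "snd p \<in> S" by (auto simp: case_prod_unfold subset_iff)
    then show "(case p of (a, b) \<Rightarrow> \<bar>f b - f a\<bar>) = (case p of (a, b) \<Rightarrow> \<bar>g b - g a\<bar>)"
      using assms by (simp add: case_prod_unfold)
  qed
  then show ?thesis unfolding abs_continuous_on_def by (intro all_cong ex_cong imp_cong conj_cong refl) simp
qed

text \<open>The inverse is restricted to \<open>I01\<close> because the equivalence of absolute
  continuity and Lusin's condition concerns elements of \<open>H_plus\<close>, which are
  extensional. Both properties see only the values on the interval.\<close>

lemma H_AC_iff:
  "f \<in> H_AC \<longleftrightarrow> f \<in> H_plus \<and> lusin_N f \<and> lusin_N (inv_into I01 f)"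
proof (cases "f \<in> H_plus")
  case True
  let ?g = "restrict (inv_into I01 f) I01"
  have g: "?g \<in> H_plus" using H_plus_inv[OF True] .
  have "abs_continuous_on I01 f \<longleftrightarrow> lusin_N f"
    using True abs_continuous_imp_lusin_N lusin_N_imp_abs_continuous by blast
  moreover have "abs_continuous_on I01 ?g \<longleftrightarrow> lusin_N ?g"
    using g abs_continuous_imp_lusin_N lusin_N_imp_abs_continuous by blast
  moreover have "lusin_N ?g \<longleftrightarrow> lusin_N (inv_into I01 f)" by (rule lusin_N_cong) simp
  moreover have "abs_continuous_on I01 ?g \<longleftrightarrow> abs_continuous_on I01 (inv_into I01 f)"
    by (rule abs_continuous_on_cong) simp
  ultimately show ?thesis using True by (simp add: H_AC_def)
qed (simp add: H_AC_def)

lemma H_AC_H_plus: "f \<in> H_AC \<Longrightarrow> f \<in> H_plus"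
  by (simp add: H_AC_def)

lemma lusin_N_comp:
  assumes "lusin_N f" "lusin_N g" "\<And>x. x \<in> I01 \<Longrightarrow> g x \<in> I01" "\<And>x. x \<in> I01 \<Longrightarrow> h x = f (g x)"
  shows "lusin_N h"
  unfolding lusin_N_def
proof (intro allI impI)
  fix E assume E: "E \<subseteq> I01" "negligible E"
  have "h ` E = f ` (g ` E)" using assms(4) E(1) unfolding image_image by (intro image_cong refl) blast
  moreover have "g ` E \<subseteq> I01" using assms(3) E(1) by blast
  ultimately show "negligible (h ` E)" using assms(1,2) E unfolding lusin_N_def by auto
qed

lemma inv_into_compose:
  assumes "f \<in> H_plus" "g \<in> H_plus" "y \<in> I01"
  shows "inv_into I01 (compose I01 f g) y = inv_into I01 g (inv_into I01 f y)"
proof (rule inv_into_f_eq)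
  show "inj_on (compose I01 f g) I01" using H_plus_inj[OF H_plus_compose[OF assms(1,2)]] .
  have 1: "inv_into I01 f y \<in> I01" using H_plus_inv_mem assms by blast
  then show 2: "inv_into I01 g (inv_into I01 f y) \<in> I01" using H_plus_inv_mem assms by blast
  show "compose I01 f g (inv_into I01 g (inv_into I01 f y)) = y"
    unfolding compose_eq[OF 2] using H_plus_f_inv[OF assms(2) 1] H_plus_f_inv[OF assms(1,3)] by simp
qed

lemma inv_into_restrict_inv_into:
  assumes "f \<in> H_plus" "y \<in> I01"
  shows "inv_into I01 (restrict (inv_into I01 f) I01) y = f y"
proof (rule inv_into_f_eq)
  show "inj_on (restrict (inv_into I01 f) I01) I01" using H_plus_inj[OF H_plus_inv[OF assms(1)]] .
  show fy: "f y \<in> I01" using H_plus_mem assms by blast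
  show "restrict (inv_into I01 f) I01 (f y) = y" 
    unfolding restrict_apply'[OF fy] using H_plus_inv_f[OF assms] .
qed

lemma H_AC_compose:
  assumes "f \<in> H_AC" "g \<in> H_AC"
  shows "compose I01 f g \<in> H_AC"
proof -
  have H: "f \<in> H_plus" "g \<in> H_plus" "lusin_N f" "lusin_N g"
    "lusin_N (inv_into I01 f)" "lusin_N (inv_into I01 g)" using assms by (auto simp: H_AC_iff)
  have "lusin_N (compose I01 f g)"
    by (rule lusin_N_comp[OF H(3,4)]) (use H_plus_mem[OF H(2)] in \<open>auto simp: compose_eq\<close>)
  moreover have "lusin_N (inv_into I01 (compose I01 f g))"
    by (rule lusin_N_comp[OF H(6,5)]) (use H_plus_inv_mem[OF H(1)] inv_into_compose[OF H(1,2)] in auto)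
  ultimately show ?thesis using H_plus_compose H by (simp add: H_AC_iff)
qed

lemma H_AC_inv:
  assumes "f \<in> H_AC"
  shows "restrict (inv_into I01 f) I01 \<in> H_AC"
proof -
  have H: "f \<in> H_plus" "lusin_N f" "lusin_N (inv_into I01 f)" using assms by (auto simp: H_AC_iff)
  have "lusin_N (restrict (inv_into I01 f) I01)"
    using H(3) by (subst lusin_N_cong[of _ "inv_into I01 f"]) auto
  moreover have "lusin_N (inv_into I01 (restrict (inv_into I01 f) I01))"
    using H(2) by (subst lusin_N_cong[OF inv_into_restrict_inv_into[OF H(1)]])
  ultimately show ?thesis using H_plus_inv[OF H(1)] by (simp add: H_AC_iff)
qed

lemma H_AC_id: "(\<lambda>x\<in>I01. x) \<in> H_AC"
proof -
  have H: "(\<lambda>x\<in>I01. x) \<in> H_plus" by (rule H_plusI) (auto simp: strict_mono_on_def)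
  have N: "lusin_N (\<lambda>x. x)" by (simp add: lusin_N_def)
  have "lusin_N (\<lambda>x\<in>I01. x)" using N by (subst lusin_N_cong[of _ "\<lambda>x. x"]) auto
  moreover have "lusin_N (inv_into I01 (\<lambda>x\<in>I01. x))"
    using N H_plus_f_inv[OF H] H_plus_inv_mem[OF H] by (subst lusin_N_cong[of _ "\<lambda>x. x"]) auto
  ultimately show ?thesis using H by (simp add: H_AC_iff)
qed

text \<open>Needed to compute inverses: \<open>H_AC_group\<close> only changes the carrier, so its
  inverse is a new definite description, which agrees with that of \<open>BijGroup\<close> once the
  carrier is a subgroup.\<close>

lemma subgroup_H_AC: "subgroup H_AC (BijGroup I01)"
proof (rule group.subgroupI[OF group_BijGroup])
  show "H_AC \<subseteq> carrier (BijGroup I01)"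
    using H_plus_Bij H_AC_H_plus by (auto simp: BijGroup_def)
  show "H_AC \<noteq> {}" using H_AC_id by blast
  show "inv\<^bsub>BijGroup I01\<^esub> f \<in> H_AC" if "f \<in> H_AC" for f
    using H_AC_inv[OF that] inv_BijGroup[OF H_plus_Bij[OF H_AC_H_plus[OF that]]] by simp
  show "f \<otimes>\<^bsub>BijGroup I01\<^esub> g \<in> H_AC" if "f \<in> H_AC" "g \<in> H_AC" for f g
    using H_AC_compose[OF that] that H_plus_Bij H_AC_H_plus by (simp add: BijGroup_def)
qed

lemma H_AC_group_conj:
  assumes f: "f \<in> H_AC" and g: "g \<in> H_AC"
  shows "g \<otimes>\<^bsub>H_AC_group\<^esub> f \<otimes>\<^bsub>H_AC_group\<^esub> inv\<^bsub>H_AC_group\<^esub> g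
       = compose I01 (compose I01 g f) (restrict (inv_into I01 g) I01)"
proof -
  have "inv\<^bsub>H_AC_group\<^esub> g = inv\<^bsub>BijGroup I01\<^esub> g"
    unfolding H_AC_group_def by (rule group.m_inv_consistent[OF group_BijGroup subgroup_H_AC g])
  also have "\<dots> = restrict (inv_into I01 g) I01"
    by (rule inv_BijGroup[OF H_plus_Bij[OF H_AC_H_plus[OF g]]])
  finally show ?thesis
    using H_plus_Bij[OF H_AC_H_plus[OF g]] H_plus_Bij[OF H_AC_H_plus[OF f]]
      H_plus_Bij[OF H_AC_H_plus[OF H_AC_compose[OF g f]]] H_plus_Bij[OF H_AC_H_plus[OF H_AC_inv[OF g]]]
    by (simp add: H_AC_group_def BijGroup_def)
qed

section \<open>Almost everywhere derivatives and the metric\<close>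

lemma negligible_affine_image:
  fixes E :: "real set"
  assumes "negligible E"
  shows "negligible ((\<lambda>x. a * x + b) ` E)"
  by (rule negligible_differentiable_image_negligible[OF order_refl assms])
    (auto intro!: derivative_intros)

text \<open>Lebesgue differentiation is used for averages over \<open>[x, x + h]\<close> with
  positive \<open>h\<close>, which yields right derivatives. Applied to the reflected function
  \<open>D (- t)\<close> at the point \<open>- x\<close>, it yields the left ones.\<close>

lemma H_AC_derivative:
  assumes "f \<in> H_AC"
  obtains D N where "negligible N" "\<And>x. 0 \<le> D x" "D absolutely_integrable_on I01"
    "\<And>x. x \<in> I01 - N \<Longrightarrow> (f has_real_derivative D x) (at x)"
    "\<And>x y. x \<in> I01 \<Longrightarrow> y \<in> I01 \<Longrightarrow> x \<le> y \<Longrightarrow> integral {x..y} D = f y - f x"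
proof -
  have f: "f \<in> H_plus" "lusin_N f" using assms by (auto simp: H_AC_iff)
  obtain D :: "real \<Rightarrow> real" where Dm: "D \<in> borel_measurable borel" and D0: "\<And>x. 0 \<le> D x"
    and Di: "integrable lborel D"
    and Df: "\<And>x y. x \<in> I01 \<Longrightarrow> y \<in> I01 \<Longrightarrow> x \<le> y \<Longrightarrow> (LINT t:{x..y}|lebesgue. D t) = f y - f x"
    using lusin_N_density[OF f] by blast
  have DL: "integrable lebesgue D" using Di by (simp add: integrable_completion Dm)
  have Ds: "D absolutely_integrable_on A" if "A \<in> sets lebesgue" for A
    using that DL unfolding set_integrable_def by (intro integrable_mult_indicator)
  have Dint: "D integrable_on {x..y}" for x y
    using Ds[of "{x..y}"] by (intro set_lebesgue_integral_eq_integral(1)) simp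
  have DF: "integral {x..y} D = f y - f x" if "x \<in> I01" "y \<in> I01" "x \<le> y" for x y
    using Df[OF that] set_lebesgue_integral_eq_integral(2)[OF Ds[of "{x..y}"]] by simp
  obtain N1 where N1: "negligible N1"
    "\<And>x e. \<lbrakk>x \<notin> N1; 0 < e\<rbrakk> \<Longrightarrow> \<exists>d>0. \<forall>h. 0 < h \<and> h < d \<longrightarrow>
        norm (integral (cbox x (x + h *\<^sub>R One)) D /\<^sub>R h ^ DIM(real) - D x) < e"
    by (rule integrable_ccontinuous_explicit[of D]) (use Dint in auto)
  have Dr: "(\<lambda>t. D (- t)) integrable_on {x..y}" for x y
    using Dint[of "-y" "-x"] Henstock_Kurzweil_Integration.integrable_reflect_real[where f=D and a="-y" and b="-x"] by simp
  obtain N2 where N2: "negligible N2"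
    "\<And>x e. \<lbrakk>x \<notin> N2; 0 < e\<rbrakk> \<Longrightarrow> \<exists>d>0. \<forall>h. 0 < h \<and> h < d \<longrightarrow>
        norm (integral (cbox x (x + h *\<^sub>R One)) (\<lambda>t. D (- t)) /\<^sub>R h ^ DIM(real) - D (- x)) < e"
    by (rule integrable_ccontinuous_explicit[of "\<lambda>t. D (- t)"]) (use Dr in auto)
  \<comment> \<open>The end points are excluded because \<open>f\<close> is \<open>undefined\<close>
    on one side of each.\<close>
  define N where "N = N1 \<union> uminus ` N2 \<union> {0, 1}"
  have "negligible (uminus ` N2)"
    using negligible_affine_image[OF N2(1), of "-1" 0] by (simp add: image_def)
  then have "negligible N" using N1(1) by (simp add: N_def)
  moreover have "(f has_real_derivative D x) (at x)" if x: "x \<in> I01 - N" for x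
    unfolding DERIV_def
  proof (rule LIM_I)
    fix e :: real assume e: "0 < e"
    have x01: "0 < x" "x < 1" "x \<notin> N1" "- x \<notin> N2" using x by (force simp: N_def)+
    obtain d1 where d1: "d1 > 0" "\<And>h. 0 < h \<Longrightarrow> h < d1 \<Longrightarrow> \<bar>integral {x..x+h} D / h - D x\<bar> < e"
      using N1(2)[OF x01(3) e] by (auto simp: field_simps)
    obtain d2 where d2: "d2 > 0" 
      "\<And>h. 0 < h \<Longrightarrow> h < d2 \<Longrightarrow> \<bar>integral {-x..-x+h} (\<lambda>t. D (- t)) / h - D x\<bar> < e"
      using N2(2)[OF x01(4) e] by (auto simp: field_simps)
    define d where "d = Min {d1, d2, x, 1 - x}"
    have d: "d > 0" "d \<le> d1" "d \<le> d2" "d \<le> x" "d \<le> 1 - x" using d1 d2 x01 by (auto simp: d_def)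
    have "\<bar>(f (x + h) - f x) / h - D x\<bar> < e" if h: "h \<noteq> 0" "\<bar>h\<bar> < d" for h
    proof (cases "h > 0")
      case True
      then have "integral {x..x+h} D = f (x + h) - f x" using x01 d h by (intro DF) auto
      then show ?thesis using d1(2)[of h] True h d by simp
    next
      case False
      then have "integral {x+h..x} D = f x - f (x + h)" using x01 d h by (intro DF) auto
      \<comment> \<open>Reflection turns an interval to the left of \<open>x\<close> into one to the
        right of \<open>- x\<close>.\<close>
      moreover have "integral {-x..-(x+h)} (\<lambda>t. D (- t)) = integral {x+h..x} D"
        using Henstock_Kurzweil_Integration.integral_reflect_real[where f=D and a="x+h" and b=x] by blast
      ultimately have "integral {-x..-x+(-h)} (\<lambda>t. D (- t)) = f x - f (x + h)" by (simp add: algebra_simps)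
      then have "\<bar>(f x - f (x + h)) / (-h) - D x\<bar> < e" using d2(2)[of "-h"] False h d by simp
      moreover have "(f x - f (x + h)) / (-h) = (f (x + h) - f x) / h" using h by (simp add: field_simps)
      ultimately show ?thesis by simp
    qed
    then show "\<exists>s>0. \<forall>h. h \<noteq> 0 \<and> norm (h - 0) < s \<longrightarrow> norm ((f (x + h) - f x) / h - D x) < e"
      using d(1) by auto
  qed
  ultimately show ?thesis using that[of N D] D0 DF Ds[of I01] by simp
qed

lemma H_AC_deriv_integrable:
  assumes "f \<in> H_AC"
  shows "deriv f absolutely_integrable_on I01"
proof -
  obtain D N where D: "negligible N" "D absolutely_integrable_on I01"
    "\<And>x. x \<in> I01 - N \<Longrightarrow> (f has_real_derivative D x) (at x)"
    using H_AC_derivative[OF assms] by metis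
  show ?thesis
    by (rule absolutely_integrable_spike[OF D(2,1)]) (rule DERIV_imp_deriv[OF D(3)])
qed

lemma H_AC_integral_deriv:
  assumes "f \<in> H_AC" "x \<in> I01" "y \<in> I01" "x \<le> y"
  shows "integral {x..y} (deriv f) = f y - f x"
proof -
  obtain D N where D: "negligible N"
    "\<And>x. x \<in> I01 - N \<Longrightarrow> (f has_real_derivative D x) (at x)"
    "\<And>x y. x \<in> I01 \<Longrightarrow> y \<in> I01 \<Longrightarrow> x \<le> y \<Longrightarrow> integral {x..y} D = f y - f x"
    using H_AC_derivative[OF assms(1)] by metis
  have "integral {x..y} (deriv f) = integral {x..y} D"
  proof (rule integral_spike[OF D(1)])
    fix t assume "t \<in> {x..y} - N"
    then have "t \<in> I01 - N" using assms by auto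
    then show "D t = deriv f t" using DERIV_imp_deriv[OF D(2)] by metis
  qed
  then show ?thesis using D(3) assms by simp
qed

lemma rho_integrable:
  assumes "f \<in> H_AC" "g \<in> H_AC"
  shows "(\<lambda>x. \<bar>deriv f x - deriv g x\<bar>) absolutely_integrable_on I01"
  using set_integrable_abs[OF set_integral_diff(1)[OF H_AC_deriv_integrable[OF assms(1)] H_AC_deriv_integrable[OF assms(2)]]] .

lemma rho_eq_integral:
  assumes "f \<in> H_AC" "g \<in> H_AC"
  shows "rho f g = integral I01 (\<lambda>x. \<bar>deriv f x - deriv g x\<bar>)"
  unfolding rho_def by (rule set_lebesgue_integral_eq_integral(2)[OF rho_integrable[OF assms]])

text \<open>Both functions vanish at 0, so their difference is the integral of the difference of
  their derivatives. The openness arguments use \<open>rho\<close> through this bound only.\<close>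

lemma abs_diff_le_rho:
  assumes f: "f \<in> H_AC" and g: "g \<in> H_AC" and x: "x \<in> I01"
  shows "\<bar>f x - g x\<bar> \<le> rho f g"
proof -
  have sub: "{0..x} \<subseteq> I01" using x by auto
  have i: "deriv f integrable_on {0..x}" "deriv g integrable_on {0..x}"
    "(\<lambda>t. \<bar>deriv f t - deriv g t\<bar>) integrable_on {0..x}" "(\<lambda>t. \<bar>deriv f t - deriv g t\<bar>) integrable_on I01"
    using H_AC_deriv_integrable[OF f] H_AC_deriv_integrable[OF g] rho_integrable[OF f g] sub
    by (auto intro!: set_lebesgue_integral_eq_integral(1) intro: set_integrable_subset)
  have "f x - g x = integral {0..x} (deriv f) - integral {0..x} (deriv g)"
    using H_AC_integral_deriv[OF f, of 0 x] H_AC_integral_deriv[OF g, of 0 x] x 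
      H_plus_0[OF H_AC_H_plus[OF f]] H_plus_0[OF H_AC_H_plus[OF g]] by simp
  also have "\<dots> = integral {0..x} (\<lambda>t. deriv f t - deriv g t)"
    using i by (simp add: Henstock_Kurzweil_Integration.integral_diff)
  finally have "\<bar>f x - g x\<bar> \<le> integral {0..x} (\<lambda>t. \<bar>deriv f t - deriv g t\<bar>)"
    using integral_norm_bound_integral[of "\<lambda>t. deriv f t - deriv g t" "{0..x}" "\<lambda>t. \<bar>deriv f t - deriv g t\<bar>"] i
    by (simp add: integrable_diff)
  also have "\<dots> \<le> integral I01 (\<lambda>t. \<bar>deriv f t - deriv g t\<bar>)"
    using i sub by (intro integral_subset_le) auto
  finally show ?thesis by (simp only: rho_eq_integral[OF f g])
qed

text \<open>For definiteness, \<open>rho f g = 0\<close> forces equality on the interval by the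
  uniform bound, and off the interval both functions are \<open>undefined\<close>.\<close>

lemma Metric_space_rho: "Metric_space H_AC rho"
proof
  show nn: "0 \<le> rho f g" for f g
    unfolding rho_def set_lebesgue_integral_def by (intro Bochner_Integration.integral_nonneg) auto
  show "rho f g = rho g f" for f g by (simp add: rho_def abs_minus_commute)
  show "rho f g = 0 \<longleftrightarrow> f = g" if fg: "f \<in> H_AC" "g \<in> H_AC" for f g
  proof
    assume "rho f g = 0"
    then have "f x = g x" if "x \<in> I01" for x using abs_diff_le_rho[OF fg that] by simp
    then show "f = g" using fg H_plus_ext[OF H_AC_H_plus] by (metis extensionalityI)
  qed (simp add: rho_def)
  show "rho f h \<le> rho f g + rho g h" if fgh: "f \<in> H_AC" "g \<in> H_AC" "h \<in> H_AC" for f g h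
  proof -
    have i: "(\<lambda>x. \<bar>deriv f x - deriv g x\<bar>) integrable_on I01" "(\<lambda>x. \<bar>deriv g x - deriv h x\<bar>) integrable_on I01"
      "(\<lambda>x. \<bar>deriv f x - deriv h x\<bar>) integrable_on I01"
      using rho_integrable[OF fgh(1,2)] rho_integrable[OF fgh(2,3)] rho_integrable[OF fgh(1,3)] 
      by (auto intro!: set_lebesgue_integral_eq_integral(1))
    show ?thesis
      unfolding rho_eq_integral[OF fgh(1,2)] rho_eq_integral[OF fgh(2,3)] rho_eq_integral[OF fgh(1,3)]
        Henstock_Kurzweil_Integration.integral_add[OF i(1,2), symmetric]
      using i by (intro integral_le integrable_add) auto
  qed
qed

section \<open>Orbitals\<close>

text \<open>
  Three sign changes, not one: near a fixed point that ends an orbital, the first of the four points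
  may lie in that orbital, and only the second and third are sure to lie in orbitals of both parities
  strictly beyond it.
\<close>

definition alternates :: "(real \<Rightarrow> real) \<Rightarrow> real set \<Rightarrow> bool" where
  "alternates v S \<longleftrightarrow> (\<exists>x1\<in>S. \<exists>x2\<in>S. \<exists>x3\<in>S. \<exists>x4\<in>S. x1 < x2 \<and> x2 < x3 \<and> x3 < x4 \<and>
     v x1 * v x2 < 0 \<and> v x2 * v x3 < 0 \<and> v x3 * v x4 < 0)"

lemma alternates_mono: "alternates v S \<Longrightarrow> S \<subseteq> T \<Longrightarrow> alternates v T"
  unfolding alternates_def by (meson subsetD)

lemma FixI: "x \<in> I01 \<Longrightarrow> f x = x \<Longrightarrow> x \<in> Fix f"
  and Fix_mem: "x \<in> Fix f \<Longrightarrow> x \<in> I01"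
  and Fix_eq: "x \<in> Fix f \<Longrightarrow> f x = x"
  by (simp_all add: Fix_def)

lemma Fix_0: "f \<in> H_plus \<Longrightarrow> 0 \<in> Fix f" and Fix_1: "f \<in> H_plus \<Longrightarrow> 1 \<in> Fix f"
  by (simp_all add: Fix_def H_plus_0 H_plus_1)

lemma compact_Fix:
  assumes "f \<in> H_plus"
  shows "compact (Fix f)"
proof -
  have "continuous_on I01 (\<lambda>x. f x - x)" using H_plus_cont[OF assms] by (intro continuous_intros)
  then have "closed {x \<in> I01. f x - x = 0}"
    using continuous_closed_preimage_constant closed_atLeastAtMost by blast
  moreover have "{x \<in> I01. f x - x = 0} = Fix f" by (auto simp: Fix_def)
  ultimately have "closed (Fix f)" by simp
  moreover have "bounded (Fix f)"
    by (rule bounded_subset[OF bounded_closed_interval[of 0 1]]) (auto simp: Fix_def)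
  ultimately show ?thesis by (simp add: compact_eq_bounded_closed)
qed

lemma sign_change_Fix:
  assumes f: "f \<in> H_plus" and xy: "x \<in> I01" "y \<in> I01" "x < y" and s: "(f x - x) * (f y - y) < 0"
  obtains z where "z \<in> Fix f" "x < z" "z < y"
proof -
  have c: "continuous_on {x..y} (\<lambda>x. f x - x)"
    using H_plus_cont[OF f] xy by (intro continuous_intros) (auto intro: continuous_on_subset)
  have "\<exists>z. x \<le> z \<and> z \<le> y \<and> f z - z = 0"
  proof (cases "f x - x < 0")
    case True
    then have "0 < f y - y" using s by (simp add: mult_less_0_iff)
    then show ?thesis using True xy c by (intro IVT') auto
  next
    case False
    then have "f x - x > 0" "f y - y < 0" using s by (auto simp: mult_less_0_iff)
    then show ?thesis using xy c by (intro IVT2') auto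
  qed
  then obtain z where z: "x \<le> z" "z \<le> y" "f z = z" by auto
  then have "z \<noteq> x" "z \<noteq> y" using s by auto
  then show ?thesis using z xy by (intro that[of z] FixI) auto
qed

text \<open>The end points are the nearest fixed points on either side of \<open>x\<close>; they
  exist because \<open>Fix f\<close> is compact and contains 0 and 1.\<close>

lemma orbital_interval:
  assumes f: "f \<in> H_plus" and x: "x \<in> I01" "f x \<noteq> x"
  obtains a b where "a \<in> Fix f" "b \<in> Fix f" "a < x" "x < b" "orbital f x = {a<..<b}"
    "{a<..<b} \<inter> Fix f = {}" "{a<..<b} \<subseteq> I01"
proof -
  define A where "A = Fix f \<inter> {..x}"
  define B where "B = Fix f \<inter> {x..}"
  have cpt: "compact A" "compact B" 
    unfolding A_def B_def using compact_Fix[OF f] by (auto intro: compact_Int_closed)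
  have ne: "A \<noteq> {}" "B \<noteq> {}" using Fix_0[OF f] Fix_1[OF f] x by (auto simp: A_def B_def)
  obtain a where a: "a \<in> A" "\<And>t. t \<in> A \<Longrightarrow> t \<le> a" using compact_attains_sup[OF cpt(1) ne(1)] by blast
  obtain b where b: "b \<in> B" "\<And>t. t \<in> B \<Longrightarrow> b \<le> t" using compact_attains_inf[OF cpt(2) ne(2)] by blast
  have nf: "x \<notin> Fix f" using x by (simp add: Fix_def)
  have ab: "a \<in> Fix f" "b \<in> Fix f" "a < x" "x < b"
    using a b nf by (auto simp: A_def B_def less_le)
  have ni: "{a<..<b} \<inter> Fix f = {}"
  proof (rule ccontr)
    assume "{a<..<b} \<inter> Fix f \<noteq> {}"
    then obtain t where "t \<in> Fix f" "a < t" "t < b" by auto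
    then show False using a(2)[of t] b(2)[of t] by (cases "t \<le> x") (auto simp: A_def B_def)
  qed
  have sub: "{a<..<b} \<subseteq> I01" using Fix_mem[OF ab(1)] Fix_mem[OF ab(2)] by auto
  have "connected_component_set (I01 - Fix f) x = {a<..<b}"
  proof
    show "{a<..<b} \<subseteq> connected_component_set (I01 - Fix f) x"
      by (rule connected_component_maximal) (use ab ni sub in auto)
    show "connected_component_set (I01 - Fix f) x \<subseteq> {a<..<b}"
    proof
      fix t assume t: "t \<in> connected_component_set (I01 - Fix f) x"
      let ?C = "connected_component_set (I01 - Fix f) x"
      have C: "connected ?C" "?C \<subseteq> I01 - Fix f" by (auto simp: connected_component_subset)
      have xC: "x \<in> ?C" using connected_component_refl[of x "I01 - Fix f"] x nf by simp
      have "a < t"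
      proof (rule ccontr)
        assume "\<not> a < t"
        then have "a \<in> ?C" using connectedD_interval[OF C(1) t xC, of a] ab by auto
        then show False using C(2) ab by auto
      qed
      moreover have "t < b"
      proof (rule ccontr)
        assume "\<not> t < b"
        then have "b \<in> ?C" using connectedD_interval[OF C(1) xC t, of b] ab by auto
        then show False using C(2) ab by auto
      qed
      ultimately show "t \<in> {a<..<b}" by simp
    qed
  qed
  then have "orbital f x = {a<..<b}" using nf by (simp add: orbital_def)
  then show ?thesis using that ab ni sub by blast
qed

lemma orbital_self: "f \<in> H_plus \<Longrightarrow> x \<in> I01 \<Longrightarrow> f x \<noteq> x \<Longrightarrow> x \<in> orbital f x"
  by (metis orbital_interval greaterThanLessThan_iff)

lemma same_sign:
  assumes f: "f \<in> H_plus" and xy: "x \<in> I01" "y \<in> I01" and n: "f x \<noteq> x" "f y \<noteq> y"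
    and nz: "\<not> (\<exists>z\<in>Fix f. x < z \<and> z < y)" "\<not> (\<exists>z\<in>Fix f. y < z \<and> z < x)"
  shows "(f x - x) * (f y - y) > 0"
proof (rule ccontr)
  assume "\<not> ?thesis"
  moreover have "(f x - x) * (f y - y) \<noteq> 0" using n by simp
  ultimately have s: "(f x - x) * (f y - y) < 0" by linarith
  then have "x \<noteq> y" using zero_le_square[of "f y - y"] by auto
  then consider "x < y" | "y < x" by linarith
  then show False
    using sign_change_Fix[OF f xy _ s] sign_change_Fix[OF f xy(2,1) _ s[unfolded mult.commute[of "f x - x"]]] nz
    by cases blast+
qed

lemma orbital_eq:
  assumes "f \<in> H_plus" "x \<in> I01" "f x \<noteq> x" "y \<in> orbital f x"
  shows "orbital f y = orbital f x" "y \<in> I01" "f y \<noteq> y"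
proof -
  obtain a b where ab: "orbital f x = {a<..<b}" "{a<..<b} \<inter> Fix f = {}" "{a<..<b} \<subseteq> I01"
    using orbital_interval[OF assms(1-3)] by metis
  show y1: "y \<in> I01" using assms(4) ab(1,3) by blast
  have "y \<notin> Fix f" using assms(4) ab(1,2) by blast
  then show y2: "f y \<noteq> y" using FixI[OF y1] by blast
  note y = y1 y2
  have "x \<notin> Fix f" "y \<notin> Fix f" using assms(3) y by (auto simp: Fix_def)
  then show "orbital f y = orbital f x"
    using assms(4) connected_component_eq[of y "I01 - Fix f" x] by (simp add: orbital_def)
qed

text \<open>Replaces the order of sets by a relation between representatives: one component of the
  complement of \<open>Fix f\<close> precedes another iff a fixed point separates them. From here on
  orbitals are handled through their points.\<close>

lemma orbital_less_iff:
  assumes f: "f \<in> H_plus" and x: "x \<in> I01" "f x \<noteq> x" and y: "y \<in> I01" "f y \<noteq> y"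
  shows "(orbital f x, orbital f y) \<in> orbital_order f \<longleftrightarrow> (\<exists>z\<in>Fix f. x < z \<and> z < y)"
proof -
  obtain a b where ab: "a \<in> Fix f" "b \<in> Fix f" "a < x" "x < b" "orbital f x = {a<..<b}" "{a<..<b} \<inter> Fix f = {}"
    using orbital_interval[OF f x] by metis
  obtain c d where cd: "c \<in> Fix f" "d \<in> Fix f" "c < y" "y < d" "orbital f y = {c<..<d}" "{c<..<d} \<inter> Fix f = {}"
    using orbital_interval[OF f y] by metis
  have nz: "orbital f x \<in> nonzero_orbitals f" "orbital f y \<in> nonzero_orbitals f"
    using x y by (auto simp: nonzero_orbitals_def positive_orbitals_def negative_orbitals_def neq_iff)
  show ?thesis
  proof
    assume "(orbital f x, orbital f y) \<in> orbital_order f"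
    then have *: "u < v" if "u \<in> orbital f x" "v \<in> orbital f y" for u v
      using that by (auto simp: orbital_order_def)
    have xo: "x \<in> orbital f x" "y \<in> orbital f y" using orbital_self[OF f] x y by blast+
    have "x < y" using *[OF xo] .
    show "\<exists>z\<in>Fix f. x < z \<and> z < y"
    proof (rule bexI[of _ b])
      show "x < b \<and> b < y"
      proof (rule ccontr)
        assume "\<not> (x < b \<and> b < y)"
        then have "y \<le> b" using ab(4) by linarith
        moreover have "y \<noteq> b" using y ab(2) Fix_eq by blast
        ultimately have "y \<in> orbital f x" using ab(3) \<open>x < y\<close> unfolding ab(5) by simp
        then show False using *[OF _ xo(2), of y] by simp
      qed
    qed (rule ab(2))
  next
    assume "\<exists>z\<in>Fix f. x < z \<and> z < y"
    then obtain z where z: "z \<in> Fix f" "x < z" "z < y" by blast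
    have "b \<le> z"
    proof (rule ccontr)
      assume "\<not> b \<le> z"
      then have "z \<in> {a<..<b} \<inter> Fix f" using z ab(3) by simp
      then show False using ab(6) by blast
    qed
    have "z \<le> c"
    proof (rule ccontr)
      assume "\<not> z \<le> c"
      then have "z \<in> {c<..<d} \<inter> Fix f" using z cd(4) by simp
      then show False using cd(6) by blast
    qed
    have "u < v" if uv: "u \<in> orbital f x" "v \<in> orbital f y" for u v
    proof -
      have "u < b" "c < v" using uv unfolding ab(5) cd(5) by simp_all
      then show ?thesis using \<open>b \<le> z\<close> \<open>z \<le> c\<close> by linarith
    qed
    then show "(orbital f x, orbital f y) \<in> orbital_order f" unfolding orbital_order_def using nz by blast
  qed
qed

section \<open>Membership in \<open>C_set\<close> as a statement about points\<close>

lemma nonzero_orbitals_iff: "J \<in> nonzero_orbitals f \<longleftrightarrow> (\<exists>x\<in>I01. f x \<noteq> x \<and> J = orbital f x)"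
  by (auto simp: nonzero_orbitals_def positive_orbitals_def negative_orbitals_def neq_iff)

text \<open>Supplies the density clause of the linear order from the density of the orbitals of one
  parity.\<close>

lemma dense_subset_of_order_carrier: 
  assumes "dense_subset_of_order A r D"
  shows "dense_subset_of_order A r A"
  unfolding dense_subset_of_order_def
proof (intro conjI ballI impI)
  fix a b assume "a \<in> A" "b \<in> A" "(a, b) \<in> r"
  then obtain d where "d \<in> D" "(a, d) \<in> r" "(d, b) \<in> r"
    using assms unfolding dense_subset_of_order_def by meson
  moreover have "D \<subseteq> A" using assms by (simp add: dense_subset_of_order_def)
  ultimately show "\<exists>d\<in>A. (a, d) \<in> r \<and> (d, b) \<in> r" by blast
qed simp

text \<open>The translation of the order holds for non-fixed points of the interval only, so it is
  no unconditional rewrite rule under the quantifiers. Here and in \<open>neighbour_cong\<close> the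
  guards are carried along.\<close>

lemma between_cong:
  assumes RS: "\<And>x y. x \<in> I \<Longrightarrow> N x \<Longrightarrow> y \<in> I \<Longrightarrow> N y \<Longrightarrow> R x y \<longleftrightarrow> S x y" and QN: "\<And>p. Q p \<Longrightarrow> N p"
  shows "(\<forall>x\<in>I. N x \<longrightarrow> (\<forall>y\<in>I. N y \<longrightarrow> R x y \<longrightarrow> (\<exists>p\<in>I. Q p \<and> R x p \<and> R p y))) \<longleftrightarrow>
    (\<forall>x\<in>I. \<forall>y\<in>I. N x \<longrightarrow> N y \<longrightarrow> S x y \<longrightarrow> (\<exists>p\<in>I. Q p \<and> S x p \<and> S p y))"
proof -
  have "(\<exists>p\<in>I. Q p \<and> R x p \<and> R p y) \<longleftrightarrow> (\<exists>p\<in>I. Q p \<and> S x p \<and> S p y)" if "x \<in> I" "N x" "y \<in> I" "N y" for x y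
    by (intro bex_cong conj_cong refl RS QN that)
  then have "(\<forall>x\<in>I. N x \<longrightarrow> (\<forall>y\<in>I. N y \<longrightarrow> R x y \<longrightarrow> (\<exists>p\<in>I. Q p \<and> R x p \<and> R p y))) \<longleftrightarrow>
    (\<forall>x\<in>I. N x \<longrightarrow> (\<forall>y\<in>I. N y \<longrightarrow> S x y \<longrightarrow> (\<exists>p\<in>I. Q p \<and> S x p \<and> S p y)))"
    by (intro ball_cong imp_cong refl RS)
  then show ?thesis by simp
qed

lemma neighbour_cong:
  assumes RS: "\<And>x y. x \<in> I \<Longrightarrow> N x \<Longrightarrow> y \<in> I \<Longrightarrow> N y \<Longrightarrow> R x y \<longleftrightarrow> S x y"
  shows "(\<forall>x\<in>I. N x \<longrightarrow> (\<exists>y\<in>I. N y \<and> R x y)) \<longleftrightarrow> (\<forall>x\<in>I. N x \<longrightarrow> (\<exists>y\<in>I. N y \<and> S x y))"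
  by (intro ball_cong imp_cong bex_cong conj_cong refl RS)

lemma between_conj:
  "(\<forall>x\<in>I. \<forall>y\<in>I. N x \<longrightarrow> N y \<longrightarrow> S x y \<longrightarrow> P x y \<and> Q x y) \<longleftrightarrow>
   (\<forall>x\<in>I. \<forall>y\<in>I. N x \<longrightarrow> N y \<longrightarrow> S x y \<longrightarrow> P x y) \<and>
   (\<forall>x\<in>I. \<forall>y\<in>I. N x \<longrightarrow> N y \<longrightarrow> S x y \<longrightarrow> Q x y)"
  by blast

text \<open>Orbitals are disjoint intervals, so their order is strict and linear for every
  \<open>f\<close> in \<open>H_plus\<close>. The remaining clauses, on non-emptiness, density and
  end points, are read on points through \<open>orbital_less_iff\<close>.\<close>

lemma C_set_iff:
  "f \<in> C_set \<longleftrightarrow> f \<in> H_plus \<and> (\<exists>x\<in>I01. f x \<noteq> x) \<and>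
     (\<forall>x\<in>I01. \<forall>y\<in>I01. f x \<noteq> x \<longrightarrow> f y \<noteq> y \<longrightarrow> (\<exists>z\<in>Fix f. x < z \<and> z < y) \<longrightarrow>
        (\<exists>p\<in>I01. p < f p \<and> (\<exists>z\<in>Fix f. x < z \<and> z < p) \<and> (\<exists>z\<in>Fix f. p < z \<and> z < y)) \<and>
        (\<exists>p\<in>I01. f p < p \<and> (\<exists>z\<in>Fix f. x < z \<and> z < p) \<and> (\<exists>z\<in>Fix f. p < z \<and> z < y))) \<and>
     (\<forall>x\<in>I01. f x \<noteq> x \<longrightarrow> (\<exists>y\<in>I01. f y \<noteq> y \<and> (\<exists>z\<in>Fix f. y < z \<and> z < x))) \<and>
     (\<forall>x\<in>I01. f x \<noteq> x \<longrightarrow> (\<exists>y\<in>I01. f y \<noteq> y \<and> (\<exists>z\<in>Fix f. x < z \<and> z < y)))"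
  (is "_ \<longleftrightarrow> _ \<and> ?ne \<and> ?dense \<and> ?below \<and> ?above")
proof (cases "f \<in> H_plus")
  case f: True
  let ?A = "nonzero_orbitals f" and ?r = "orbital_order f"
  note less = orbital_less_iff[OF f]
  have A_eq: "?A = orbital f ` {x \<in> I01. f x \<noteq> x}"
  proof (rule subset_antisym; rule subsetI)
    fix J assume "J \<in> ?A"
    then show "J \<in> orbital f ` {x \<in> I01. f x \<noteq> x}" unfolding nonzero_orbitals_iff by blast
  next
    fix J assume "J \<in> orbital f ` {x \<in> I01. f x \<noteq> x}"
    then show "J \<in> ?A" unfolding nonzero_orbitals_iff by blast
  qed
  have all: "(\<forall>J\<in>?A. P J) \<longleftrightarrow> (\<forall>x\<in>I01. f x \<noteq> x \<longrightarrow> P (orbital f x))"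
    and ex: "(\<exists>J\<in>?A. P J) \<longleftrightarrow> (\<exists>x\<in>I01. f x \<noteq> x \<and> P (orbital f x))" for P
    unfolding A_eq by blast+
  have exp: "(\<exists>J\<in>positive_orbitals f. P J) \<longleftrightarrow> (\<exists>x\<in>I01. x < f x \<and> P (orbital f x))"
    and exn: "(\<exists>J\<in>negative_orbitals f. P J) \<longleftrightarrow> (\<exists>x\<in>I01. f x < x \<and> P (orbital f x))" for P
    unfolding positive_orbitals_def negative_orbitals_def by blast+
  have sub: "?r \<subseteq> ?A \<times> ?A" by (auto simp: orbital_order_def)
  have rD: "J \<in> ?A" "K \<in> ?A" "\<And>u v. u \<in> J \<Longrightarrow> v \<in> K \<Longrightarrow> u < v" if "(J, K) \<in> ?r" for J K
    using that by (auto simp: orbital_order_def)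
  have nonempty: "\<exists>y. y \<in> J" if J: "J \<in> ?A" for J
  proof -
    obtain y where "J = orbital f y" "y \<in> I01" "f y \<noteq> y" using J unfolding nonzero_orbitals_iff by blast
    then show ?thesis using orbital_self[OF f] by blast
  qed
  have "trans ?r"
  proof (rule transI)
    fix J K L assume JK: "(J, K) \<in> ?r" and KL: "(K, L) \<in> ?r"
    \<comment> \<open>A point of the middle orbital is needed to chain the two inequalities.\<close>
    obtain y where y: "y \<in> K" using nonempty rD(1)[OF KL] by blast
    have "u < v" if "u \<in> J" "v \<in> L" for u v
      using rD(3)[OF JK that(1) y] rD(3)[OF KL y that(2)] by simp
    then show "(J, L) \<in> ?r" using rD(1)[OF JK] rD(2)[OF KL] by (simp add: orbital_order_def)
  qed
  moreover have "irrefl ?r"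
  proof (rule irreflI)
    fix J show "(J, J) \<notin> ?r" using nonempty[of J] rD[of J J] by blast
  qed
  moreover have "total_on ?A ?r"
    unfolding total_on_def
  proof (intro ballI impI)
    fix J K assume "J \<in> ?A" "K \<in> ?A" "J \<noteq> K"
    obtain x where x: "x \<in> I01" "f x \<noteq> x" "J = orbital f x" 
      using \<open>J \<in> ?A\<close> unfolding nonzero_orbitals_iff by blast
    obtain y where y: "y \<in> I01" "f y \<noteq> y" "K = orbital f y"
      using \<open>K \<in> ?A\<close> unfolding nonzero_orbitals_iff by blast
    note xy = x y
    show "(J, K) \<in> ?r \<or> (K, J) \<in> ?r"
    proof (rule ccontr)
      assume "\<not> ?thesis"
      then have nz: "\<not> (\<exists>z\<in>Fix f. x < z \<and> z < y)" "\<not> (\<exists>z\<in>Fix f. y < z \<and> z < x)"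
        using less[OF x(1,2) y(1,2)] less[OF y(1,2) x(1,2)] xy(3,6) by simp_all
      obtain a b where ab: "a \<in> Fix f" "b \<in> Fix f" "a < x" "x < b" "orbital f x = {a<..<b}"
        using orbital_interval[OF f xy(1,2)] by metis
      have "y \<noteq> a" "y \<noteq> b" using ab xy Fix_eq by blast+
      \<comment> \<open>With no fixed point between them, \<open>x\<close> and \<open>y\<close> lie
        between the same two neighbouring fixed points.\<close>
      then have "y \<in> orbital f x" using nz ab(1-4) unfolding ab(5) greaterThanLessThan_iff by (meson linorder_neqE_linordered_idom)
      then show False using orbital_eq[OF f xy(1,2)] \<open>J \<noteq> K\<close> xy by blast
    qed
  qed
  ultimately have lin: "strict_linear_order_on ?A ?r" by (simp add: strict_linear_order_on_def)
  have dp: "dense_subset_of_order ?A ?r (positive_orbitals f) \<longleftrightarrow>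
     (\<forall>x\<in>I01. \<forall>y\<in>I01. f x \<noteq> x \<longrightarrow> f y \<noteq> y \<longrightarrow> (\<exists>z\<in>Fix f. x < z \<and> z < y) \<longrightarrow>
        (\<exists>p\<in>I01. p < f p \<and> (\<exists>z\<in>Fix f. x < z \<and> z < p) \<and> (\<exists>z\<in>Fix f. p < z \<and> z < y)))"
  proof -
    have X: "positive_orbitals f \<subseteq> ?A" by (simp add: nonzero_orbitals_def)
    have "dense_subset_of_order ?A ?r (positive_orbitals f) \<longleftrightarrow>
      (\<forall>x\<in>I01. f x \<noteq> x \<longrightarrow> (\<forall>y\<in>I01. f y \<noteq> y \<longrightarrow> (orbital f x, orbital f y) \<in> ?r \<longrightarrow>
        (\<exists>p\<in>I01. p < f p \<and> (orbital f x, orbital f p) \<in> ?r \<and> (orbital f p, orbital f y) \<in> ?r)))"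
      unfolding dense_subset_of_order_def all exp using X by (simp only: simp_thms)
    also have "\<dots> \<longleftrightarrow> (\<forall>x\<in>I01. \<forall>y\<in>I01. f x \<noteq> x \<longrightarrow> f y \<noteq> y \<longrightarrow> (\<exists>z\<in>Fix f. x < z \<and> z < y) \<longrightarrow>
        (\<exists>p\<in>I01. p < f p \<and> (\<exists>z\<in>Fix f. x < z \<and> z < p) \<and> (\<exists>z\<in>Fix f. p < z \<and> z < y)))"
      by (rule between_cong[where N="\<lambda>x. f x \<noteq> x" and R="\<lambda>x y. (orbital f x, orbital f y) \<in> orbital_order f" and S="\<lambda>x y. \<exists>z\<in>Fix f. x < z \<and> z < y" and Q="\<lambda>p. p < f p"]) (rule less, assumption+, simp)
    finally show ?thesis .
  qed
  have dn: "dense_subset_of_order ?A ?r (negative_orbitals f) \<longleftrightarrow>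
     (\<forall>x\<in>I01. \<forall>y\<in>I01. f x \<noteq> x \<longrightarrow> f y \<noteq> y \<longrightarrow> (\<exists>z\<in>Fix f. x < z \<and> z < y) \<longrightarrow>
        (\<exists>p\<in>I01. f p < p \<and> (\<exists>z\<in>Fix f. x < z \<and> z < p) \<and> (\<exists>z\<in>Fix f. p < z \<and> z < y)))"
  proof -
    have X: "negative_orbitals f \<subseteq> ?A" by (simp add: nonzero_orbitals_def)
    have "dense_subset_of_order ?A ?r (negative_orbitals f) \<longleftrightarrow>
      (\<forall>x\<in>I01. f x \<noteq> x \<longrightarrow> (\<forall>y\<in>I01. f y \<noteq> y \<longrightarrow> (orbital f x, orbital f y) \<in> ?r \<longrightarrow>
        (\<exists>p\<in>I01. f p < p \<and> (orbital f x, orbital f p) \<in> ?r \<and> (orbital f p, orbital f y) \<in> ?r)))"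
      unfolding dense_subset_of_order_def all exn using X by (simp only: simp_thms)
    also have "\<dots> \<longleftrightarrow> (\<forall>x\<in>I01. \<forall>y\<in>I01. f x \<noteq> x \<longrightarrow> f y \<noteq> y \<longrightarrow> (\<exists>z\<in>Fix f. x < z \<and> z < y) \<longrightarrow>
        (\<exists>p\<in>I01. f p < p \<and> (\<exists>z\<in>Fix f. x < z \<and> z < p) \<and> (\<exists>z\<in>Fix f. p < z \<and> z < y)))"
      by (rule between_cong[where N="\<lambda>x. f x \<noteq> x" and R="\<lambda>x y. (orbital f x, orbital f y) \<in> orbital_order f" and S="\<lambda>x y. \<exists>z\<in>Fix f. x < z \<and> z < y" and Q="\<lambda>p. f p < p"]) (rule less, assumption+, simp)
    finally show ?thesis .
  qed
  note dd = dense_subset_of_order_carrier[of ?A ?r "positive_orbitals f"]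
  have ne: "?A \<noteq> {} \<longleftrightarrow> ?ne" unfolding ex_in_conv[symmetric] nonzero_orbitals_iff by blast
  have be: "(\<forall>a\<in>?A. \<exists>b\<in>?A. (b, a) \<in> ?r) \<longleftrightarrow> ?below"
    unfolding all ex 
    by (rule neighbour_cong[where N="\<lambda>x. f x \<noteq> x" and R="\<lambda>x y. (orbital f y, orbital f x) \<in> orbital_order f" and S="\<lambda>x y. \<exists>z\<in>Fix f. y < z \<and> z < x"]) (rule less, assumption+)
  have ab: "(\<forall>a\<in>?A. \<exists>b\<in>?A. (a, b) \<in> ?r) \<longleftrightarrow> ?above"
    unfolding all ex 
    by (rule neighbour_cong[where N="\<lambda>x. f x \<noteq> x" and R="\<lambda>x y. (orbital f x, orbital f y) \<in> orbital_order f" and S="\<lambda>x y. \<exists>z\<in>Fix f. x < z \<and> z < y"]) (rule less, assumption+)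
  have dense_iff: "?dense \<longleftrightarrow> dense_subset_of_order ?A ?r (positive_orbitals f) \<and>
     dense_subset_of_order ?A ?r (negative_orbitals f)"
    unfolding dp dn by (rule between_conj)
  let ?P = "dense_subset_of_order ?A ?r (positive_orbitals f)" and ?N = "dense_subset_of_order ?A ?r (negative_orbitals f)"
  have "f \<in> C_set \<longleftrightarrow> f \<in> H_plus \<and> ?A \<noteq> {} \<and> (?P \<and> ?N) \<and>
      (\<forall>a\<in>?A. \<exists>b\<in>?A. (b, a) \<in> ?r) \<and> (\<forall>a\<in>?A. \<exists>b\<in>?A. (a, b) \<in> ?r)"
    (is "_ \<longleftrightarrow> _ \<and> ?ne' \<and> _ \<and> ?be' \<and> ?ab'")
  proof
    assume "f \<in> C_set"
    then have *: "dense_linear_order_without_endpoints ?A ?r" "?P" "?N"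
      unfolding C_set_def by blast+
    have "?ne'" "?be'" "?ab'"
      using *(1) unfolding dense_linear_order_without_endpoints_def by blast+
    then show "f \<in> H_plus \<and> ?ne' \<and> (?P \<and> ?N) \<and> ?be' \<and> ?ab'" using f *(2,3) by (intro conjI)
  next
    assume H: "f \<in> H_plus \<and> ?ne' \<and> (?P \<and> ?N) \<and> ?be' \<and> ?ab'"
    then have H': "?ne'" "?P" "?N" "?be'" "?ab'" by blast+
    have "dense_linear_order_without_endpoints ?A ?r"
      unfolding dense_linear_order_without_endpoints_def by (intro conjI H' sub lin dd)
    then show "f \<in> C_set" unfolding C_set_def using f H'(2,3) by (intro CollectI conjI)
  qed
  also have "\<dots> \<longleftrightarrow> f \<in> H_plus \<and> ?ne \<and> ?dense \<and> ?below \<and> ?above"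
    unfolding ne dense_iff be ab by (rule refl)
  finally show ?thesis .
qed (simp add: C_set_def)

lemma nonfixed_in_interval:
  assumes "negligible (Fix f)" "a < b" "{a<..<b} \<subseteq> I01"
  obtains x where "a < x" "x < b" "f x \<noteq> x" "x \<in> I01"
proof -
  have "\<not> negligible {a<..<b}" using assms(2) negligible_interval(2)[of a b] by simp
  then have "\<not> {a<..<b} \<subseteq> Fix f" using assms(1) negligible_subset by blast
  then obtain x where "x \<in> {a<..<b}" "x \<notin> Fix f" by blast
  then show ?thesis using assms(3) by (intro that[of x]) (auto simp: Fix_def)
qed

text \<open>Forward: near a fixed point there are two non-fixed points with a fixed point between
  them, and density inserts orbitals of alternating parity there. Backward: the alternation is
  applied at the fixed point where the orbital of \<open>x\<close> ends, and at 0 and 1 to exclude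
  extreme orbitals.\<close>

lemma C_set_iff_alternates:
  assumes f: "f \<in> H_plus" and null: "negligible (Fix f)"
  shows "f \<in> C_set \<longleftrightarrow> (\<forall>p\<in>Fix f. \<forall>e>0. alternates (\<lambda>x. f x - x) (I01 \<inter> ball p e))"
proof
  assume "f \<in> C_set"
  then have dense: "\<And>x y. x \<in> I01 \<Longrightarrow> y \<in> I01 \<Longrightarrow> f x \<noteq> x \<Longrightarrow> f y \<noteq> y \<Longrightarrow> \<exists>z\<in>Fix f. x < z \<and> z < y \<Longrightarrow>
        (\<exists>p\<in>I01. p < f p \<and> (\<exists>z\<in>Fix f. x < z \<and> z < p) \<and> (\<exists>z\<in>Fix f. p < z \<and> z < y)) \<and>
        (\<exists>p\<in>I01. f p < p \<and> (\<exists>z\<in>Fix f. x < z \<and> z < p) \<and> (\<exists>z\<in>Fix f. p < z \<and> z < y))"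
    and below: "\<And>x. x \<in> I01 \<Longrightarrow> f x \<noteq> x \<Longrightarrow> \<exists>y\<in>I01. f y \<noteq> y \<and> (\<exists>z\<in>Fix f. y < z \<and> z < x)"
    and above: "\<And>x. x \<in> I01 \<Longrightarrow> f x \<noteq> x \<Longrightarrow> \<exists>y\<in>I01. f y \<noteq> y \<and> (\<exists>z\<in>Fix f. x < z \<and> z < y)"
    by (simp_all add: C_set_iff)
  show "\<forall>p\<in>Fix f. \<forall>e>0. alternates (\<lambda>x. f x - x) (I01 \<inter> ball p e)"
  proof (intro ballI allI impI)
    fix p e :: real assume p: "p \<in> Fix f" and e: "e > 0"
    have pI: "p \<in> I01" using Fix_mem[OF p] .
    have "\<exists>x y. x \<in> I01 \<inter> ball p e \<and> y \<in> I01 \<inter> ball p e \<and> f x \<noteq> x \<and> f y \<noteq> y \<and> (\<exists>z\<in>Fix f. x < z \<and> z < y)"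
    proof -
      consider "p = 0" | "p = 1" | "0 < p" "p < 1" using pI by force
      then show ?thesis
      proof cases
        case 1
        \<comment> \<open>There is nothing to the left of 0. The second point comes from the absence
          of a least orbital; as it lies between 0 and \<open>x\<close>, it is in the ball.\<close>
        obtain x where x: "0 < x" "x < min e 1" "f x \<noteq> x" "x \<in> I01"
          by (rule nonfixed_in_interval[OF null, of 0 "min e 1"]) (use e in auto)
        obtain y where "y \<in> I01" "f y \<noteq> y" "\<exists>z\<in>Fix f. y < z \<and> z < x" using below x by blast
        then show ?thesis using x 1 by (intro exI[of _ y] exI[of _ x]) (auto simp: dist_real_def)
      next
        case 2
        obtain x where x: "max (1 - e) 0 < x" "x < 1" "f x \<noteq> x" "x \<in> I01"
          by (rule nonfixed_in_interval[OF null, of "max (1 - e) 0" 1]) (use e in auto)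
        obtain y where "y \<in> I01" "f y \<noteq> y" "\<exists>z\<in>Fix f. x < z \<and> z < y" using above x by blast
        then show ?thesis using x 2 by (intro exI[of _ x] exI[of _ y]) (auto simp: dist_real_def)
      next
        case 3
        obtain x where x: "max (p - e) 0 < x" "x < p" "f x \<noteq> x" "x \<in> I01"
          by (rule nonfixed_in_interval[OF null, of "max (p - e) 0" p]) (use e 3 in auto)
        obtain y where y: "p < y" "y < min (p + e) 1" "f y \<noteq> y" "y \<in> I01"
          by (rule nonfixed_in_interval[OF null, of p "min (p + e) 1"]) (use e 3 in auto)
        show ?thesis using x y p by (intro exI[of _ x] exI[of _ y]) (auto simp: dist_real_def)
      qed
    qed
    then obtain x y where xy: "x \<in> I01 \<inter> ball p e" "y \<in> I01 \<inter> ball p e" "f x \<noteq> x" "f y \<noteq> y"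
      "\<exists>z\<in>Fix f. x < z \<and> z < y" by blast
    have xI: "x \<in> I01" and yI: "y \<in> I01" using xy(1,2) by blast+
    have btw: "t \<in> I01 \<inter> ball p e" if "t \<in> I01" "x < t" "t < y" for t
      using that xy(1,2) by (auto simp: dist_real_def)
    obtain x1 where x1: "x1 \<in> I01" "x1 < f x1" "\<exists>z\<in>Fix f. x < z \<and> z < x1" "\<exists>z\<in>Fix f. x1 < z \<and> z < y"
      using dense[OF xI yI xy(3,4,5)] by blast
    then have n1: "f x1 \<noteq> x1" by simp
    obtain x2 where x2: "x2 \<in> I01" "f x2 < x2" "\<exists>z\<in>Fix f. x1 < z \<and> z < x2" "\<exists>z\<in>Fix f. x2 < z \<and> z < y"
      using dense[OF x1(1) yI n1 xy(4) x1(4)] by blast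
    then have n2: "f x2 \<noteq> x2" by simp
    obtain x3 where x3: "x3 \<in> I01" "x3 < f x3" "\<exists>z\<in>Fix f. x2 < z \<and> z < x3" "\<exists>z\<in>Fix f. x3 < z \<and> z < y"
      using dense[OF x2(1) yI n2 xy(4) x2(4)] by blast
    then have n3: "f x3 \<noteq> x3" by simp
    obtain x4 where x4: "x4 \<in> I01" "f x4 < x4" "\<exists>z\<in>Fix f. x3 < z \<and> z < x4" "\<exists>z\<in>Fix f. x4 < z \<and> z < y"
      using dense[OF x3(1) yI n3 xy(4) x3(4)] by blast
    then have n4: "f x4 \<noteq> x4" by simp
    have o: "x < x1" "x1 < x2" "x2 < x3" "x3 < x4" "x4 < y" using x1 x2 x3 x4 by force+
    show "alternates (\<lambda>x. f x - x) (I01 \<inter> ball p e)"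
      unfolding alternates_def
    proof (rule bexI[of _ x1], rule bexI[of _ x2], rule bexI[of _ x3], rule bexI[of _ x4], intro conjI)
      show "x1 \<in> I01 \<inter> ball p e" "x2 \<in> I01 \<inter> ball p e" "x3 \<in> I01 \<inter> ball p e" "x4 \<in> I01 \<inter> ball p e"
        using btw[OF x1(1)] btw[OF x2(1)] btw[OF x3(1)] btw[OF x4(1)] o by auto
      show "(f x1 - x1) * (f x2 - x2) < 0" using x1(2) x2(2) by (intro mult_pos_neg) auto
      show "(f x2 - x2) * (f x3 - x3) < 0" using x2(2) x3(2) by (intro mult_neg_pos) auto
      show "(f x3 - x3) * (f x4 - x4) < 0" using x3(2) x4(2) by (intro mult_pos_neg) auto
    qed (fact o)+
  qed
next
  assume alt: "\<forall>p\<in>Fix f. \<forall>e>0. alternates (\<lambda>x. f x - x) (I01 \<inter> ball p e)"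
  obtain x0 where x0: "0 < x0" "x0 < 1" "f x0 \<noteq> x0" "x0 \<in> I01" by (rule nonfixed_in_interval[OF null, of 0 1]) auto
  have dense: "(\<exists>p\<in>I01. p < f p \<and> (\<exists>z\<in>Fix f. x < z \<and> z < p) \<and> (\<exists>z\<in>Fix f. p < z \<and> z < y)) \<and>
        (\<exists>p\<in>I01. f p < p \<and> (\<exists>z\<in>Fix f. x < z \<and> z < p) \<and> (\<exists>z\<in>Fix f. p < z \<and> z < y))"
    if x: "x \<in> I01" "f x \<noteq> x" and y: "y \<in> I01" "f y \<noteq> y" and z: "\<exists>z\<in>Fix f. x < z \<and> z < y" for x y
  proof -
    obtain a b where ab: "b \<in> Fix f" "a < x" "x < b" "{a<..<b} \<inter> Fix f = {}"
      using orbital_interval[OF f x] by metis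
    obtain z where z: "z \<in> Fix f" "x < z" "z < y" using z by blast
    have "b \<le> z" using z ab by (metis disjoint_iff greaterThanLessThan_iff less_trans not_le)
    then have by': "b < y" using z by simp
    \<comment> \<open>The radius keeps the four points strictly between \<open>x\<close> and
      \<open>y\<close>; the fixed points found between neighbours then separate \<open>x2\<close>
      and \<open>x3\<close> from both.\<close>
    have "alternates (\<lambda>x. f x - x) (I01 \<inter> ball b (min (b - x) (y - b)))" using alt ab by' by simp
    then obtain x1 x2 x3 x4 where X0: "{x1, x2, x3, x4} \<subseteq> I01 \<inter> ball b (min (b - x) (y - b))"
      "x1 < x2" "x2 < x3" "x3 < x4" 
      "(f x1 - x1) * (f x2 - x2) < 0" "(f x2 - x2) * (f x3 - x3) < 0" "(f x3 - x3) * (f x4 - x4) < 0"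
      unfolding alternates_def by blast
    then have "x1 \<in> I01" "x2 \<in> I01" "x3 \<in> I01" "x4 \<in> I01" "x < x1" "x4 < y"
      by (auto simp: dist_real_def)
    note X = this X0(2-)
    obtain z1 where z1: "z1 \<in> Fix f" "x1 < z1" "z1 < x2" using sign_change_Fix[OF f X(1,2,7,10)] .
    obtain z2 where z2: "z2 \<in> Fix f" "x2 < z2" "z2 < x3" using sign_change_Fix[OF f X(2,3,8,11)] .
    obtain z3 where z3: "z3 \<in> Fix f" "x3 < z3" "z3 < x4" using sign_change_Fix[OF f X(3,4,9,12)] .
    have l2: "\<exists>z\<in>Fix f. x < z \<and> z < x2" using z1 X by (intro bexI[of _ z1]) auto
    have l3: "\<exists>z\<in>Fix f. x < z \<and> z < x3" using z2 X by (intro bexI[of _ z2]) auto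
    have u2: "\<exists>z\<in>Fix f. x2 < z \<and> z < y" using z2 X by (intro bexI[of _ z2]) auto
    have u3: "\<exists>z\<in>Fix f. x3 < z \<and> z < y" using z3 X by (intro bexI[of _ z3]) auto
    from X(11) consider "x2 < f x2" "f x3 < x3" | "f x2 < x2" "x3 < f x3"
      by (auto simp: mult_less_0_iff)
    then show ?thesis
    proof cases
      case 1 show ?thesis using 1 l2 l3 u2 u3 X(2,3) by blast
    next
      case 2 show ?thesis using 2 l2 l3 u2 u3 X(2,3) by blast
    qed
  qed
  have below: "\<exists>y\<in>I01. f y \<noteq> y \<and> (\<exists>z\<in>Fix f. y < z \<and> z < x)" if x: "x \<in> I01" "f x \<noteq> x" for x
  proof -
    have "x > 0" using x H_plus_0[OF f] by (cases "x = 0") auto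
    \<comment> \<open>Within radius \<open>x\<close> of 0 every point lies to the left of
      \<open>x\<close>, so the sign change occurs before \<open>x\<close>.\<close>
    then have "alternates (\<lambda>x. f x - x) (I01 \<inter> ball 0 x)" using alt Fix_0[OF f] by simp
    then obtain x1 x2 where X: "x1 \<in> I01 \<inter> ball 0 x" "x2 \<in> I01 \<inter> ball 0 x" "x1 < x2" "(f x1 - x1) * (f x2 - x2) < 0"
      unfolding alternates_def by blast
    then have X: "x1 \<in> I01" "x2 \<in> I01" "x2 < x" "x1 < x2" "(f x1 - x1) * (f x2 - x2) < 0"
      by (auto simp: dist_real_def)
    obtain z1 where z1: "z1 \<in> Fix f" "x1 < z1" "z1 < x2" using sign_change_Fix[OF f X(1,2,4,5)] .
    have "f x1 \<noteq> x1" using X(5) by auto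
    then show ?thesis using X z1 by (intro bexI[of _ x1] conjI bexI[of _ z1]) auto
  qed
  have above: "\<exists>y\<in>I01. f y \<noteq> y \<and> (\<exists>z\<in>Fix f. x < z \<and> z < y)" if x: "x \<in> I01" "f x \<noteq> x" for x
  proof -
    have "x < 1" using x H_plus_1[OF f] by (cases "x = 1") auto
    then have "alternates (\<lambda>x. f x - x) (I01 \<inter> ball 1 (1 - x))" using alt Fix_1[OF f] by simp
    then obtain x1 x2 where X: "x1 \<in> I01 \<inter> ball 1 (1 - x)" "x2 \<in> I01 \<inter> ball 1 (1 - x)" "x1 < x2" "(f x1 - x1) * (f x2 - x2) < 0"
      unfolding alternates_def by blast
    then have X: "x1 \<in> I01" "x2 \<in> I01" "x < x1" "x1 < x2" "(f x1 - x1) * (f x2 - x2) < 0"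
      by (auto simp: dist_real_def)
    obtain z1 where z1: "z1 \<in> Fix f" "x1 < z1" "z1 < x2" using sign_change_Fix[OF f X(1,2,4,5)] .
    have "f x2 \<noteq> x2" using X(5) by auto
    then show ?thesis using X z1 by (intro bexI[of _ x2] conjI bexI[of _ z1]) auto
  qed
  show "f \<in> C_set"
    unfolding C_set_iff using f x0 dense below above by blast
qed

lemma C_AC_iff:
  "f \<in> C_AC \<longleftrightarrow> f \<in> H_AC \<and> negligible (Fix f) \<and>
     (\<forall>p\<in>Fix f. \<forall>e>0. alternates (\<lambda>x. f x - x) (I01 \<inter> ball p e))"
  using C_set_iff_alternates H_AC_H_plus
  by (auto simp: C_AC_def N_set_def negligible_iff_null_sets)

section \<open>The G-delta property\<close>

interpretation H_AC: Metric_space H_AC rho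
  by (rule Metric_space_rho)

lemma openin_H_AC_topology:
  assumes "S \<subseteq> H_AC" and "\<And>f. f \<in> S \<Longrightarrow> \<exists>e>0. \<forall>g\<in>H_AC. rho f g < e \<longrightarrow> g \<in> S"
  shows "openin H_AC_topology S"
  unfolding H_AC_topology_def H_AC.openin_mtopology
proof (intro conjI ballI allI impI assms(1))
  fix f assume "f \<in> S"
  then obtain e where "e > 0" "\<forall>g\<in>H_AC. rho f g < e \<longrightarrow> g \<in> S" using assms(2) by blast
  then show "\<exists>r>0. H_AC.mball f r \<subseteq> S" by (intro exI[of _ e]) auto
qed

lemma compact_sublevel:
  fixes v :: "real \<Rightarrow> real"
  assumes "continuous_on I01 v"
  shows "compact {x \<in> I01. \<bar>v x\<bar> \<le> e}"
proof -
  have cont: "continuous_on I01 (\<lambda>x. \<bar>v x\<bar>)" using assms by (intro continuous_intros)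
  have "closed {x \<in> I01. \<bar>v x\<bar> \<le> e}"
    using continuous_closed_preimage[OF cont closed_atLeastAtMost closed_atMost[of e]]
    by (simp add: vimage_def Int_def)
  moreover have "bounded {x \<in> I01. \<bar>v x\<bar> \<le> e}"
    by (rule bounded_subset[OF bounded_closed_interval[of 0 1]]) blast
  ultimately show ?thesis by (simp add: compact_eq_bounded_closed)
qed

text \<open>The zero set is the decreasing intersection of the compact sets where
  \<open>|v| \<le> 1 / (k + 1)\<close>, so the measures converge. This serves both the openness of
  the condition on \<open>Fix f\<close> and the choice of the width of a perturbation.\<close>

lemma measure_sublevel:
  fixes v :: "real \<Rightarrow> real"
  assumes cont: "continuous_on I01 v" and r: "measure lebesgue {x \<in> I01. v x = 0} < r"
  obtains e where "e > 0" "\<And>d. d \<le> e \<Longrightarrow> measure lebesgue {x \<in> I01. \<bar>v x\<bar> \<le> d} < r"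
proof -
  define A where "A = (\<lambda>k::nat. {x \<in> I01. \<bar>v x\<bar> \<le> 1 / real (Suc k)})"
  have lm: "A k \<in> lmeasurable" for k
    unfolding A_def by (intro lmeasurable_compact compact_sublevel cont)
  have fin: "emeasure lebesgue (A k) \<noteq> \<infinity>" for k using fmeasurableD2[OF lm] by simp
  have dec: "decseq A"
  proof (rule decseq_SucI, rule subsetI)
    fix k x assume x: "x \<in> A (Suc k)"
    have "1 / real (Suc (Suc k)) \<le> 1 / real (Suc k)" by (intro divide_left_mono) auto
    with x show "x \<in> A k" by (auto simp: A_def)
  qed
  have int: "(\<Inter>k. A k) = {x \<in> I01. v x = 0}"
  proof (intro equalityI subsetI)
    fix x assume x: "x \<in> (\<Inter>k. A k)"
    have "\<bar>v x\<bar> \<le> 0"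
    proof (rule ccontr)
      assume "\<not> ?thesis"
      then obtain k where "1 / real (Suc k) < \<bar>v x\<bar>"
        using reals_Archimedean[of "\<bar>v x\<bar>"] by (auto simp: inverse_eq_divide)
      moreover have "x \<in> A k" using x by blast
      ultimately show False by (simp add: A_def)
    qed
    moreover have "x \<in> A 0" using x by blast
    ultimately show "x \<in> {x \<in> I01. v x = 0}" by (simp add: A_def)
  qed (auto simp: A_def)
  have "(\<lambda>k. measure lebesgue (A k)) \<longlonglongrightarrow> measure lebesgue (\<Inter>k. A k)"
    by (rule Lim_measure_decseq[OF _ dec]) (use fmeasurableD[OF lm] fin in blast)+
  then have "\<forall>\<^sub>F k in sequentially. measure lebesgue (A k) < r"
    using r unfolding int by (rule order_tendstoD(2))
  then obtain k where k: "measure lebesgue (A k) < r" by (auto simp: eventually_sequentially)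
  show ?thesis
  proof (rule that[of "1 / real (Suc k)"])
    fix d assume d: "d \<le> 1 / real (Suc k)"
    have "{x \<in> I01. \<bar>v x\<bar> \<le> d} \<subseteq> A k"
      unfolding A_def by (intro Collect_mono impI conjI) (use d in \<open>blast intro: order_trans\<close>)+
    then have "measure lebesgue {x \<in> I01. \<bar>v x\<bar> \<le> d} \<le> measure lebesgue (A k)"
      by (rule measure_mono_fmeasurable[OF _ fmeasurableD[OF lmeasurable_compact[OF compact_sublevel[OF cont]]] lm])
    then show "measure lebesgue {x \<in> I01. \<bar>v x\<bar> \<le> d} < r" using k by simp
  qed simp
qed

text \<open>If \<open>g\<close> is closer to \<open>f\<close> than \<open>e\<close>, then
  \<open>f\<close> moves every fixed point of \<open>g\<close> by at most \<open>e\<close>. Hence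
  \<open>Fix g\<close> lies in a sublevel set of \<open>|f x - x|\<close>, whose measure is still
  below \<open>r\<close> for small \<open>e\<close>.\<close>

lemma openin_measure_Fix:
  "openin H_AC_topology {f \<in> H_AC. measure lebesgue (Fix f) < r}"
proof (rule openin_H_AC_topology)
  fix f assume f: "f \<in> {f \<in> H_AC. measure lebesgue (Fix f) < r}"
  then have fH: "f \<in> H_AC" and fr: "measure lebesgue (Fix f) < r" and fP: "f \<in> H_plus"
    using H_AC_H_plus by auto
  have cont: "continuous_on I01 (\<lambda>x. f x - x)"
    using H_plus_cont[OF fP] by (intro continuous_intros)
  have "{x \<in> I01. f x - x = 0} = Fix f" by (simp add: Fix_def)
  then have "measure lebesgue {x \<in> I01. f x - x = 0} < r" using fr by metis
  then obtain e where e: "e > 0" "\<And>d. d \<le> e \<Longrightarrow> measure lebesgue {x \<in> I01. \<bar>f x - x\<bar> \<le> d} < r"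
    using measure_sublevel[OF cont] by blast
  show "\<exists>e>0. \<forall>g\<in>H_AC. rho f g < e \<longrightarrow> g \<in> {f \<in> H_AC. measure lebesgue (Fix f) < r}"
  proof (intro exI[of _ e] conjI ballI impI e(1))
    fix g assume g: "g \<in> H_AC" "rho f g < e"
    have "Fix g \<subseteq> {x \<in> I01. \<bar>f x - x\<bar> \<le> e}"
    proof
      fix x assume "x \<in> Fix g"
      then have x: "x \<in> I01" "g x = x" using Fix_mem Fix_eq by blast+
      then show "x \<in> {x \<in> I01. \<bar>f x - x\<bar> \<le> e}" using abs_diff_le_rho[OF fH g(1) x(1)] g(2) by simp
    qed
    then have "measure lebesgue (Fix g) \<le> measure lebesgue {x \<in> I01. \<bar>f x - x\<bar> \<le> e}"
      by (rule measure_mono_fmeasurable[OF _ fmeasurableD[OF lmeasurable_compact[OF compact_Fix[OF H_AC_H_plus[OF g(1)]]]]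
        lmeasurable_compact[OF compact_sublevel[OF cont]]])
    then show "g \<in> {f \<in> H_AC. measure lebesgue (Fix f) < r}" using g e(2)[of e] by simp
  qed
qed blast

lemma mult_neg_perturb:
  fixes a b a' b' :: real
  assumes "a * b < 0" "\<bar>a - a'\<bar> < \<bar>a\<bar>" "\<bar>b - b'\<bar> < \<bar>b\<bar>"
  shows "a' * b' < 0"
  using assms by (auto simp: mult_less_0_iff abs_if split: if_splits)

text \<open>Here \<open>e\<close> is the smallest of the four absolute values, so a function closer
  than that has the same signs at the four points.\<close>

lemma alternates_perturb:
  assumes "alternates v S"
  obtains e where "e > 0" "\<And>w. (\<And>x. x \<in> S \<Longrightarrow> \<bar>v x - w x\<bar> < e) \<Longrightarrow> alternates w S"
proof -
  obtain x1 x2 x3 x4 where X: "x1 \<in> S" "x2 \<in> S" "x3 \<in> S" "x4 \<in> S" "x1 < x2" "x2 < x3" "x3 < x4"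
    "v x1 * v x2 < 0" "v x2 * v x3 < 0" "v x3 * v x4 < 0"
    using assms unfolding alternates_def by blast
  define e where "e = min (min \<bar>v x1\<bar> \<bar>v x2\<bar>) (min \<bar>v x3\<bar> \<bar>v x4\<bar>)"
  have le: "e \<le> \<bar>v x1\<bar>" "e \<le> \<bar>v x2\<bar>" "e \<le> \<bar>v x3\<bar>" "e \<le> \<bar>v x4\<bar>" by (auto simp: e_def)
  show ?thesis
  proof (rule that[of e])
    show "e > 0" using X(8-10) by (auto simp: e_def)
    fix w assume w: "\<And>x. x \<in> S \<Longrightarrow> \<bar>v x - w x\<bar> < e"
    have c: "\<bar>v x1 - w x1\<bar> < \<bar>v x1\<bar>" "\<bar>v x2 - w x2\<bar> < \<bar>v x2\<bar>" "\<bar>v x3 - w x3\<bar> < \<bar>v x3\<bar>" "\<bar>v x4 - w x4\<bar> < \<bar>v x4\<bar>"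
      using w[OF X(1)] w[OF X(2)] w[OF X(3)] w[OF X(4)] le by linarith+
    show "alternates w S"
      unfolding alternates_def
      using X(1-7) mult_neg_perturb[OF X(8) c(1,2)] mult_neg_perturb[OF X(9) c(2,3)]
        mult_neg_perturb[OF X(10) c(3,4)] by blast
  qed
qed

text \<open>Fixed points vary with \<open>f\<close>, so the condition is attached to a ball instead.
  The ball that must avoid \<open>Fix f\<close> is closed: then \<open>|f x - x|\<close> has a
  positive minimum on it, which makes this alternative open.\<close>

lemma openin_alternates:
  "openin H_AC_topology {f \<in> H_AC. Fix f \<inter> cball q r = {} \<or> alternates (\<lambda>x. f x - x) (I01 \<inter> ball q (2 * r))}"
  (is "openin _ ?S")
proof (rule openin_H_AC_topology)
  fix f assume "f \<in> ?S"
  then have fH: "f \<in> H_AC" and fP: "f \<in> H_plus"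
    and "Fix f \<inter> cball q r = {} \<or> alternates (\<lambda>x. f x - x) (I01 \<inter> ball q (2 * r))"
    using H_AC_H_plus by auto
  then consider "Fix f \<inter> cball q r = {}" | "alternates (\<lambda>x. f x - x) (I01 \<inter> ball q (2 * r))" by blast
  then show "\<exists>e>0. \<forall>g\<in>H_AC. rho f g < e \<longrightarrow> g \<in> ?S"
  proof cases
    case 1
    show ?thesis
    \<comment> \<open>Attaining a minimum needs a non-empty set; a ball disjoint from the interval
      meets no \<open>Fix g\<close> at all.\<close>
    proof (cases "I01 \<inter> cball q r = {}")
      case True
      then have "Fix g \<inter> cball q r = {}" for g using Fix_mem by blast
      then show ?thesis by (intro exI[of _ 1]) auto
    next
      case False
      have cpt: "compact (I01 \<inter> cball q r)" by (intro compact_Int_closed) auto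
      have "continuous_on (I01 \<inter> cball q r) f" 
        using H_plus_cont[OF fP] by (rule continuous_on_subset) blast
      then have "continuous_on (I01 \<inter> cball q r) (\<lambda>x. \<bar>f x - x\<bar>)" by (intro continuous_intros)
      then obtain x0 where x0: "x0 \<in> I01 \<inter> cball q r" "\<forall>x\<in>I01 \<inter> cball q r. \<bar>f x0 - x0\<bar> \<le> \<bar>f x - x\<bar>"
        using continuous_attains_inf[OF cpt False] by blast
      have "f x0 \<noteq> x0" using 1 x0(1) FixI[of x0 f] by blast
      then have pos: "\<bar>f x0 - x0\<bar> > 0" by simp
      show ?thesis
      proof (intro exI[of _ "\<bar>f x0 - x0\<bar>"] conjI ballI impI pos)
        fix g assume g: "g \<in> H_AC" "rho f g < \<bar>f x0 - x0\<bar>"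
        have "x \<notin> Fix g" if "x \<in> cball q r" for x
        proof
          assume x: "x \<in> Fix g"
          then have xI: "x \<in> I01" by (rule Fix_mem)
          have "\<bar>f x - x\<bar> < \<bar>f x0 - x0\<bar>" using abs_diff_le_rho[OF fH g(1) xI] g(2) Fix_eq[OF x] by simp
          moreover have "\<bar>f x0 - x0\<bar> \<le> \<bar>f x - x\<bar>" using x0(2) xI that by blast
          ultimately show False by simp
        qed
        then show "g \<in> ?S" using g(1) by blast
      qed
    qed
  next
    case 2
    obtain e where e: "e > 0" 
      "\<And>w. (\<And>x. x \<in> I01 \<inter> ball q (2 * r) \<Longrightarrow> \<bar>(f x - x) - w x\<bar> < e) \<Longrightarrow> alternates w (I01 \<inter> ball q (2 * r))"
      using alternates_perturb[OF 2] by blast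
    show ?thesis
    proof (intro exI[of _ e] conjI ballI impI e(1))
      fix g assume g: "g \<in> H_AC" "rho f g < e"
      have "alternates (\<lambda>x. g x - x) (I01 \<inter> ball q (2 * r))"
      proof (rule e(2))
        fix x assume "x \<in> I01 \<inter> ball q (2 * r)"
        then have "x \<in> I01" by blast
        then show "\<bar>f x - x - (g x - x)\<bar> < e" using abs_diff_le_rho[OF fH g(1)] g(2) by fastforce
      qed
      then show "g \<in> ?S" using g(1) by blast
    qed
  qed
qed blast

lemma topspace_H_AC_topology: "topspace H_AC_topology = H_AC"
  by (simp add: H_AC_topology_def)

text \<open>The doubled radius makes the conditions on rational balls equivalent to the one on fixed
  points. If a fixed point \<open>p\<close> lies in \<open>cball q r\<close>, then
  \<open>ball p r\<close> is inside \<open>ball q (2 * r)\<close>; conversely, for \<open>p\<close>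
  within \<open>r\<close> of \<open>q\<close>, \<open>ball q (2 * r)\<close> is inside
  \<open>ball p e\<close> as soon as \<open>r < e / 3\<close>.\<close>

lemma gdelta_C_AC: "gdelta_in H_AC_topology C_AC"
proof -
  define N where "N = (\<lambda>n::nat. {f \<in> H_AC. measure lebesgue (Fix f) < 1 / real (Suc n)})"
  define T where "T = (\<lambda>(q::real, r::real). {f \<in> H_AC. Fix f \<inter> cball q r = {} \<or> alternates (\<lambda>x. f x - x) (I01 \<inter> ball q (2 * r))})"
  define Q where "Q = (\<rat> :: real set) \<times> (\<rat> \<inter> {0::real<..})"
  have cQ: "countable Q" unfolding Q_def by (intro countable_SIGMA countable_rat countable_Int1)
  have "C_AC = \<Inter> (range N \<union> T ` Q)"
  proof (intro equalityI subsetI)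
    fix f assume f: "f \<in> C_AC"
    then have fH: "f \<in> H_AC" and null: "negligible (Fix f)"
      and alt: "\<And>p e. p \<in> Fix f \<Longrightarrow> e > 0 \<Longrightarrow> alternates (\<lambda>x. f x - x) (I01 \<inter> ball p e)"
      unfolding C_AC_iff by blast+
    have "f \<in> N n" for n using fH null by (simp add: N_def negligible_imp_measure0)
    moreover have "f \<in> T (q, r)" if r: "r > 0" for q r
    proof (cases "Fix f \<inter> cball q r = {}")
      case True
      then show ?thesis using fH by (simp add: T_def)
    next
      case False
      then obtain p where p: "p \<in> Fix f" "p \<in> cball q r" by blast
      have "ball p r \<subseteq> ball q (2 * r)"
      proof
        fix x assume "x \<in> ball p r"
        then show "x \<in> ball q (2 * r)" using p(2) dist_triangle[of q x p] by simp
      qed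
      then have "alternates (\<lambda>x. f x - x) (I01 \<inter> ball q (2 * r))"
        by (intro alternates_mono[OF alt[OF p(1) r]]) blast
      then show ?thesis using fH by (simp add: T_def)
    qed
    ultimately show "f \<in> \<Inter> (range N \<union> T ` Q)" by (auto simp: Q_def)
  next
    fix f assume f: "f \<in> \<Inter> (range N \<union> T ` Q)"
    have fN: "f \<in> N n" for n using f by blast
    have fT: "f \<in> T (q, r)" if "q \<in> \<rat>" "r \<in> \<rat>" "r > 0" for q r
    proof -
      have "(q, r) \<in> Q" using that by (simp add: Q_def)
      then show ?thesis using f by blast
    qed
    have fH: "f \<in> H_AC" using fN[of 0] by (simp add: N_def)
    have lm: "Fix f \<in> lmeasurable" using compact_Fix[OF H_AC_H_plus[OF fH]] by (rule lmeasurable_compact)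
    have "measure lebesgue (Fix f) = 0"
    proof (rule ccontr)
      assume "measure lebesgue (Fix f) \<noteq> 0"
      then have "0 < measure lebesgue (Fix f)" using zero_less_measure_iff by blast
      then obtain n where "inverse (real (Suc n)) < measure lebesgue (Fix f)" using reals_Archimedean by blast
      then show False using fN[of n] by (simp add: N_def inverse_eq_divide)
    qed
    then have null: "negligible (Fix f)" using lm by (simp add: negligible_iff_measure)
    have "alternates (\<lambda>x. f x - x) (I01 \<inter> ball p e)" if p: "p \<in> Fix f" and e: "e > 0" for p e
    proof -
      obtain r where r: "r \<in> \<rat>" "0 < r" "r < e / 3" using Rats_dense_in_real[of 0 "e / 3"] e by auto
      obtain q where q: "q \<in> \<rat>" "p - r < q" "q < p + r" using Rats_dense_in_real[of "p - r" "p + r"] r by auto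
      have "p \<in> cball q r" using q by (simp add: dist_real_def abs_le_iff)
      then have "Fix f \<inter> cball q r \<noteq> {}" using p by blast
      moreover have "f \<in> T (q, r)" by (rule fT[OF q(1) r(1,2)])
      ultimately have "alternates (\<lambda>x. f x - x) (I01 \<inter> ball q (2 * r))" unfolding T_def by blast
      moreover have "ball q (2 * r) \<subseteq> ball p e"
      proof
        fix x assume "x \<in> ball q (2 * r)"
        then show "x \<in> ball p e" using q r by (simp add: dist_real_def abs_less_iff)
      qed
      ultimately show ?thesis by (elim alternates_mono) blast
    qed
    then show "f \<in> C_AC" unfolding C_AC_iff using fH null by blast
  qed
  moreover have "gdelta_in H_AC_topology (\<Inter> (range N \<union> T ` Q))"
  proof (rule gdelta_in_Inter)
    show "countable (range N \<union> T ` Q)" using cQ by simp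
    fix S assume "S \<in> range N \<union> T ` Q"
    then show "gdelta_in H_AC_topology S"
      unfolding N_def T_def using openin_measure_Fix openin_alternates by (auto intro!: open_imp_gdelta_in)
  qed simp
  ultimately show ?thesis by simp
qed

section \<open>Invariance under conjugation\<close>

lemma alternatesI:
  assumes "x1 \<in> S" "x2 \<in> S" "x3 \<in> S" "x4 \<in> S" "x1 < x2" "x2 < x3" "x3 < x4"
    "v x1 * v x2 < 0" "v x2 * v x3 < 0" "v x3 * v x4 < 0"
  shows "alternates v S"
  unfolding alternates_def using assms by blast

text \<open>The displacement \<open>F (g x) - g x\<close> equals \<open>g (f x) - g x\<close>, which
  has the sign of \<open>f x - x\<close> because \<open>g\<close> increases. So \<open>g\<close>
  carries fixed points and sign changes of \<open>f\<close> to those of \<open>F\<close>; continuity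
  keeps the sign changes nearby, and Lusin's condition keeps the fixed points null.\<close>

lemma C_AC_conjugate:
  assumes f: "f \<in> C_AC" and g: "g \<in> H_AC" and F: "F \<in> H_AC"
    and conj: "\<And>x. x \<in> I01 \<Longrightarrow> F (g x) = g (f x)"
  shows "F \<in> C_AC"
proof -
  have fH: "f \<in> H_AC" and null: "negligible (Fix f)"
    and alt: "\<And>p e. p \<in> Fix f \<Longrightarrow> e > 0 \<Longrightarrow> alternates (\<lambda>x. f x - x) (I01 \<inter> ball p e)"
    using f unfolding C_AC_iff by blast+
  have fP: "f \<in> H_plus" and gP: "g \<in> H_plus" and gN: "lusin_N g"
    using fH g by (simp_all add: H_AC_iff)
  have gI: "g x \<in> I01" if "x \<in> I01" for x using H_plus_mem[OF gP that] .
  have fI: "f x \<in> I01" if "x \<in> I01" for x using H_plus_mem[OF fP that] .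
  have Fix: "\<exists>x\<in>Fix f. y = g x" if y: "y \<in> Fix F" for y
  proof -
    have yI: "y \<in> I01" "F y = y" using Fix_mem[OF y] Fix_eq[OF y] .
    define x where "x = inv_into I01 g y"
    have x: "x \<in> I01" "g x = y" using H_plus_inv_mem[OF gP yI(1)] H_plus_f_inv[OF gP yI(1)] by (simp_all add: x_def)
    have "g (f x) = g x" using conj[OF x(1)] yI(2) x(2) by simp
    then have "f x = x" using inj_onD[OF H_plus_inj[OF gP]] fI[OF x(1)] x(1) by blast
    then show ?thesis using FixI[OF x(1)] x(2) by blast
  qed
  then have "Fix F \<subseteq> g ` Fix f" by blast
  moreover have "negligible (g ` Fix f)"
    using gN null Fix_mem unfolding lusin_N_def by blast
  ultimately have null': "negligible (Fix F)" using negligible_subset by blast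
  have sign: "(F (g x) - g x) * (F (g y) - g y) < 0" if x: "x \<in> I01" and y: "y \<in> I01" and "(f x - x) * (f y - y) < 0" for x y
  proof -
    have 1: "F (g t) - g t < 0 \<longleftrightarrow> f t - t < 0" "0 < F (g t) - g t \<longleftrightarrow> 0 < f t - t" if t: "t \<in> I01" for t
      unfolding conj[OF t] using H_plus_less[OF gP fI[OF t] t] H_plus_less[OF gP t fI[OF t]] by simp_all
    show ?thesis using that(3) unfolding mult_less_0_iff 1[OF x] 1[OF y] .
  qed
  have "alternates (\<lambda>x. F x - x) (I01 \<inter> ball q e)" if q: "q \<in> Fix F" and e: "e > 0" for q e
  proof -
    obtain p where p: "p \<in> Fix f" "q = g p" using Fix[OF q] by blast
    have pI: "p \<in> I01" using Fix_mem[OF p(1)] .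
    obtain d where d: "d > 0" "\<And>x. x \<in> I01 \<Longrightarrow> dist x p < d \<Longrightarrow> dist (g x) (g p) < e"
      using H_plus_cont[OF gP] pI e unfolding continuous_on_iff by meson
    obtain x1 x2 x3 x4 where X: "x1 \<in> I01 \<inter> ball p d" "x2 \<in> I01 \<inter> ball p d" "x3 \<in> I01 \<inter> ball p d" "x4 \<in> I01 \<inter> ball p d"
      "x1 < x2" "x2 < x3" "x3 < x4"
      "(f x1 - x1) * (f x2 - x2) < 0" "(f x2 - x2) * (f x3 - x3) < 0" "(f x3 - x3) * (f x4 - x4) < 0"
      using alt[OF p(1) d(1)] unfolding alternates_def by blast
    have XI: "x1 \<in> I01" "x2 \<in> I01" "x3 \<in> I01" "x4 \<in> I01" using X(1-4) by blast+
    have b: "g x \<in> I01 \<inter> ball q e" if "x \<in> I01 \<inter> ball p d" for x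
    proof -
      have "x \<in> I01" "dist x p < d" using that by (simp_all add: dist_commute)
      then show ?thesis using d(2)[of x] gI[of x] by (simp add: p(2) dist_commute)
    qed
    show ?thesis
    proof (rule alternatesI)
      show "g x1 \<in> I01 \<inter> ball q e" "g x2 \<in> I01 \<inter> ball q e" "g x3 \<in> I01 \<inter> ball q e" "g x4 \<in> I01 \<inter> ball q e"
        by (rule b[OF X(1)] b[OF X(2)] b[OF X(3)] b[OF X(4)])+
      show "g x1 < g x2" "g x2 < g x3" "g x3 < g x4"
        using X(5-7) H_plus_less[OF gP XI(1,2)] H_plus_less[OF gP XI(2,3)] H_plus_less[OF gP XI(3,4)] by simp_all
    qed (rule sign[OF XI(1,2) X(8)] sign[OF XI(2,3) X(9)] sign[OF XI(3,4) X(10)])+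
  qed
  then show ?thesis unfolding C_AC_iff using F null' by blast
qed

lemma compose_inv_apply:
  assumes "g \<in> H_plus" "x \<in> I01"
  shows "compose I01 (compose I01 g f) (restrict (inv_into I01 g) I01) (g x) = g (f x)"
proof -
  have "g x \<in> I01" using H_plus_mem[OF assms] .
  then show ?thesis using H_plus_inv_f[OF assms] assms(2) by (simp add: compose_def)
qed

text \<open>Separates the algebra from the construction of conjugators. Invariance under conjugation
  gives one inclusion; the assumed conjugator gives the other, once the conjugate is compared with
  \<open>F\<close> as an extensional function.\<close>

lemma conjugacy_class_C_AC:
  assumes f: "f \<in> C_AC"
    and conjugator: "\<And>F. F \<in> C_AC \<Longrightarrow> \<exists>h\<in>H_AC. \<forall>x\<in>I01. h (f x) = F (h x)"
  shows "C_AC = conjugacy_class H_AC_group f"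
proof -
  have fH: "f \<in> H_AC" using f by (simp add: C_AC_iff)
  have mem: "compose I01 (compose I01 g f) (restrict (inv_into I01 g) I01) \<in> H_AC" if "g \<in> H_AC" for g
    by (intro H_AC_compose H_AC_inv fH that)
  have carrier: "carrier H_AC_group = H_AC" by (simp add: H_AC_group_def)
  show ?thesis
  proof (intro equalityI subsetI)
    fix F assume F: "F \<in> C_AC"
    then have FP: "F \<in> H_plus" using H_AC_H_plus by (simp add: C_AC_iff)
    obtain h where h: "h \<in> H_AC" "\<And>x. x \<in> I01 \<Longrightarrow> h (f x) = F (h x)" using conjugator[OF F] by blast
    have hP: "h \<in> H_plus" using H_AC_H_plus[OF h(1)] .
    have "F = compose I01 (compose I01 h f) (restrict (inv_into I01 h) I01)"
    proof (rule extensionalityI[of _ I01])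
      show "F \<in> extensional I01" using H_plus_ext[OF FP] .
      fix y assume y: "y \<in> I01"
      define x where "x = inv_into I01 h y"
      have x: "x \<in> I01" "h x = y" using H_plus_inv_mem[OF hP y] H_plus_f_inv[OF hP y] by (simp_all add: x_def)
      show "F y = compose I01 (compose I01 h f) (restrict (inv_into I01 h) I01) y"
        using compose_inv_apply[OF hP x(1), of f] h(2)[OF x(1)] x(2) by simp
    qed (simp add: compose_def)
    then show "F \<in> conjugacy_class H_AC_group f"
      unfolding conjugacy_class_def carrier H_AC_group_conj[OF fH h(1), symmetric] using h(1) by blast
  next
    fix F assume "F \<in> conjugacy_class H_AC_group f"
    then obtain g where g: "g \<in> H_AC" "F = g \<otimes>\<^bsub>H_AC_group\<^esub> f \<otimes>\<^bsub>H_AC_group\<^esub> inv\<^bsub>H_AC_group\<^esub> g"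
      unfolding conjugacy_class_def carrier by blast
    have "F = compose I01 (compose I01 g f) (restrict (inv_into I01 g) I01)"
      unfolding g(2) by (rule H_AC_group_conj[OF fH g(1)])
    then show "F \<in> C_AC"
      using C_AC_conjugate[OF f g(1) mem[OF g(1)]] compose_inv_apply[OF H_AC_H_plus[OF g(1)]] by simp
  qed
qed

section \<open>A self-similar oscillating function\<close>

lemma alternates_transfer:
  assumes alt: "alternates v S"
    and mono: "(\<forall>x\<in>S. \<forall>y\<in>S. x < y \<longrightarrow> h x < h y) \<or> (\<forall>x\<in>S. \<forall>y\<in>S. x < y \<longrightarrow> h y < h x)"
    and T: "\<And>x. x \<in> S \<Longrightarrow> h x \<in> T"
    and k: "k \<noteq> 0" "\<And>x. x \<in> S \<Longrightarrow> v' (h x) = k * v x"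
  shows "alternates v' T"
proof -
  obtain x1 x2 x3 x4 where X: "x1 \<in> S" "x2 \<in> S" "x3 \<in> S" "x4 \<in> S"
    "x1 < x2" "x2 < x3" "x3 < x4" "v x1 * v x2 < 0" "v x2 * v x3 < 0" "v x3 * v x4 < 0"
    using alt unfolding alternates_def by blast
  have neg: "v' (h x) * v' (h y) < 0" if "x \<in> S" "y \<in> S" "v x * v y < 0" for x y
  proof -
    have "v' (h x) * v' (h y) = (k * k) * (v x * v y)" using k(2) that by simp
    moreover have "0 < k * k" using k(1) by (metis not_square_less_zero linorder_neqE_linordered_idom mult_eq_0_iff)
    ultimately show ?thesis using that(3) mult_pos_neg by metis
  qed
  note N = neg[OF X(1,2,8)] neg[OF X(2,3,9)] neg[OF X(3,4,10)]
  from mono show ?thesis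
  proof
    assume "\<forall>x\<in>S. \<forall>y\<in>S. x < y \<longrightarrow> h x < h y"
    then have "h x1 < h x2" "h x2 < h x3" "h x3 < h x4" using X(1-7) by blast+
    then show ?thesis using N T X(1-4) by (intro alternatesI[of "h x1" _ "h x2" "h x3" "h x4"])
  next
    assume "\<forall>x\<in>S. \<forall>y\<in>S. x < y \<longrightarrow> h y < h x"
    then have "h x2 < h x1" "h x3 < h x2" "h x4 < h x3" using X(1-7) by blast+
    \<comment> \<open>Under reversal the four points are listed backwards, so each product appears
      with its factors exchanged.\<close>
    then show ?thesis using N[unfolded mult.commute[of "v' (h x1)"] mult.commute[of "v' (h x2)" "v' (h x3)"] mult.commute[of "v' (h x3)" "v' (h x4)"]] T X(1-4)
      by (intro alternatesI[of "h x4" _ "h x3" "h x2" "h x1"])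
  qed
qed

text \<open>
  \<open>cantor_wave\<close> is a tent on the middle third of the unit interval and a copy of itself scaled by
  \<open>-1/3\<close> (reflected on the right) on each outer third. Its zeros in the interval form the middle-third
  Cantor set, and every zero is a limit of zeros of smaller and smaller copies of the wave.
\<close>

definition tent :: "real \<Rightarrow> real" where
  "tent x = max 0 (1/6 - \<bar>x - 1/2\<bar>)"

text \<open>Expands each outer third onto the unit interval, the right one reversed, and sends the
  middle third to 1. As 1 goes to 0, which is fixed, and the tent vanishes at both, the middle third
  receives no further terms, and one recursion covers all three thirds.\<close>

definition fold3 :: "real \<Rightarrow> real" where
  "fold3 x = min 1 (min (3 * x) (3 * (1 - x)))"

definition cantor_wave :: "real \<Rightarrow> real" where
  "cantor_wave x = (\<Sum>n. (-1/3)^n * tent ((fold3 ^^ n) x))"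

lemma cantor_wave_summable: "summable (\<lambda>n. (-1/3)^n * tent ((fold3 ^^ n) x))"
proof (rule summable_comparison_test'[of "\<lambda>n. (1/3)^n" 0])
  show "summable (\<lambda>n. (1/3::real)^n)" by (rule summable_geometric) simp
  fix n :: nat
  have "\<bar>tent ((fold3 ^^ n) x)\<bar> \<le> 1" by (simp add: tent_def)
  then show "norm ((-1/3)^n * tent ((fold3 ^^ n) x)) \<le> (1/3)^n"
    by (simp add: abs_mult power_abs mult_left_le)
qed

lemma cantor_wave_rec: "cantor_wave x = tent x - cantor_wave (fold3 x) / 3"
proof -
  have "cantor_wave x = (\<Sum>n. (-1/3)^(Suc n) * tent ((fold3 ^^ Suc n) x)) + (-1/3)^0 * tent ((fold3 ^^ 0) x)"
    unfolding cantor_wave_def by (subst suminf_split_head[OF cantor_wave_summable]) simp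
  also have "(\<Sum>n. (-1/3)^(Suc n) * tent ((fold3 ^^ Suc n) x)) = (\<Sum>n. (-1/3) * ((-1/3)^n * tent ((fold3 ^^ n) (fold3 x))))"
    by (simp add: funpow_swap1 mult.assoc)
  also have "\<dots> = (-1/3) * cantor_wave (fold3 x)"
    unfolding cantor_wave_def by (rule suminf_mult[OF cantor_wave_summable])
  finally show ?thesis by simp
qed

lemma cantor_wave_nonpos: 
  assumes "x \<le> 0"
  shows "cantor_wave x = 0"
proof -
  have "(fold3 ^^ n) x \<le> 0" for n
    by (induction n) (use assms in \<open>auto simp: fold3_def\<close>)
  moreover have "tent y = 0" if "y \<le> 0" for y using that by (simp add: tent_def)
  ultimately have "tent ((fold3 ^^ n) x) = 0" for n by blast
  then show ?thesis by (simp add: cantor_wave_def)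
qed

lemma cantor_wave_ge_1:
  assumes "1 \<le> x"
  shows "cantor_wave x = 0"
proof -
  have "fold3 x \<le> 0" "tent x = 0" using assms by (auto simp: fold3_def tent_def)
  then show ?thesis using cantor_wave_rec[of x] cantor_wave_nonpos by simp
qed

lemma cantor_wave_left: "x \<le> 1/3 \<Longrightarrow> cantor_wave x = - cantor_wave (3 * x) / 3"
  using cantor_wave_rec[of x] by (simp add: tent_def fold3_def)

lemma cantor_wave_mid: 
  assumes "1/3 \<le> x" "x \<le> 2/3" shows "cantor_wave x = 1/6 - \<bar>x - 1/2\<bar>"
proof -
  have "fold3 x = 1" "tent x = 1/6 - \<bar>x - 1/2\<bar>" using assms by (auto simp: fold3_def tent_def abs_if)
  then show ?thesis using cantor_wave_rec[of x] cantor_wave_ge_1[of 1] by simp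
qed

lemma cantor_wave_right: "2/3 \<le> x \<Longrightarrow> cantor_wave x = - cantor_wave (3 * (1 - x)) / 3"
  using cantor_wave_rec[of x] by (simp add: tent_def fold3_def)

text \<open>The increment is split at the gluing point \<open>a\<close>. The predicate
  \<open>P\<close> restricts the right end from above, so the same statement serves a bounded middle
  piece and an unbounded last piece.\<close>

lemma nonexpansive_glue:
  fixes F :: "real \<Rightarrow> real"
  assumes "\<And>x y. x \<le> y \<Longrightarrow> y \<le> a \<Longrightarrow> \<bar>F y - F x\<bar> \<le> y - x"
    and "\<And>x y. a \<le> x \<Longrightarrow> x \<le> y \<Longrightarrow> P y \<Longrightarrow> \<bar>F y - F x\<bar> \<le> y - x"
    and "x \<le> y" "P y"
  shows "\<bar>F y - F x\<bar> \<le> y - x"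
proof -
  consider "y \<le> a" | "a \<le> x" | "x \<le> a" "a \<le> y" by linarith
  then show ?thesis
  proof cases
    case 3
    then show ?thesis using assms(1)[of x a] assms(2)[of a y] assms(4) by linarith
  qed (use assms in blast)+
qed

text \<open>Every summand has slopes up to 1, so adding Lipschitz constants term by term gives only
  \<open>n\<close>. The induction uses instead that on each outer third the sum is a copy of its
  predecessor, scaled alike in value and argument, and that on the middle third it is the tent
  alone.\<close>

lemma cantor_wave_partial_nonexpansive:
  fixes x y :: real
  assumes "x \<le> y"
  shows "\<bar>(\<Sum>k<n. (-1/3)^k * tent ((fold3 ^^ k) y)) - (\<Sum>k<n. (-1/3)^k * tent ((fold3 ^^ k) x))\<bar> \<le> y - x"
proof -
  define S where "S = (\<lambda>n x. \<Sum>k<n. (-1/3)^k * tent ((fold3 ^^ k) x))"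
  have S0: "S 0 x = 0" for x by (simp add: S_def)
  have SS: "S (Suc n) x = tent x - S n (fold3 x) / 3" for n x
  proof -
    have "S (Suc n) x = (-1/3)^0 * tent ((fold3 ^^ 0) x) + (\<Sum>k<n. (-1/3)^(Suc k) * tent ((fold3 ^^ Suc k) x))"
      unfolding S_def by (rule sum.lessThan_Suc_shift)
    also have "(\<Sum>k<n. (-1/3)^(Suc k) * tent ((fold3 ^^ Suc k) x)) = (-1/3) * S n (fold3 x)"
      unfolding S_def sum_distrib_left by (intro sum.cong) (simp_all add: funpow_swap1)
    finally show ?thesis by simp
  qed
  have neg: "S n x = 0" if "x \<le> 0" for n x
    using that
  proof (induction n arbitrary: x)
    case (Suc n)
    have "fold3 x \<le> 0" "tent x = 0" using Suc.prems by (auto simp: fold3_def tent_def)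
    then show ?case using Suc.IH by (simp add: SS)
  qed (simp add: S0)
  \<comment> \<open>The middle third is sent to 1, so this leaves the tent as the only contribution
    there.\<close>
  have one: "S n 1 = 0" for n
  proof (cases n)
    case (Suc m)
    have "fold3 1 = 0" "tent 1 = 0" by (auto simp: fold3_def tent_def)
    then show ?thesis using neg[of 0 m] Suc by (simp add: SS)
  qed (simp add: S0)
  have "\<bar>S n y - S n x\<bar> \<le> y - x" if "x \<le> y" for n x y
    using that
  proof (induction n arbitrary: x y)
    case 0
    then show ?case by (simp add: S0)
  next
    case (Suc n)
    have l: "S (Suc n) t = - S n (3 * t) / 3" if "t \<le> 1/3" for t
      using that by (simp add: SS tent_def fold3_def)
    have m: "S (Suc n) t = 1/6 - \<bar>t - 1/2\<bar>" if "1/3 \<le> t" "t \<le> 2/3" for t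
    proof -
      have "fold3 t = 1" "tent t = 1/6 - \<bar>t - 1/2\<bar>" using that by (auto simp: fold3_def tent_def abs_if)
      then show ?thesis using one by (simp add: SS)
    qed
    have r: "S (Suc n) t = - S n (3 * (1 - t)) / 3" if "2/3 \<le> t" for t
      using that by (simp add: SS tent_def fold3_def)
    have L: "\<bar>S (Suc n) t - S (Suc n) s\<bar> \<le> t - s" if "s \<le> t" "t \<le> 1/3" for s t
      using Suc.IH[of "3 * s" "3 * t"] l[of s] l[of t] that by simp
    have M: "\<bar>S (Suc n) t - S (Suc n) s\<bar> \<le> t - s" if "1/3 \<le> s" "s \<le> t" "t \<le> 2/3" for s t
      using m[of s] m[of t] that by (simp add: abs_if)
    have R: "\<bar>S (Suc n) t - S (Suc n) s\<bar> \<le> t - s" if "2/3 \<le> s" "s \<le> t" "True" for s t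
      using Suc.IH[of "3 * (1 - t)" "3 * (1 - s)"] r[of s] r[of t] that by simp
    have LM: "\<bar>S (Suc n) t - S (Suc n) s\<bar> \<le> t - s" if "s \<le> t" "t \<le> 2/3" for s t
      by (rule nonexpansive_glue[of "1/3" "S (Suc n)" "\<lambda>y. y \<le> 2/3", OF L M that])
    show ?case
      by (rule nonexpansive_glue[of "2/3" "S (Suc n)" "\<lambda>y. True", OF LM R Suc.prems TrueI])
  qed
  then show ?thesis using assms by (simp add: S_def)
qed

lemma cantor_wave_nonexpansive: "\<bar>cantor_wave x - cantor_wave y\<bar> \<le> \<bar>x - y\<bar>"
proof -
  have *: "\<bar>cantor_wave y - cantor_wave x\<bar> \<le> y - x" if "x \<le> y" for x y
  proof -
    have "(\<lambda>n. \<Sum>k<n. (-1/3)^k * tent ((fold3 ^^ k) t)) \<longlonglongrightarrow> cantor_wave t" for t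
      unfolding cantor_wave_def by (rule summable_LIMSEQ[OF cantor_wave_summable])
    then have "(\<lambda>n. \<bar>(\<Sum>k<n. (-1/3)^k * tent ((fold3 ^^ k) y)) - (\<Sum>k<n. (-1/3)^k * tent ((fold3 ^^ k) x))\<bar>)
      \<longlonglongrightarrow> \<bar>cantor_wave y - cantor_wave x\<bar>" by (intro tendsto_intros)
    then show ?thesis
      by (rule LIMSEQ_le_const2) (use cantor_wave_partial_nonexpansive[OF that] in blast)
  qed
  show ?thesis
  proof (cases "x \<le> y")
    case True
    then show ?thesis using *[of x y] by (simp add: abs_minus_commute)
  next
    case False
    then show ?thesis using *[of y x] by simp
  qed
qed

lemma continuous_cantor_wave: "continuous_on S cantor_wave"
proof (rule lipschitz_on_continuous_on)
  show "1-lipschitz_on S cantor_wave"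
    by (rule lipschitz_onI) (simp_all add: dist_real_def cantor_wave_nonexpansive)
qed

section \<open>The zero set of the wave\<close>

definition cantor_zeros :: "real set" where
  "cantor_zeros = {x \<in> I01. cantor_wave x = 0}"

lemma cantor_zeros_cases:
  assumes "x \<in> cantor_zeros"
  obtains "x \<le> 1/3" "3 * x \<in> cantor_zeros" | "2/3 \<le> x" "3 * (1 - x) \<in> cantor_zeros"
proof -
  have x: "0 \<le> x" "x \<le> 1" "cantor_wave x = 0" using assms by (auto simp: cantor_zeros_def)
  consider "x \<le> 1/3" | "2/3 \<le> x" | "1/3 < x" "x < 2/3" by linarith
  then show ?thesis
  proof cases
    case 1
    then show ?thesis using x cantor_wave_left[of x] that(1) by (simp add: cantor_zeros_def)
  next
    case 2
    then show ?thesis using x cantor_wave_right[of x] that(2) by (simp add: cantor_zeros_def)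
  next
    case 3
    \<comment> \<open>Inside the middle third the tent is strictly positive, so no zero lies
      there.\<close>
    then have "\<bar>x - 1/2\<bar> < 1/6" unfolding abs_less_iff by linarith
    then show ?thesis using x cantor_wave_mid[of x] 3 by simp
  qed
qed

text \<open>The zero set is covered by two copies of itself scaled by 1/3, so its measure, which is
  finite, is at most two thirds of itself.\<close>

lemma negligible_cantor_zeros: "negligible cantor_zeros"
proof -
  let ?Z = cantor_zeros
  have "closed ?Z"
    unfolding cantor_zeros_def by (rule continuous_closed_preimage_constant[OF continuous_cantor_wave]) simp
  moreover have "bounded ?Z"
    by (rule bounded_subset[OF bounded_closed_interval[of 0 1]]) (auto simp: cantor_zeros_def)
  ultimately have cZ: "compact ?Z" by (simp add: compact_eq_bounded_closed)
  then have Z: "?Z \<in> lmeasurable" by (rule lmeasurable_compact)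
  let ?A = "(\<lambda>x. (1/3) *\<^sub>R x + 0) ` ?Z" and ?B = "(\<lambda>x. (-1/3) *\<^sub>R x + 1) ` ?Z"
  have sub: "?Z \<subseteq> ?A \<union> ?B"
  proof
    fix x assume "x \<in> ?Z"
    then show "x \<in> ?A \<union> ?B"
    proof (cases rule: cantor_zeros_cases)
      case 1
      have "x = (1/3) *\<^sub>R (3 * x) + 0" by simp
      then show ?thesis using 1(2) by blast
    next
      case 2
      have "x = (-1/3) *\<^sub>R (3 * (1 - x)) + 1" by (simp add: field_simps)
      then show ?thesis using 2(2) by blast
    qed
  qed
  have mA: "measure lebesgue ?A = measure lebesgue ?Z / 3"
    using measure_lebesgue_affine[of "1/3" 0 ?Z] by simp
  have lA: "?A \<in> lmeasurable"
    by (intro lmeasurable_compact compact_continuous_image cZ continuous_intros)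
  have mB: "measure lebesgue ?B = measure lebesgue ?Z / 3"
    using measure_lebesgue_affine[of "-1/3" 1 ?Z] by simp
  have lB: "?B \<in> lmeasurable"
    by (intro lmeasurable_compact compact_continuous_image cZ continuous_intros)
  have "measure lebesgue ?Z \<le> measure lebesgue (?A \<union> ?B)"
    by (rule measure_mono_fmeasurable[OF sub fmeasurableD[OF Z] fmeasurable.Un[OF lA lB]])
  also have "\<dots> \<le> measure lebesgue ?A + measure lebesgue ?B"
    by (rule measure_Un_le[OF fmeasurableD[OF lA] fmeasurableD[OF lB]])
  finally have "measure lebesgue ?Z \<le> 0" unfolding mA mB by simp
  then have "measure lebesgue ?Z = 0" by (simp add: measure_le_0_iff)
  then show ?thesis using Z by (simp add: negligible_iff_measure)
qed

text \<open>The wave is sampled at 1/2, at the centres 1/6 and 5/6 of the outer thirds, and at 1/18,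
  the centre of the leftmost ninth; each level of nesting flips the sign.\<close>

lemma alternates_cantor_wave_unit: "alternates cantor_wave {0<..<1}"
proof (rule alternatesI)
  have m: "cantor_wave (1/2) = 1/6" using cantor_wave_mid[of "1/2"] by simp
  have a: "cantor_wave (1/6) = -1/18" using cantor_wave_left[of "1/6"] m by simp
  have b: "cantor_wave (1/18) = 1/54" using cantor_wave_left[of "1/18"] a by simp
  have c: "cantor_wave (5/6) = -1/18" using cantor_wave_right[of "5/6"] m by simp
  show "cantor_wave (1/18) * cantor_wave (1/6) < 0" "cantor_wave (1/6) * cantor_wave (1/2) < 0"
    "cantor_wave (1/2) * cantor_wave (5/6) < 0" unfolding a b c m by simp_all
qed auto

lemma alternates_cantor_wave_left:
  assumes "alternates cantor_wave ({0<..<1} \<inter> ball (3 * p) (3 * e))"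
  shows "alternates cantor_wave ({0<..<1} \<inter> ball p e)"
proof (rule alternates_transfer[OF assms, where h="\<lambda>x. x / 3" and k="-(1/3)"])
  fix x assume x: "x \<in> {0<..<1} \<inter> ball (3 * p) (3 * e)"
  then have xb: "0 < x" "x < 1" "dist (3 * p) x < 3 * e" by simp_all
  have "p - (x / 3) = (3 * p - x) / 3" by simp
  then have E: "\<bar>p - (x / 3)\<bar> = \<bar>3 * p - x\<bar> / 3" by (simp only: abs_minus_cancel abs_divide abs_numeral)
  have "dist p (x / 3) < e" using xb(3) unfolding dist_real_def E by simp
  then show "x / 3 \<in> {0<..<1} \<inter> ball p e" using xb(1,2) by simp
  show "cantor_wave (x / 3) = -(1/3) * cantor_wave x" using cantor_wave_left[of "x / 3"] xb(1,2) by simp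
next
  have "\<And>x y :: real. x < y \<Longrightarrow> x / 3 < y / 3" by simp
  then show "(\<forall>x\<in>{0<..<1} \<inter> ball (3 * p) (3 * e). \<forall>y\<in>{0<..<1} \<inter> ball (3 * p) (3 * e). x < y \<longrightarrow> x / 3 < y / 3) \<or>
        (\<forall>x\<in>{0<..<1} \<inter> ball (3 * p) (3 * e). \<forall>y\<in>{0<..<1} \<inter> ball (3 * p) (3 * e). x < y \<longrightarrow> y / 3 < x / 3)"
    by blast
qed simp

lemma alternates_cantor_wave_right:
  assumes "alternates cantor_wave ({0<..<1} \<inter> ball (3 * (1 - p)) (3 * e))"
  shows "alternates cantor_wave ({0<..<1} \<inter> ball p e)"
proof (rule alternates_transfer[OF assms, where h="\<lambda>x. 1 - x / 3" and k="-(1/3)"])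
  fix x assume x: "x \<in> {0<..<1} \<inter> ball (3 * (1 - p)) (3 * e)"
  then have xb: "0 < x" "x < 1" "dist (3 * (1 - p)) x < 3 * e" by simp_all
  have "p - (1 - x / 3) = - ((3 * (1 - p) - x) / 3)" by (simp add: field_simps)
  then have E: "\<bar>p - (1 - x / 3)\<bar> = \<bar>3 * (1 - p) - x\<bar> / 3" by (simp only: abs_minus_cancel abs_divide abs_numeral)
  have "dist p (1 - x / 3) < e" using xb(3) unfolding dist_real_def E by simp
  then show "1 - x / 3 \<in> {0<..<1} \<inter> ball p e" using xb(1,2) by simp
  show "cantor_wave (1 - x / 3) = -(1/3) * cantor_wave x" using cantor_wave_right[of "1 - x / 3"] xb(1,2) by simp
next
  have "\<And>x y :: real. x < y \<Longrightarrow> 1 - y / 3 < 1 - x / 3" by simp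
  then show "(\<forall>x\<in>{0<..<1} \<inter> ball (3 * (1 - p)) (3 * e). \<forall>y\<in>{0<..<1} \<inter> ball (3 * (1 - p)) (3 * e). x < y \<longrightarrow> 1 - x / 3 < 1 - y / 3) \<or>
        (\<forall>x\<in>{0<..<1} \<inter> ball (3 * (1 - p)) (3 * e). \<forall>y\<in>{0<..<1} \<inter> ball (3 * (1 - p)) (3 * e). x < y \<longrightarrow> 1 - y / 3 < 1 - x / 3)"
    by blast
qed simp

text \<open>Zooming in: a zero lies in an outer third, and the expansion of that third takes it to a
  zero again and triples the radius. After \<open>n\<close> steps the ball contains the whole unit
  interval.\<close>

lemma alternates_cantor_wave_pow:
  assumes "p \<in> cantor_zeros" "(1/3)^n < e"
  shows "alternates cantor_wave ({0<..<1} \<inter> ball p e)"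
  using assms
proof (induction n arbitrary: p e)
  case 0
  have p: "0 \<le> p" "p \<le> 1" using 0(1) by (simp_all add: cantor_zeros_def)
  have "{0<..<1} \<subseteq> {0<..<1} \<inter> ball p e"
  proof
    fix x :: real assume x: "x \<in> {0<..<1}"
    then have "\<bar>p - x\<bar> < 1" using p unfolding greaterThanLessThan_iff by linarith
    then show "x \<in> {0<..<1} \<inter> ball p e" using x 0(2) by (simp add: dist_real_def)
  qed
  then show ?case by (rule alternates_mono[OF alternates_cantor_wave_unit])
next
  case (Suc n)
  have e: "(1/3)^n < 3 * e" using Suc.prems(2) by simp
  from Suc.prems(1) show ?case
  proof (cases rule: cantor_zeros_cases)
    case 1
    show ?thesis by (rule alternates_cantor_wave_left[OF Suc.IH[OF 1(2) e]])
  next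
    case 2
    show ?thesis by (rule alternates_cantor_wave_right[OF Suc.IH[OF 2(2) e]])
  qed
qed

text \<open>The four points lie in the open unit interval, hence to the right of the zero 0. This
  matters at roots of a polynomial, near which the polynomial may keep one sign.\<close>

lemma alternates_cantor_wave:
  assumes "p \<in> cantor_zeros" "0 < e"
  shows "alternates cantor_wave ({0<..<1} \<inter> ball p e)"
proof -
  obtain n where "(1/3)^n < e" using real_arch_pow_inv[OF assms(2), of "1/3"] by auto
  then show ?thesis using alternates_cantor_wave_pow[OF assms(1)] by blast
qed

section \<open>Perturbing polynomials\<close>

lemma lipschitz_abs_continuous_on:
  assumes "\<And>x y. x \<in> S \<Longrightarrow> y \<in> S \<Longrightarrow> x \<le> y \<Longrightarrow> \<bar>f y - f x\<bar> \<le> K * (y - x)" and "K > 0"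
  shows "abs_continuous_on S f"
  unfolding abs_continuous_on_def
proof (intro allI impI)
  fix e :: real assume e: "e > 0"
  show "\<exists>\<delta>>0. \<forall>P :: (real \<times> real) set.
        finite P \<longrightarrow> (\<forall>(a, b)\<in>P. a \<le> b \<and> {a..b} \<subseteq> S) \<longrightarrow>
        disjoint_family_on (\<lambda>(a, b). {a<..<b}) P \<longrightarrow>
        (\<Sum>(a, b)\<in>P. b - a) < \<delta> \<longrightarrow> (\<Sum>(a, b)\<in>P. \<bar>f b - f a\<bar>) < e"
  proof (intro exI[of _ "e / K"] conjI allI impI)
    fix P :: "(real \<times> real) set"
    assume P: "\<forall>(a, b)\<in>P. a \<le> b \<and> {a..b} \<subseteq> S" and s: "(\<Sum>(a, b)\<in>P. b - a) < e / K"
    have "(\<Sum>(a, b)\<in>P. \<bar>f b - f a\<bar>) \<le> (\<Sum>p\<in>P. K * (snd p - fst p))"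
      unfolding case_prod_unfold
    proof (rule sum_mono)
      fix p assume "p \<in> P"
      then have "fst p \<le> snd p" "fst p \<in> S" "snd p \<in> S" using P by (auto simp: case_prod_unfold subset_iff)
      then show "\<bar>f (snd p) - f (fst p)\<bar> \<le> K * (snd p - fst p)" using assms(1) by blast
    qed
    also have "\<dots> = K * (\<Sum>(a, b)\<in>P. b - a)" by (simp add: sum_distrib_left case_prod_unfold)
    also have "\<dots> < e" using s assms(2) by (simp add: field_simps)
    finally show "(\<Sum>(a, b)\<in>P. \<bar>f b - f a\<bar>) < e" .
  qed (use e assms(2) in simp)
qed

text \<open>The means of showing that explicit maps lie in \<open>H_AC\<close>: the lower slope
  bound \<open>k\<close> makes the inverse Lipschitz with constant \<open>1 / k\<close>.\<close>

lemma bilipschitz_H_AC: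
  assumes lo: "\<And>x y. x \<in> I01 \<Longrightarrow> y \<in> I01 \<Longrightarrow> x \<le> y \<Longrightarrow> k * (y - x) \<le> F y - F x"
    and hi: "\<And>x y. x \<in> I01 \<Longrightarrow> y \<in> I01 \<Longrightarrow> x \<le> y \<Longrightarrow> F y - F x \<le> K * (y - x)"
    and k: "k > 0" and F: "F 0 = 0" "F 1 = 1"
  shows "restrict F I01 \<in> H_AC"
proof -
  have K: "K > 0" using lo[of 0 1] hi[of 0 1] k by simp
  have abs: "\<bar>F y - F x\<bar> \<le> K * (y - x)" if "x \<in> I01" "y \<in> I01" "x \<le> y" for x y
  proof -
    have "0 \<le> k * (y - x)" using k that(3) by simp
    then show ?thesis using lo[OF that] hi[OF that] by linarith
  qed
  have sm: "strict_mono_on I01 F"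
  proof (rule strict_mono_onI)
    fix x y assume xy: "x \<in> I01" "y \<in> I01" "x < y"
    then have "0 < k * (y - x)" using k by simp
    then show "F x < F y" using lo[OF xy(1,2)] xy(3) by simp
  qed
  have cont: "continuous_on I01 F"
  proof (rule lipschitz_on_continuous_on)
    show "K-lipschitz_on I01 F"
      by (rule lipschitz_on_leI) (use abs K in \<open>simp_all add: dist_real_def abs_minus_commute\<close>)
  qed
  have im: "F ` I01 = I01"
  proof (intro equalityI subsetI)
    fix y assume "y \<in> F ` I01"
    then obtain x where x: "x \<in> I01" "y = F x" by blast
    then show "y \<in> I01"
      using strict_mono_on_leD[OF sm, of 0 x] strict_mono_on_leD[OF sm, of x 1] F by auto
  next
    fix y assume "y \<in> I01"
    then obtain x where "0 \<le> x" "x \<le> 1" "F x = y" using IVT'[of F 0 y 1] F cont by auto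
    then show "y \<in> F ` I01" by auto
  qed
  have H: "restrict F I01 \<in> H_plus"
    by (rule H_plusI) (use sm im in \<open>auto simp: strict_mono_on_def\<close>)
  have "abs_continuous_on I01 (restrict F I01)"
    by (rule lipschitz_abs_continuous_on[OF _ K]) (use abs in simp)
  moreover have "abs_continuous_on I01 (inv_into I01 (restrict F I01))"
  proof (rule lipschitz_abs_continuous_on)
    show "1 / k > 0" using k by simp
    fix x y assume xy: "x \<in> I01" "y \<in> I01" "x \<le> y"
    let ?g = "inv_into I01 (restrict F I01)"
    have g: "?g x \<in> I01" "?g y \<in> I01" using H_plus_inv_mem[OF H] xy by blast+
    have Fg: "F (?g x) = x" "F (?g y) = y"
      using H_plus_f_inv[OF H xy(1)] H_plus_f_inv[OF H xy(2)] g by simp_all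
    have "?g x \<le> ?g y" using H_plus_le[OF H g] Fg g xy(3) by simp
    moreover have "k * (?g y - ?g x) \<le> y - x" using lo[OF g \<open>?g x \<le> ?g y\<close>] Fg by simp
    ultimately show "\<bar>?g y - ?g x\<bar> \<le> 1 / k * (y - x)" using k by (simp add: field_simps)
  qed
  ultimately show ?thesis using H by (simp add: H_AC_def)
qed

lemma lipschitz_deriv_bound:
  fixes f :: "real \<Rightarrow> real"
  assumes D: "(f has_real_derivative D) (at x)" and d: "d > 0"
    and lip: "\<And>y. \<bar>y - x\<bar> < d \<Longrightarrow> \<bar>f y - f x\<bar> \<le> K * \<bar>y - x\<bar>"
  shows "\<bar>D\<bar> \<le> K"
proof (rule tendsto_upperbound)
  show "((\<lambda>y. \<bar>(f y - f x) / (y - x)\<bar>) \<longlongrightarrow> \<bar>D\<bar>) (at x)"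
    using D unfolding has_field_derivative_iff by (intro tendsto_intros)
  show "\<forall>\<^sub>F y in at x. \<bar>(f y - f x) / (y - x)\<bar> \<le> K"
    unfolding eventually_at
  proof (intro exI[of _ d] conjI ballI impI d)
    fix y assume "y \<noteq> x \<and> dist y x < d"
    then show "\<bar>(f y - f x) / (y - x)\<bar> \<le> K" using lip[of y] by (simp add: dist_real_def field_simps)
  qed
qed simp

text \<open>\<open>N\<close> collects points where a derivative may fail to exist, so that
  \<open>deriv\<close> is arbitrary there; being null, it is overwritten in the integrand before the
  comparison.\<close>

lemma rho_le_measure:
  assumes f: "f \<in> H_AC" and g: "g \<in> H_AC" and Z: "Z \<in> lmeasurable" "Z \<subseteq> I01" and N: "negligible N"
    and eq: "\<And>x. x \<in> I01 - Z - N \<Longrightarrow> deriv f x = deriv g x"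
    and bd: "\<And>x. x \<in> Z - N \<Longrightarrow> \<bar>deriv f x - deriv g x\<bar> \<le> B"
  shows "rho f g \<le> B * measure lebesgue Z"
proof -
  have one: "(\<lambda>x. 1::real) integrable_on Z" using Z(1) by (simp add: integrable_on_const)
  have B: "(\<lambda>x. B) integrable_on Z" using Z(1) by (rule integrable_on_const)
  define h where "h = (\<lambda>x. if x \<in> Z then B else 0)"
  have hi: "h integrable_on I01" unfolding h_def using B Z(2) by (simp add: integrable_restrict_Int inf.absorb2 inf.absorb1)
  have "rho f g = integral I01 (\<lambda>x. \<bar>deriv f x - deriv g x\<bar>)" by (rule rho_eq_integral[OF f g])
  also have "\<dots> = integral I01 (\<lambda>x. if x \<in> N then h x else \<bar>deriv f x - deriv g x\<bar>)"
    by (rule integral_spike[OF N]) simp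
  also have "\<dots> \<le> integral I01 h"
  proof (rule integral_le[OF _ hi])
    have "(\<lambda>x. \<bar>deriv f x - deriv g x\<bar>) integrable_on I01"
      by (rule set_lebesgue_integral_eq_integral(1)[OF rho_integrable[OF f g]])
    then show "(\<lambda>x. if x \<in> N then h x else \<bar>deriv f x - deriv g x\<bar>) integrable_on I01"
      by (rule integrable_spike[OF _ N]) simp
    fix x assume "x \<in> I01"
    then show "(if x \<in> N then h x else \<bar>deriv f x - deriv g x\<bar>) \<le> h x"
      using eq[of x] bd[of x] by (simp add: h_def)
  qed
  also have "\<dots> = integral Z (\<lambda>x. B)" 
    unfolding h_def using Z(2) by (simp add: integral_restrict_Int inf.absorb2 inf.absorb1)
  also have "\<dots> = B * measure lebesgue Z"
    using lmeasure_integral[OF Z(1)] integral_mult_right[of Z B "\<lambda>x. 1"] by simp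
  finally show ?thesis .
qed

text \<open>The intermediate value theorem produces preimages of the four values one after another,
  each to the right of the one before, although \<open>u\<close> may oscillate. Decreasing end
  values are reduced to increasing ones by changing the sign of \<open>u\<close>.\<close>

lemma alternates_comp:
  fixes u v :: "real \<Rightarrow> real"
  assumes ab: "a < b" and cont: "continuous_on {a..b} u"
    and alt: "alternates v {t. min (u a) (u b) < t \<and> t < max (u a) (u b)}"
  shows "alternates (\<lambda>x. v (u x)) {a<..<b}"
proof -
  have up: "alternates (\<lambda>x. v (u x)) {a<..<b}"
    if cont: "continuous_on {a..b} u" and alt: "alternates v {t. u a < t \<and> t < u b}" for u v :: "real \<Rightarrow> real"
  proof -
    obtain t1 t2 t3 t4 where t: "u a < t1" "t1 < t2" "t2 < t3" "t3 < t4" "t4 < u b"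
      and v: "v t1 * v t2 < 0" "v t2 * v t3 < 0" "v t3 * v t4 < 0"
      using alt unfolding alternates_def by blast
    have next_point: "\<exists>y. x < y \<and> y < b \<and> u y = t" if w: "a \<le> x" "x < b" "u x < t" "t < u b" for x t
    proof -
      have c: "continuous_on {x..b} u" using cont by (rule continuous_on_subset) (use w in auto)
      have "\<exists>y. x \<le> y \<and> y \<le> b \<and> u y = t" by (rule IVT'[OF _ _ _ c]) (use w in auto)
      then obtain y where y: "x \<le> y" "y \<le> b" "u y = t" by blast
      then have "y \<noteq> x" "y \<noteq> b" using w by auto
      then show ?thesis using y by (intro exI[of _ y]) auto
    qed
    obtain x1 where x1: "a < x1" "x1 < b" "u x1 = t1" using next_point[of a t1] ab t by auto
    obtain x2 where x2: "x1 < x2" "x2 < b" "u x2 = t2" using next_point[of x1 t2] x1 t by auto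
    obtain x3 where x3: "x2 < x3" "x3 < b" "u x3 = t3" using next_point[of x2 t3] x1 x2 t by auto
    obtain x4 where x4: "x3 < x4" "x4 < b" "u x4 = t4" using next_point[of x3 t4] x1 x2 x3 t by auto
    show ?thesis
      by (rule alternatesI[of x1 _ x2 x3 x4]) (use x1 x2 x3 x4 v in auto)
  qed
  show ?thesis
  proof (cases "u a \<le> u b")
    case True
    then show ?thesis using up[OF cont] alt by (simp add: min_def max_def)
  next
    case False
    have "alternates (\<lambda>t. v (- t)) {t. - u a < t \<and> t < - u b}"
    proof (rule alternates_transfer[OF alt, where h=uminus and k=1])
      show "\<And>x. x \<in> {t. min (u a) (u b) < t \<and> t < max (u a) (u b)} \<Longrightarrow> - x \<in> {t. - u a < t \<and> t < - u b}"
        using False by (simp add: min_def max_def)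
    qed simp_all
    moreover have "continuous_on {a..b} (\<lambda>x. - u x)" using cont by (rule continuous_on_minus)
    ultimately have "alternates (\<lambda>x. v (- (- u x))) {a<..<b}" by (intro up)
    then show ?thesis by simp
  qed
qed

text \<open>Soft thresholding: 0 on \<open>[-d, d]\<close> and a translation by \<open>d\<close>
  towards 0 outside, so every slope is 0 or 1.\<close>

definition soft_threshold :: "real \<Rightarrow> real \<Rightarrow> real" where
  "soft_threshold d t = max (t - d) 0 + min (t + d) 0"

text \<open>Two mirror copies of the wave fill the flat part of the threshold. Scaling the argument
  by \<open>d\<close> and the value by \<open>c * d\<close> gives the added wave the Lipschitz
  constant \<open>c\<close>, whatever \<open>d\<close> is.\<close>

definition wave_perturb :: "real \<Rightarrow> real \<Rightarrow> real \<Rightarrow> real" where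
  "wave_perturb c d t = soft_threshold d t + c * d * cantor_wave (\<bar>t\<bar> / d)"

lemma soft_threshold_diff:
  assumes "s \<le> t" "d > 0"
  shows "0 \<le> soft_threshold d t - soft_threshold d s" "soft_threshold d t - soft_threshold d s \<le> t - s"
  using assms by (simp_all add: soft_threshold_def max_def min_def)

lemma wave_perturb_wave_diff:
  assumes "d > 0" "c \<ge> 0"
  shows "\<bar>c * d * cantor_wave (\<bar>t\<bar> / d) - c * d * cantor_wave (\<bar>s\<bar> / d)\<bar> \<le> c * \<bar>t - s\<bar>"
proof -
  have "\<bar>c * d * cantor_wave (\<bar>t\<bar> / d) - c * d * cantor_wave (\<bar>s\<bar> / d)\<bar>
    = (c * d) * \<bar>cantor_wave (\<bar>t\<bar> / d) - cantor_wave (\<bar>s\<bar> / d)\<bar>"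
    using assms by (simp add: right_diff_distrib[symmetric] abs_mult)
  also have "\<dots> \<le> (c * d) * \<bar>\<bar>t\<bar> / d - \<bar>s\<bar> / d\<bar>"
    using assms cantor_wave_nonexpansive by (intro mult_left_mono) auto
  also have "\<bar>\<bar>t\<bar> / d - \<bar>s\<bar> / d\<bar> = \<bar>\<bar>t\<bar> - \<bar>s\<bar>\<bar> / d"
    using assms by (simp add: diff_divide_distrib[symmetric])
  also have "(c * d) * (\<bar>\<bar>t\<bar> - \<bar>s\<bar>\<bar> / d) = c * \<bar>\<bar>t\<bar> - \<bar>s\<bar>\<bar>" using assms by simp
  also have "\<dots> \<le> c * \<bar>t - s\<bar>" using assms by (intro mult_left_mono abs_triangle_ineq3)
  finally show ?thesis .
qed

text \<open>The threshold moves in the direction of \<open>t - s\<close> and by no more than that,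
  and the wave changes by at most \<open>c * |t - s|\<close>. Applied to values of \<open>u\<close>,
  the lower bound keeps the identity plus the perturbation increasing.\<close>

lemma wave_perturb_diff:
  assumes "d > 0" "c \<ge> 0"
  shows "min 0 (t - s) - c * \<bar>t - s\<bar> \<le> wave_perturb c d t - wave_perturb c d s"
    and "wave_perturb c d t - wave_perturb c d s \<le> (1 + c) * \<bar>t - s\<bar>"
proof -
  have S: "min 0 (t - s) \<le> soft_threshold d t - soft_threshold d s"
    "soft_threshold d t - soft_threshold d s \<le> \<bar>t - s\<bar>"
    using soft_threshold_diff[of s t d] soft_threshold_diff[of t s d] assms(1)
    by (cases "s \<le> t"; simp add: min_def)+
  have e: "(1 + c) * \<bar>t - s\<bar> = \<bar>t - s\<bar> + c * \<bar>t - s\<bar>" by (simp add: distrib_right)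
  show "min 0 (t - s) - c * \<bar>t - s\<bar> \<le> wave_perturb c d t - wave_perturb c d s"
    "wave_perturb c d t - wave_perturb c d s \<le> (1 + c) * \<bar>t - s\<bar>"
    using S wave_perturb_wave_diff[OF assms, of t s] unfolding wave_perturb_def e by linarith+
qed

lemma wave_perturb_0: "d > 0 \<Longrightarrow> wave_perturb c d 0 = 0"
  by (simp add: wave_perturb_def soft_threshold_def cantor_wave_nonpos)

lemma wave_perturb_outside: 
  assumes "d > 0"
  shows "d < t \<Longrightarrow> wave_perturb c d t = t - d" "t < - d \<Longrightarrow> wave_perturb c d t = t + d"
proof -
  have 1: "cantor_wave (\<bar>t\<bar> / d) = 0" if "d < \<bar>t\<bar>"
    using assms that by (intro cantor_wave_ge_1) simp
  show "d < t \<Longrightarrow> wave_perturb c d t = t - d" "t < - d \<Longrightarrow> wave_perturb c d t = t + d"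
    using 1 assms by (simp_all add: wave_perturb_def soft_threshold_def)
qed

lemma wave_perturb_inside: 
  "\<bar>t\<bar> \<le> d \<Longrightarrow> wave_perturb c d t = c * d * cantor_wave (\<bar>t\<bar> / d)"
  by (simp add: wave_perturb_def soft_threshold_def abs_le_iff)

lemma wave_perturb_zeroD:
  assumes "d > 0" "c > 0" "wave_perturb c d t = 0"
  shows "\<bar>t\<bar> \<le> d" "\<bar>t\<bar> / d \<in> cantor_zeros"
proof -
  show 1: "\<bar>t\<bar> \<le> d"
    using wave_perturb_outside[OF assms(1), of t c] assms(3) by linarith
  then have "cantor_wave (\<bar>t\<bar> / d) = 0" using wave_perturb_inside[of t d c] assms by simp
  then show "\<bar>t\<bar> / d \<in> cantor_zeros" using 1 assms(1) by (simp add: cantor_zeros_def)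
qed

lemma negligible_wave_perturb_zeros:
  assumes "d > 0" "c > 0"
  shows "negligible {t. wave_perturb c d t = 0}"
proof (rule negligible_subset)
  show "negligible ((\<lambda>x. d * x + 0) ` cantor_zeros \<union> (\<lambda>x. (-d) * x + 0) ` cantor_zeros)"
    by (intro negligible_Un negligible_affine_image negligible_cantor_zeros)
  show "{t. wave_perturb c d t = 0} \<subseteq> (\<lambda>x. d * x + 0) ` cantor_zeros \<union> (\<lambda>x. (-d) * x + 0) ` cantor_zeros"
  proof
    fix t assume "t \<in> {t. wave_perturb c d t = 0}"
    then have z: "\<bar>t\<bar> / d \<in> cantor_zeros" using wave_perturb_zeroD[OF assms] by simp
    show "t \<in> (\<lambda>x. d * x + 0) ` cantor_zeros \<union> (\<lambda>x. (-d) * x + 0) ` cantor_zeros"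
    proof (cases "t \<ge> 0")
      case True
      then have "t = d * (\<bar>t\<bar> / d) + 0" using assms by simp
      then show ?thesis using z by blast
    next
      case False
      then have "t = (-d) * (\<bar>t\<bar> / d) + 0" using assms by simp
      then show ?thesis using z by blast
    qed
  qed
qed

text \<open>\<open>\<sigma>\<close> selects a side of 0, and all four points stay on that side,
  since the function composed later may take values on one side only.\<close>

lemma alternates_wave_perturb:
  assumes d: "d > 0" and c: "c > 0" and z: "z \<in> cantor_zeros" and \<sigma>: "\<sigma> = 1 \<or> \<sigma> = -1" and r: "r > 0"
  shows "alternates (wave_perturb c d) {t. 0 < \<sigma> * t \<and> \<bar>t - \<sigma> * d * z\<bar> < r}"
proof -
  have "r / d > 0" using d r by simp
  note alt = alternates_cantor_wave[OF z this]
  show ?thesis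
  proof (rule alternates_transfer[OF alt, where h="\<lambda>s. \<sigma> * d * s" and k="c * d"])
    fix s assume "s \<in> {0<..<1} \<inter> ball z (r / d)"
    then have s: "0 < s" "s < 1" "\<bar>z - s\<bar> < r / d" by (simp_all add: dist_real_def)
    have a: "\<bar>\<sigma> * d * s\<bar> = d * s" using \<sigma> s d by (auto simp: abs_mult)
    have "\<bar>\<sigma> * d * s - \<sigma> * d * z\<bar> = d * \<bar>z - s\<bar>"
      using \<sigma> d by (auto simp: right_diff_distrib[symmetric] abs_mult abs_minus_commute)
    also have "\<dots> < r" using s(3) d by (simp add: field_simps)
    finally have 1: "\<bar>\<sigma> * d * s - \<sigma> * d * z\<bar> < r" .
    have "0 < d * s" using s d by simp
    then have 2: "0 < \<sigma> * (\<sigma> * d * s)" using \<sigma> by auto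
    show "\<sigma> * d * s \<in> {t. 0 < \<sigma> * t \<and> \<bar>t - \<sigma> * d * z\<bar> < r}" using 1 2 by blast
    have "\<bar>\<sigma> * d * s\<bar> \<le> d" using a s d by simp
    then show "wave_perturb c d (\<sigma> * d * s) = c * d * cantor_wave s"
      using wave_perturb_inside[of "\<sigma> * d * s" d c] a d by simp
  next
    from \<sigma> show "(\<forall>x\<in>{0<..<1} \<inter> ball z (r / d). \<forall>y\<in>{0<..<1} \<inter> ball z (r / d). x < y \<longrightarrow> \<sigma> * d * x < \<sigma> * d * y) \<or>
      (\<forall>x\<in>{0<..<1} \<inter> ball z (r / d). \<forall>y\<in>{0<..<1} \<inter> ball z (r / d). x < y \<longrightarrow> \<sigma> * d * y < \<sigma> * d * x)"
    proof
      assume "\<sigma> = 1"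
      then have "\<sigma> * d * x < \<sigma> * d * y" if "x < y" for x y using d that by simp
      then show ?thesis by blast
    next
      assume "\<sigma> = -1"
      then have "\<sigma> * d * y < \<sigma> * d * x" if "x < y" for x y using d that by simp
      then show ?thesis by blast
    qed
  qed (use c d in simp)
qed

section \<open>Elements of \<open>C_AC\<close> near a polynomial map\<close>

lemma polynomial_mvt:
  fixes q :: "real poly"
  assumes "x < y" "x \<in> I01" "y \<in> I01"
  obtains z where "z \<in> I01" "poly q y - poly q x = (y - x) * poly (pderiv q) z"
proof -
  obtain z where "x < z" "z < y" "poly q y - poly q x = (y - x) * poly (pderiv q) z"
    using poly_MVT[OF assms(1), of q] by blast
  moreover from this have "z \<in> I01" using assms by simp
  ultimately show ?thesis using that by blast
qed

text \<open>Both derivatives are bounded by \<open>K\<close> in absolute value and agree almost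
  everywhere where \<open>|u| > d\<close>, so \<open>rho f g\<close> is at most \<open>2 * K\<close>
  times the measure of the rest. This measure is small for small \<open>d\<close>, as
  \<open>u\<close> has finitely many zeros; for the choice of \<open>d\<close> it is essential that
  \<open>K\<close> does not depend on it.\<close>

lemma C_AC_near_polynomial:
  fixes q :: "real poly"
  assumes q0: "q \<noteq> 0" and q: "poly q 0 = 0" "poly q 1 = 0"
    and pos: "\<And>x. x \<in> I01 \<Longrightarrow> -1 < poly (pderiv q) x" and \<epsilon>: "\<epsilon> > 0"
  defines "g \<equiv> restrict (\<lambda>x. x + poly q x) I01"
  shows "g \<in> H_AC" and "\<exists>f\<in>C_AC. rho f g < \<epsilon>"
proof -
  let ?u = "poly q" and ?u' = "poly (pderiv q)"
  have der: "(?u has_real_derivative ?u' x) (at x)" for x by (rule poly_DERIV)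
  have contu: "continuous_on S ?u" for S by (intro continuous_intros)
  have contu': "continuous_on S ?u'" for S by (intro continuous_intros)
  have I01: "compact I01" "I01 \<noteq> {}" by auto
  obtain xm where xm: "xm \<in> I01" "\<And>x. x \<in> I01 \<Longrightarrow> ?u' xm \<le> ?u' x"
    using continuous_attains_inf[OF I01 contu'] by blast
  \<comment> \<open>The cap at 1 makes \<open>m - 1 \<le> 0\<close>, so that this lower bound also
    lies below \<open>min 0\<close> of an increment of \<open>u\<close>.\<close>
  define m where "m = min (1 + ?u' xm) 1"
  have m3: "m - 1 \<le> ?u' x" if "x \<in> I01" for x
    using xm(2)[OF that] by (simp add: m_def)
  have m: "0 < m" "m \<le> 1" using pos[OF xm(1)] by (simp_all add: m_def)
  obtain xM where xM: "xM \<in> I01" "\<And>x. x \<in> I01 \<Longrightarrow> \<bar>?u' x\<bar> \<le> \<bar>?u' xM\<bar>"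
    using continuous_attains_sup[OF I01, of "\<lambda>x. \<bar>?u' x\<bar>"] contu' by (metis continuous_on_rabs)
  define M where "M = 1 + \<bar>?u' xM\<bar>"
  have M1: "1 \<le> M" by (simp add: M_def)
  have M2: "\<bar>?u' x\<bar> \<le> M" if "x \<in> I01" for x
    using xM(2)[OF that] by (simp add: M_def)
  have ulo: "(m - 1) * (y - x) \<le> ?u y - ?u x" and uabs: "\<bar>?u y - ?u x\<bar> \<le> M * (y - x)"
    if xy: "x \<in> I01" "y \<in> I01" "x \<le> y" for x y
  proof -
    have "(m - 1) * (y - x) \<le> ?u y - ?u x \<and> \<bar>?u y - ?u x\<bar> \<le> M * (y - x)"
    proof (cases "x = y")
      case False
      then have lt: "x < y" using xy(3) by simp
      obtain z where z: "z \<in> I01" "?u y - ?u x = (y - x) * ?u' z"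
        using polynomial_mvt[OF lt xy(1,2), of q] by blast
      have "(m - 1) * (y - x) \<le> (y - x) * ?u' z"
        using mult_right_mono[OF m3[OF z(1)], of "y - x"] xy(3) by (simp add: mult.commute)
      moreover have "\<bar>(y - x) * ?u' z\<bar> \<le> M * (y - x)"
        using mult_right_mono[OF M2[OF z(1)], of "y - x"] xy(3) by (simp add: abs_mult mult.commute)
      ultimately show ?thesis unfolding z(2) by blast
    qed simp
    then show "(m - 1) * (y - x) \<le> ?u y - ?u x" "\<bar>?u y - ?u x\<bar> \<le> M * (y - x)" by blast+
  qed
  \<comment> \<open>The slopes of \<open>x + P (u x)\<close> are at least
    \<open>1 + min 0 u' - c * |u'|\<close>, hence at least \<open>m - c * M\<close>, which is
    \<open>m / 2\<close> for this \<open>c\<close>.\<close>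
  define c where "c = m / (2 * M)"
  have c: "0 < c" "c * M = m / 2" using m M1 by (auto simp: c_def)
  \<comment> \<open>A common bound for the slopes of \<open>f\<close> and \<open>g\<close>, which
    are at most \<open>1 + (1 + c) * M\<close> and \<open>1 + M\<close>.\<close>
  define K where "K = 1 + (1 + c) * M"
  have K: "1 + M \<le> K" "0 < K" using c m(1) M1 by (simp_all add: K_def distrib_right)
  have glo: "m * (y - x) \<le> (y + ?u y) - (x + ?u x)" and ghi: "(y + ?u y) - (x + ?u x) \<le> K * (y - x)"
    if xy: "x \<in> I01" "y \<in> I01" "x \<le> y" for x y
  proof -
    show "m * (y - x) \<le> (y + ?u y) - (x + ?u x)" using ulo[OF xy] by (simp add: algebra_simps)
    have "(1 + M) * (y - x) \<le> K * (y - x)" using K xy(3) by (intro mult_right_mono) auto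
    then show "(y + ?u y) - (x + ?u x) \<le> K * (y - x)" using uabs[OF xy] by (simp add: algebra_simps)
  qed
  show gH: "g \<in> H_AC"
    unfolding g_def by (rule bilipschitz_H_AC[OF glo ghi m(1)]) (use q in simp_all)

  \<comment> \<open>The polynomial is not constant, since it vanishes at 0 without being
    zero.\<close>
  have crit: "finite {x. ?u' x = 0}"
  proof (rule poly_roots_finite)
    show "pderiv q \<noteq> 0"
    proof
      assume "pderiv q = 0"
      then have "degree q = 0" by (simp add: pderiv_eq_0_iff)
      then obtain a where "q = [:a:]" by (rule degree_eq_zeroE)
      then show False using q q0 by simp
    qed
  qed
  have fin0: "finite {x. ?u x = 0}" using q0 by (rule poly_roots_finite)
  \<comment> \<open>The absolute values of the nonzero critical values of \<open>u\<close>. A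
    \<open>d\<close> below all of them ensures that no point with \<open>0 < |u x| \<le> d\<close>
    is critical; the element 1 keeps the set non-empty.\<close>
  define F where "F = insert 1 ((\<lambda>x. \<bar>?u x\<bar>) ` ({x. ?u' x = 0} - {x. ?u x = 0}))"
  have "finite F" "\<forall>a\<in>F. 0 < a" using crit by (auto simp: F_def)
  then have d0: "0 < Min F" by (subst Min_gr_iff) (auto simp: F_def)
  have d0': "Min F \<le> \<bar>?u x\<bar>" if "?u' x = 0" "?u x \<noteq> 0" for x
    using \<open>finite F\<close> that by (intro Min_le) (auto simp: F_def)
  have "negligible {x \<in> I01. ?u x = 0}"
    by (rule negligible_subset[OF negligible_finite[OF fin0]]) blast
  then have "measure lebesgue {x \<in> I01. ?u x = 0} < \<epsilon> / (2 * K)"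
    using \<epsilon> K by (simp add: negligible_imp_measure0)
  then obtain e1 where e1: "e1 > 0" "\<And>d. d \<le> e1 \<Longrightarrow> measure lebesgue {x \<in> I01. \<bar>?u x\<bar> \<le> d} < \<epsilon> / (2 * K)"
    using measure_sublevel[OF contu] by blast
  define d where "d = min e1 (Min F / 2)"
  have d: "0 < d" "d \<le> e1" "d < Min F" using e1 d0 by (auto simp: d_def)
  define P where "P = wave_perturb c d"
  define f where "f = restrict (\<lambda>x. x + P (?u x)) I01"
  have c0: "c \<ge> 0" using c by simp
  have Plo: "(m / 2) * (y - x) \<le> (y + P (?u y)) - (x + P (?u x))"
    and Phi: "(y + P (?u y)) - (x + P (?u x)) \<le> K * (y - x)"
    if xy: "x \<in> I01" "y \<in> I01" "x \<le> y" for x y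
  proof -
    have "(m - 1) * (y - x) \<le> 0" using m(2) xy(3) by (simp add: mult_nonpos_nonneg)
    then have "(m - 1) * (y - x) \<le> min 0 (?u y - ?u x)" using ulo[OF xy] by simp
    moreover have "c * \<bar>?u y - ?u x\<bar> \<le> c * (M * (y - x))" using uabs[OF xy] c0 by (intro mult_left_mono)
    moreover have "c * (M * (y - x)) = (m / 2) * (y - x)" using c(2) by (simp add: mult.assoc[symmetric])
    ultimately have "(m - 1) * (y - x) - (m / 2) * (y - x) \<le> P (?u y) - P (?u x)"
      using wave_perturb_diff(1)[OF d(1) c0, of "?u y" "?u x"] unfolding P_def by linarith
    moreover have "(m - 1) * (y - x) - (m / 2) * (y - x) = (m / 2) * (y - x) - (y - x)"
      by (simp add: field_simps)
    ultimately show "(m / 2) * (y - x) \<le> (y + P (?u y)) - (x + P (?u x))" by linarith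
    have "(1 + c) * \<bar>?u y - ?u x\<bar> \<le> (1 + c) * (M * (y - x))" using uabs[OF xy] c0 by (intro mult_left_mono) auto
    then have "P (?u y) - P (?u x) \<le> (1 + c) * (M * (y - x))"
      using wave_perturb_diff(2)[OF d(1) c0, of "?u y" "?u x"] unfolding P_def by linarith
    then show "(y + P (?u y)) - (x + P (?u x)) \<le> K * (y - x)" by (simp add: K_def algebra_simps)
  qed
  have fH: "f \<in> H_AC"
    unfolding f_def by (rule bilipschitz_H_AC[OF Plo Phi]) (use q m(1) wave_perturb_0[OF d(1)] in \<open>simp_all add: P_def\<close>)
  have fix_iff: "f x - x = P (?u x)" if "x \<in> I01" for x using that by (simp add: f_def)
  have zero: "P (?u x) = 0" "x \<in> I01" if "x \<in> Fix f" for x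
    using fix_iff[OF Fix_mem[OF that]] Fix_eq[OF that] Fix_mem[OF that] by simp_all

  have null: "negligible (Fix f)"
  proof (rule negligible_subset)
    let ?S = "{x. ?u' x \<noteq> 0}"
    \<comment> \<open>Preimages of null sets are null where the derivative does not vanish; the
      finitely many critical points are added separately.\<close>
    have "negligible {x \<in> ?S. ?u x \<in> {t. P t = 0}}"
    proof (rule negligible_differentiable_vimage)
      show "negligible {t. P t = 0}" unfolding P_def by (rule negligible_wave_perturb_zeros[OF d(1) c(1)])
      show "inj ((*) (?u' x))" if "x \<in> ?S" for x using that by (simp add: inj_on_def)
      show "(?u has_derivative (*) (?u' x)) (at x within ?S)" for x
        using der[of x] unfolding has_field_derivative_def by (rule has_derivative_at_withinI)
    qed
    then show "negligible ({x \<in> ?S. ?u x \<in> {t. P t = 0}} \<union> {x. ?u' x = 0})"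
      using negligible_finite[OF crit] by (rule negligible_Un)
    show "Fix f \<subseteq> {x \<in> ?S. ?u x \<in> {t. P t = 0}} \<union> {x. ?u' x = 0}"
      using zero(1) by blast
  qed

  have alt: "alternates (\<lambda>x. f x - x) (I01 \<inter> ball p e)" if p: "p \<in> Fix f" and e: "e > 0" for p e
  proof -
    have pI: "p \<in> I01" and P0: "P (?u p) = 0" using zero[OF p] by blast+
    have z: "\<bar>?u p\<bar> \<le> d" "\<bar>?u p\<bar> / d \<in> cantor_zeros"
      using wave_perturb_zeroD[OF d(1) c(1)] P0 unfolding P_def by blast+
    \<comment> \<open>It suffices to find two points near \<open>p\<close> whose values under
      \<open>u\<close> enclose an alternation of \<open>P\<close>; \<open>alternates_comp\<close>
      pulls it back.\<close>
    have "\<exists>a b. a < b \<and> a \<in> I01 \<inter> ball p e \<and> b \<in> I01 \<inter> ball p e \<and>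
      alternates P {t. min (?u a) (?u b) < t \<and> t < max (?u a) (?u b)}"
    proof (cases "?u p = 0")
      case True
      \<comment> \<open>At a root of \<open>u\<close> the interval reaches from \<open>p\<close> to
        a nearby non-root \<open>x\<close>, which exists because roots are finite in number. The
        wave alternates between 0 and \<open>u x\<close>, and the sign of \<open>u x\<close> decides
        the side.\<close>
      have "infinite (I01 \<inter> ball p e)"
      proof -
        have "{max 0 (p - e)<..<min 1 (p + e)} \<subseteq> I01 \<inter> ball p e" by (auto simp: dist_real_def)
        moreover have "infinite {max 0 (p - e)<..<min 1 (p + e)}" using pI e by (intro infinite_Ioo) auto
        ultimately show ?thesis using finite_subset by blast
      qed
      then obtain x where x: "x \<in> I01 \<inter> ball p e" "?u x \<noteq> 0"
        using fin0 by (metis (mono_tags, lifting) finite_subset mem_Collect_eq subsetI)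
      have 0: "0 \<in> cantor_zeros" by (simp add: cantor_zeros_def cantor_wave_nonpos)
      have pb: "p \<in> I01 \<inter> ball p e" using pI e by simp
      define \<sigma> where "\<sigma> = sgn (?u x)"
      have \<sigma>: "\<sigma> = 1 \<or> \<sigma> = -1" using x(2) by (auto simp: \<sigma>_def sgn_if)
      have "alternates P {t. 0 < \<sigma> * t \<and> \<bar>t - \<sigma> * d * 0\<bar> < \<bar>?u x\<bar>}"
        unfolding P_def by (rule alternates_wave_perturb[OF d(1) c(1) 0 \<sigma>]) (use x(2) in simp)
      then have A: "alternates P {t. min (?u p) (?u x) < t \<and> t < max (?u p) (?u x)}"
      proof (rule alternates_mono)
        show "{t. 0 < \<sigma> * t \<and> \<bar>t - \<sigma> * d * 0\<bar> < \<bar>?u x\<bar>} \<subseteq> {t. min (?u p) (?u x) < t \<and> t < max (?u p) (?u x)}"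
          unfolding True \<sigma>_def using x(2) by (auto simp: sgn_if min_def max_def split: if_splits)
      qed
      have "p \<noteq> x" using True x(2) by blast
      then consider "p < x" | "x < p" by linarith
      then show ?thesis
      proof cases
        case 1 then show ?thesis using A pb x(1) by blast
      next
        case 2 then show ?thesis using A[unfolded min.commute[of "?u p"] max.commute[of "?u p"]] pb x(1) by blast
      qed
    next
      case False
      \<comment> \<open>Here \<open>0 < |u p| \<le> d\<close>, so \<open>p\<close> is not critical
        and \<open>u\<close> crosses the value \<open>u p\<close> strictly at
        \<open>p\<close>.\<close>
      have "?u' p \<noteq> 0" using d0'[of p] z(1) d(3) False by force
      have "p \<noteq> 0" "p \<noteq> 1" using False q by metis+
      then have p01: "0 < p" "p < 1" using pI by simp_all
      have "\<exists>h0>0. \<forall>h. 0 < h \<longrightarrow> h < h0 \<longrightarrow> (?u (p - h) < ?u p \<and> ?u p < ?u (p + h)) \<or> (?u (p + h) < ?u p \<and> ?u p < ?u (p - h))"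
      proof (cases "?u' p > 0")
        case True
        obtain h1 where h1: "h1 > 0" "\<forall>h>0. h < h1 \<longrightarrow> ?u (p - h) < ?u p" using DERIV_pos_inc_left[OF der True] by blast
        obtain h2 where h2: "h2 > 0" "\<forall>h>0. h < h2 \<longrightarrow> ?u p < ?u (p + h)" using DERIV_pos_inc_right[OF der True] by blast
        show ?thesis using h1 h2 by (intro exI[of _ "min h1 h2"]) simp
      next
        case False
        then have neg: "?u' p < 0" using \<open>?u' p \<noteq> 0\<close> by simp
        obtain h1 where h1: "h1 > 0" "\<forall>h>0. h < h1 \<longrightarrow> ?u p < ?u (p - h)" using DERIV_neg_dec_left[OF der neg] by blast
        obtain h2 where h2: "h2 > 0" "\<forall>h>0. h < h2 \<longrightarrow> ?u (p + h) < ?u p" using DERIV_neg_dec_right[OF der neg] by blast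
        show ?thesis using h1 h2 by (intro exI[of _ "min h1 h2"]) simp
      qed
      then obtain h0 where h0: "h0 > 0" "\<And>h. 0 < h \<Longrightarrow> h < h0 \<Longrightarrow> (?u (p - h) < ?u p \<and> ?u p < ?u (p + h)) \<or> (?u (p + h) < ?u p \<and> ?u p < ?u (p - h))"
        by blast
      define h where "h = min (min (h0 / 2) (e / 2)) (min p (1 - p))"
      have h: "0 < h" "h < h0" "h < e" "h \<le> p" "h \<le> 1 - p" using h0(1) e p01 by (auto simp: h_def)
      let ?a = "p - h" and ?b = "p + h"
      \<comment> \<open>Every value closer than \<open>r\<close> to \<open>u p\<close> lies strictly
        between the values of \<open>u\<close> at the two end points.\<close>
      define r where "r = min \<bar>?u ?a - ?u p\<bar> \<bar>?u ?b - ?u p\<bar>"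
      have r: "r > 0" using h0(2)[OF h(1,2)] by (auto simp: r_def)
      define \<sigma> where "\<sigma> = sgn (?u p)"
      have \<sigma>: "\<sigma> = 1 \<or> \<sigma> = -1" using False by (auto simp: \<sigma>_def sgn_if)
      have "\<sigma> * d * (\<bar>?u p\<bar> / d) = ?u p" using d(1) by (simp add: \<sigma>_def sgn_mult_abs)
      then have "alternates P {t. 0 < \<sigma> * t \<and> \<bar>t - ?u p\<bar> < r}"
        using alternates_wave_perturb[OF d(1) c(1) z(2) \<sigma> r] unfolding P_def by simp
      then have "alternates P {t. min (?u ?a) (?u ?b) < t \<and> t < max (?u ?a) (?u ?b)}"
      proof (rule alternates_mono)
        show "{t. 0 < \<sigma> * t \<and> \<bar>t - ?u p\<bar> < r} \<subseteq> {t. min (?u ?a) (?u ?b) < t \<and> t < max (?u ?a) (?u ?b)}"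
        proof
          fix t assume "t \<in> {t. 0 < \<sigma> * t \<and> \<bar>t - ?u p\<bar> < r}"
          then have t: "\<bar>t - ?u p\<bar> < \<bar>?u ?a - ?u p\<bar>" "\<bar>t - ?u p\<bar> < \<bar>?u ?b - ?u p\<bar>" by (simp_all add: r_def)
          from h0(2)[OF h(1,2)] show "t \<in> {t. min (?u ?a) (?u ?b) < t \<and> t < max (?u ?a) (?u ?b)}"
          proof
            assume w: "?u ?a < ?u p \<and> ?u p < ?u ?b"
            then have "?u ?a < t" "t < ?u ?b" using t by linarith+
            then show ?thesis by simp
          next
            assume w: "?u ?b < ?u p \<and> ?u p < ?u ?a"
            then have "?u ?b < t" "t < ?u ?a" using t by linarith+
            then show ?thesis by simp
          qed
        qed
      qed
      moreover have "?a \<in> I01 \<inter> ball p e" "?b \<in> I01 \<inter> ball p e"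
        using h p01 by (simp_all add: dist_real_def)
      moreover have "?a < ?b" using h(1) by simp
      ultimately show ?thesis by blast
    qed
    then obtain a b where ab: "a < b" "a \<in> I01 \<inter> ball p e" "b \<in> I01 \<inter> ball p e"
      "alternates P {t. min (?u a) (?u b) < t \<and> t < max (?u a) (?u b)}" by blast
    have A: "alternates (\<lambda>x. P (?u x)) {a<..<b}" by (rule alternates_comp[OF ab(1) contu ab(4)])
    have sub: "x \<in> I01 \<inter> ball p e" if "x \<in> {a<..<b}" for x
      using ab(2,3) that by (simp add: dist_real_def abs_less_iff)
    show ?thesis
    proof (rule alternates_transfer[OF A, where h="\<lambda>x. x" and k=1])
      show "\<And>x. x \<in> {a<..<b} \<Longrightarrow> f x - x = 1 * P (?u x)" using fix_iff sub by simp
    qed (use sub in blast | simp)+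
  qed
  have fC: "f \<in> C_AC" unfolding C_AC_iff using fH null alt by blast

  obtain D N where N: "negligible N" "\<And>x. x \<in> I01 - N \<Longrightarrow> (f has_real_derivative D x) (at x)"
    using H_AC_derivative[OF fH] by metis
  define Z where "Z = {x \<in> I01. \<bar>?u x\<bar> \<le> d}"
  have Z: "Z \<in> lmeasurable" "Z \<subseteq> I01"
    unfolding Z_def by (intro lmeasurable_compact compact_sublevel contu) blast
  have dg: "(g has_real_derivative 1 + ?u' x) (at x)" if x: "0 < x" "x < 1" for x
  proof (rule DERIV_cong_ev[THEN iffD2])
    show "\<forall>\<^sub>F y in nhds x. g y = y + ?u y"
      using eventually_nhds_in_open[of "{0<..<1}" x] x by (auto elim!: eventually_mono simp: g_def)
    show "((\<lambda>y. y + ?u y) has_real_derivative 1 + ?u' x) (at x)" by (intro derivative_intros der)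
  qed simp_all
  have "rho f g \<le> (2 * K) * measure lebesgue Z"
  proof (rule rho_le_measure[OF fH gH Z])
    show "negligible (N \<union> {0, 1})" using N(1) by simp
  next
    fix x assume "x \<in> Z - (N \<union> {0, 1})"
    then have x: "x \<in> I01 - N" "0 < x" "x < 1" using Z(2) by force+
    have "\<bar>D x\<bar> \<le> K"
    proof (rule lipschitz_deriv_bound[OF N(2)[OF x(1)], of "min x (1 - x)"])
      fix y assume "\<bar>y - x\<bar> < min x (1 - x)"
      then have y: "y \<in> I01" by (simp add: abs_less_iff)
      have xI: "x \<in> I01" using x by simp
      have k2: "0 \<le> (m / 2) * \<bar>y - x\<bar>" using m(1) by simp
      show "\<bar>f y - f x\<bar> \<le> K * \<bar>y - x\<bar>"
      proof (cases "x \<le> y")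
        case True
        then show ?thesis using Plo[OF xI y True] Phi[OF xI y True] k2 y xI by (simp add: f_def)
      next
        case False
        then have "y \<le> x" by simp
        then show ?thesis using Plo[OF y xI \<open>y \<le> x\<close>] Phi[OF y xI \<open>y \<le> x\<close>] k2 y xI by (simp add: f_def)
      qed
    qed (use x in simp)
    moreover have "deriv f x = D x" using DERIV_imp_deriv[OF N(2)[OF x(1)]] .
    moreover have "\<bar>deriv g x\<bar> \<le> K"
      using DERIV_imp_deriv[OF dg[OF x(2,3)]] M2[of x] K(1) x by simp
    ultimately show "\<bar>deriv f x - deriv g x\<bar> \<le> 2 * K" by linarith
  next
    \<comment> \<open>Off \<open>Z\<close> the composed perturbation is locally \<open>u\<close>
      shifted by the constant \<open>d\<close> or \<open>- d\<close>, which leaves the derivative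
      unchanged.\<close>
    fix x assume x: "x \<in> I01 - Z - (N \<union> {0, 1})"
    then have x01: "0 < x" "x < 1" and "d < \<bar>?u x\<bar>" by (auto simp: Z_def)
    then consider "d < ?u x" | "?u x < - d" by linarith
    then have "(f has_real_derivative 1 + ?u' x) (at x)"
    proof cases
      case 1
      have o: "open {y. d < ?u y}" by (intro open_Collect_less continuous_intros)
      show ?thesis
      proof (rule DERIV_cong_ev[THEN iffD2])
        have "\<forall>\<^sub>F y in nhds x. y \<in> {0<..<1} \<inter> {y. d < ?u y}"
          using x01 1 by (intro eventually_nhds_in_open open_Int o) simp_all
        then show "\<forall>\<^sub>F y in nhds x. f y = y + (?u y - d)"
        proof (rule eventually_mono)
          fix y assume "y \<in> {0<..<1} \<inter> {y. d < ?u y}"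
          then show "f y = y + (?u y - d)" 
            using wave_perturb_outside(1)[OF d(1), of "?u y" c] by (simp add: f_def P_def)
        qed
        show "((\<lambda>y. y + (?u y - d)) has_real_derivative 1 + ?u' x) (at x)"
          using der[of x] by (auto intro!: derivative_eq_intros)
      qed simp_all
    next
      case 2
      have o: "open {y. ?u y < - d}" by (intro open_Collect_less continuous_intros)
      show ?thesis
      proof (rule DERIV_cong_ev[THEN iffD2])
        have "\<forall>\<^sub>F y in nhds x. y \<in> {0<..<1} \<inter> {y. ?u y < - d}"
          using x01 2 by (intro eventually_nhds_in_open open_Int o) simp_all
        then show "\<forall>\<^sub>F y in nhds x. f y = y + (?u y + d)"
        proof (rule eventually_mono)
          fix y assume "y \<in> {0<..<1} \<inter> {y. ?u y < - d}"
          then show "f y = y + (?u y + d)" 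
            using wave_perturb_outside(2)[OF d(1), of "?u y" c] by (simp add: f_def P_def)
        qed
        show "((\<lambda>y. y + (?u y + d)) has_real_derivative 1 + ?u' x) (at x)"
          using der[of x] by (auto intro!: derivative_eq_intros)
      qed simp_all
    qed
    then show "deriv f x = deriv g x" using DERIV_imp_deriv dg[OF x01] by metis
  qed
  also have "\<dots> < \<epsilon>" using e1(2)[OF d(2)] K(2) by (simp add: Z_def field_simps)
  finally show "\<exists>f\<in>C_AC. rho f g < \<epsilon>" using fC by blast
qed

section \<open>Density\<close>

text \<open>Truncation makes the target bounded and clipping makes the approximating continuous
  functions bounded, so dominated convergence applies; the Weierstrass theorem does the rest. The
  errors add up to \<open>e * 3/16 + e/8 + e/8\<close>.\<close>

lemma polynomial_L1_approx:
  fixes D :: "real \<Rightarrow> real"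
  assumes D: "D absolutely_integrable_on I01" and D0: "\<And>x. 0 \<le> D x" and e: "e > 0"
  obtains p :: "real poly" where "\<And>x. x \<in> I01 \<Longrightarrow> 0 < poly p x"
    "integral I01 (\<lambda>x. \<bar>poly p x - D x\<bar>) < e"
proof -
  let ?M = "lebesgue_on I01"
  have spM: "space ?M = I01" by simp
  have I: "I01 \<in> sets lebesgue" by simp
  interpret M: finite_measure ?M
    by (rule finite_measureI) (simp add: emeasure_restrict_space)
  have mM: "measure ?M I01 = 1" by (simp add: measure_restrict_space)
  have intD: "integrable ?M D"
    using D unfolding set_integrable_def by (subst integrable_restrict_space) simp_all
  then have mD: "D \<in> borel_measurable ?M" by (rule borel_measurable_integrable)
  have "(\<lambda>n. \<integral>x. (D x - min (D x) (real n)) \<partial>?M) \<longlonglongrightarrow> (\<integral>x. 0 \<partial>?M)"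
  proof (rule integral_dominated_convergence[where w=D])
    show "AE x in ?M. (\<lambda>n. D x - min (D x) (real n)) \<longlonglongrightarrow> 0"
    proof (rule AE_I2, rule tendsto_eventually)
      fix x
      obtain k :: nat where "D x \<le> real k" using real_arch_simple by blast
      then show "\<forall>\<^sub>F n in sequentially. D x - min (D x) (real n) = 0"
        by (intro eventually_sequentiallyI[of k]) (simp add: min_def)
    qed
    show "AE x in ?M. norm (D x - min (D x) (real n)) \<le> D x" for n using D0 by (intro AE_I2) (simp add: min_def)
  qed (use intD mD in measurable)
  then have "(\<lambda>n. \<integral>x. (D x - min (D x) (real n)) \<partial>?M) \<longlonglongrightarrow> 0" by simp
  then have "\<forall>\<^sub>F n in sequentially. (\<integral>x. (D x - min (D x) (real n)) \<partial>?M) < e/8"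
    by (rule order_tendstoD(2)) (use e in simp)
  then obtain n where n: "(\<integral>x. (D x - min (D x) (real n)) \<partial>?M) < e/8" by (auto simp: eventually_sequentially)
  define B where "B = real n"
  have B: "0 \<le> B" by (simp add: B_def)
  have intB: "integrable ?M (\<lambda>x. min (D x) B)"
    by (rule Bochner_Integration.integrable_bound[OF intD]) (use mD D0 B in \<open>auto simp: min_def\<close>)

  define f where "f = (\<lambda>x. indicat_real I01 x *\<^sub>R D x)"
  have "f \<in> borel_measurable lebesgue"
    using D unfolding set_integrable_def f_def by (rule borel_measurable_integrable)
  then have "f measurable_on I01" by (intro lebesgue_measurable_imp_measurable_on I)
  then obtain N g where N: "negligible N" and g: "\<And>n. continuous_on UNIV (g n)"
    "\<And>x. x \<notin> N \<Longrightarrow> (\<lambda>n. g n x) \<longlonglongrightarrow> (if x \<in> I01 then f x else 0)"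
    unfolding measurable_on_def by blast
  \<comment> \<open>Clipping to \<open>[0, B]\<close> provides the dominating constant and does not
    disturb the limit, since \<open>min (D x) B\<close> already lies in that range.\<close>
  define k where "k = (\<lambda>n x. max 0 (min (g n x) B))"
  have contk: "continuous_on S (k n)" for n S
    unfolding k_def using continuous_on_subset[OF g(1) subset_UNIV] by (intro continuous_intros)
  have mk: "k n \<in> borel_measurable ?M" for n
    by (rule continuous_imp_measurable_on_sets_lebesgue[OF contk I])
  have intk: "integrable ?M (k n)" for n
    by (rule M.integrable_const_bound[of _ B]) (use mk B in \<open>auto simp: k_def\<close>)
  have Nn: "N \<in> null_sets lebesgue" using N by (simp add: negligible_iff_null_sets)
  have AEN: "AE x in ?M. x \<in> I01 \<and> x \<notin> N"
  proof -
    have "AE x in lebesgue. x \<notin> N" by (rule AE_not_in[OF Nn])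
    then have "AE x in lebesgue. x \<in> I01 \<longrightarrow> x \<in> I01 \<and> x \<notin> N" by eventually_elim blast
    then show ?thesis by (subst AE_restrict_space_iff) (use I in simp, assumption)
  qed
  have "(\<lambda>n. \<integral>x. \<bar>k n x - min (D x) B\<bar> \<partial>?M) \<longlonglongrightarrow> (\<integral>x. 0 \<partial>?M)"
  proof (rule integral_dominated_convergence[where w="\<lambda>_. B"])
    show "AE x in ?M. (\<lambda>n. \<bar>k n x - min (D x) B\<bar>) \<longlonglongrightarrow> 0"
      using AEN
    proof eventually_elim
      case (elim x)
      then have "(\<lambda>n. g n x) \<longlonglongrightarrow> D x" using g(2)[of x] by (simp add: f_def)
      then have "(\<lambda>n. \<bar>k n x - min (D x) B\<bar>) \<longlonglongrightarrow> \<bar>max 0 (min (D x) B) - min (D x) B\<bar>"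
        unfolding k_def by (intro tendsto_intros tendsto_max tendsto_min)
      moreover have "max 0 (min (D x) B) = min (D x) B" using D0[of x] B by simp
      ultimately show ?case by simp
    qed
    show "AE x in ?M. norm (\<bar>k n x - min (D x) B\<bar>) \<le> B" for n
    proof (rule AE_I2)
      fix x
      have "0 \<le> k n x" "k n x \<le> B" "0 \<le> min (D x) B" "min (D x) B \<le> B" using B D0[of x] by (simp_all add: k_def)
      then show "norm (\<bar>k n x - min (D x) B\<bar>) \<le> B" by simp
    qed
    show "(\<lambda>x. \<bar>k n x - min (D x) B\<bar>) \<in> borel_measurable ?M" for n using mk[of n] mD by measurable
  qed simp_all
  then have "(\<lambda>n. \<integral>x. \<bar>k n x - min (D x) B\<bar> \<partial>?M) \<longlonglongrightarrow> 0" by simp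
  then have "\<forall>\<^sub>F n in sequentially. (\<integral>x. \<bar>k n x - min (D x) B\<bar> \<partial>?M) < e/8"
    by (rule order_tendstoD(2)) (use e in simp)
  then obtain j where j: "(\<integral>x. \<bar>k j x - min (D x) B\<bar> \<partial>?M) < e/8" by (auto simp: eventually_sequentially)

  \<comment> \<open>The shift by \<open>e/8\<close> exceeds the approximation error
    \<open>e/16\<close>, which makes the polynomial strictly positive.\<close>
  have ck: "continuous_on I01 (\<lambda>x. k j x + e/8)" using contk by (intro continuous_intros)
  have e16: "0 < e/16" using e by simp
  obtain P where P: "real_polynomial_function P" "\<And>x. x \<in> I01 \<Longrightarrow> \<bar>k j x + e/8 - P x\<bar> < e/16"
    using Stone_Weierstrass_real_polynomial_function[OF compact_Icc ck e16] by blast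
  obtain a m where am: "P = (\<lambda>x. \<Sum>i\<le>m. a i * x^i)" using real_polynomial_function_imp_sum[OF P(1)] by blast
  define p where "p = (\<Sum>i\<le>m. monom (a i) i)"
  have pP: "poly p x = P x" for x by (simp add: p_def am poly_sum poly_monom)
  have close: "\<bar>poly p x - k j x\<bar> \<le> e * 3/16" and pos: "0 < poly p x" if "x \<in> I01" for x
  proof -
    have "0 \<le> k j x" by (simp add: k_def)
    moreover have "\<bar>k j x + e/8 - poly p x\<bar> < e/16" using P(2)[OF that] by (simp add: pP)
    ultimately show "\<bar>poly p x - k j x\<bar> \<le> e * 3/16" "0 < poly p x" by linarith+
  qed
  have mp: "(\<lambda>x. poly p x) \<in> borel_measurable ?M"
  proof -
    have "continuous_on I01 (\<lambda>x. poly p x)" by (intro continuous_intros)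
    then show ?thesis using I by (rule continuous_imp_measurable_on_sets_lebesgue)
  qed
  define R where "R = (\<lambda>x. e * 3/16 + \<bar>k j x - min (D x) B\<bar> + (D x - min (D x) B))"
  have iR: "integrable ?M R"
    unfolding R_def using intk[of j] intB intD
    by (intro Bochner_Integration.integrable_add Bochner_Integration.integrable_diff integrable_abs) simp_all
  have le: "\<bar>poly p x - D x\<bar> \<le> R x" if "x \<in> I01" for x
    using close[OF that] unfolding R_def by linarith
  have ip: "integrable ?M (\<lambda>x. \<bar>poly p x - D x\<bar>)"
    by (rule Bochner_Integration.integrable_bound[OF iR])
      (use mp mD in measurable, use le spM in \<open>intro AE_I2, force\<close>)
  have "integral I01 (\<lambda>x. \<bar>poly p x - D x\<bar>) = (\<integral>x. \<bar>poly p x - D x\<bar> \<partial>?M)"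
    by (rule lebesgue_integral_eq_integral[OF ip I, symmetric])
  also have "\<dots> \<le> (\<integral>x. R x \<partial>?M)" by (rule integral_mono[OF ip iR]) (use le spM in blast)
  also have "\<dots> = e * 3/16 + (\<integral>x. \<bar>k j x - min (D x) B\<bar> \<partial>?M) + (\<integral>x. (D x - min (D x) B) \<partial>?M)"
  proof -
    have i1: "integrable ?M (\<lambda>x. \<bar>k j x - min (D x) B\<bar>)" "integrable ?M (\<lambda>x. D x - min (D x) B)" "integrable ?M (\<lambda>x. e * 3/16)"
      using intk[of j] intB intD by (auto intro: Bochner_Integration.integrable_diff)
    have "(\<integral>x. e * 3/16 \<partial>?M) = e * 3/16" using mM by simp
    then show ?thesis unfolding R_def 
      by (simp only: Bochner_Integration.integral_add[OF Bochner_Integration.integrable_add[OF i1(3,1)] i1(2)]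
        Bochner_Integration.integral_add[OF i1(3,1)])
  qed
  also have "\<dots> < e" using j n e unfolding B_def by linarith
  finally show ?thesis using that pos by blast
qed

lemma poly_antiderivative:
  fixes p :: "real poly"
  obtains Q where "pderiv Q = p" "poly Q 0 = 0"
proof -
  define Q where "Q = (\<Sum>i\<le>degree p. monom (coeff p i / real (Suc i)) (Suc i))"
  have "pderiv Q = p"
  proof (rule poly_eqI)
    fix n
    have "coeff Q (Suc n) = (\<Sum>i\<le>degree p. if i = n then coeff p i / real (Suc i) else 0)"
      unfolding Q_def coeff_sum by (intro sum.cong) simp_all
    also have "\<dots> = coeff p n / real (Suc n)" by (simp add: sum.delta coeff_eq_0)
    finally show "coeff (pderiv Q) n = coeff p n" by (simp add: coeff_pderiv)
  qed
  moreover have "poly Q 0 = 0" by (simp add: Q_def poly_sum poly_monom)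
  ultimately show ?thesis using that by blast
qed

text \<open>The restricted map is differentiated in the open interval only; the end points join the
  exceptional null set.\<close>

lemma rho_polynomial:
  fixes q :: "real poly"
  assumes g: "g \<in> H_AC" and f: "restrict (\<lambda>x. x + poly q x) I01 \<in> H_AC" and N: "negligible N"
    and D: "\<And>x. x \<in> I01 - N \<Longrightarrow> (g has_real_derivative D x) (at x)"
  shows "rho g (restrict (\<lambda>x. x + poly q x) I01) = integral I01 (\<lambda>x. \<bar>1 + poly (pderiv q) x - D x\<bar>)"
proof -
  let ?f = "restrict (\<lambda>x. x + poly q x) I01"
  have df: "deriv ?f x = 1 + poly (pderiv q) x" if x: "0 < x" "x < 1" for x
  proof (rule DERIV_imp_deriv, rule DERIV_cong_ev[THEN iffD2])
    have "\<forall>\<^sub>F y in nhds x. y \<in> {0<..<1}" using x by (intro eventually_nhds_in_open) simp_all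
    then show "\<forall>\<^sub>F y in nhds x. ?f y = y + poly q y" by (rule eventually_mono) simp
    show "((\<lambda>y. y + poly q y) has_real_derivative 1 + poly (pderiv q) x) (at x)" by (intro derivative_intros poly_DERIV)
  qed simp_all
  have N': "negligible (N \<union> {0, 1})" using N by simp
  show ?thesis
    unfolding rho_eq_integral[OF g f]
  proof (rule integral_spike[OF N'])
    fix x assume x: "x \<in> I01 - (N \<union> {0, 1})"
    then have "0 < x" "x < 1" "x \<in> I01 - N" by auto
    then show "\<bar>1 + poly (pderiv q) x - D x\<bar> = \<bar>deriv g x - deriv ?f x\<bar>"
      using df[of x] DERIV_imp_deriv[OF D[of x]] by (simp add: abs_minus_commute)
  qed
qed

text \<open>A polynomial \<open>p\<close> near the derivative of \<open>g\<close> has an integral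
  \<open>J\<close> that is only near 1, so it is divided by \<open>J\<close> to obtain a map that
  fixes 1. The resulting displacement may be the zero polynomial, to which the perturbation does not
  apply; it is then replaced by a small multiple of \<open>x^2 - x\<close>.\<close>

lemma C_AC_dense:
  assumes g: "g \<in> H_AC" and e: "e > 0"
  shows "\<exists>f\<in>C_AC. rho g f < e"
proof -
  obtain D N where N: "negligible N" and D0: "\<And>x. 0 \<le> D x" and Dint: "D absolutely_integrable_on I01"
    and Dd: "\<And>x. x \<in> I01 - N \<Longrightarrow> (g has_real_derivative D x) (at x)"
    and DF: "\<And>x y. x \<in> I01 \<Longrightarrow> y \<in> I01 \<Longrightarrow> x \<le> y \<Longrightarrow> integral {x..y} D = g y - g x"
    using H_AC_derivative[OF g] by metis
  have D1: "integral I01 D = 1"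
    using DF[of 0 1] H_plus_0[OF H_AC_H_plus[OF g]] H_plus_1[OF H_AC_H_plus[OF g]] by simp
  have Di: "D integrable_on I01" using Dint by (rule set_lebesgue_integral_eq_integral(1))
  have pint: "poly r absolutely_integrable_on I01" for r :: "real poly"
    by (rule absolutely_integrable_continuous_real) (intro continuous_intros)
  have dint: "(\<lambda>x. \<bar>poly r x - D x\<bar>) integrable_on I01" for r
    by (rule set_lebesgue_integral_eq_integral(1)[OF set_integrable_abs[OF set_integral_diff(1)[OF pint Dint]]])
  have cint: "poly r integrable_on I01" for r :: "real poly" by (rule set_lebesgue_integral_eq_integral(1)[OF pint])
  have e8: "e/8 > 0" using e by simp
  obtain p where p: "\<And>x. x \<in> I01 \<Longrightarrow> 0 < poly p x" "integral I01 (\<lambda>x. \<bar>poly p x - D x\<bar>) < e/8"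
    using polynomial_L1_approx[OF Dint D0 e8] by blast
  obtain Q where Q: "pderiv Q = p" "poly Q 0 = 0" using poly_antiderivative[of p] by blast
  define J where "J = poly Q 1"
  have "(poly p has_integral (poly Q 1 - poly Q 0)) I01"
  proof (rule fundamental_theorem_of_calculus)
    show "(poly Q has_vector_derivative poly p x) (at x within I01)" for x
      using poly_DERIV[of Q x] unfolding Q(1) has_real_derivative_iff_has_vector_derivative
      by (rule has_vector_derivative_at_within)
  qed simp
  then have J: "integral I01 (poly p) = J" using Q(2) by (simp add: J_def integral_unique)
  have Jpos: "J > 0"
  proof -
    obtain z where "0 < z" "z < 1" "poly Q 1 - poly Q 0 = (1 - 0) * poly (pderiv Q) z"
      using poly_MVT[of 0 1 Q] by auto
    then show ?thesis using p(1)[of z] Q by (simp add: J_def)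
  qed
  have J1: "\<bar>J - 1\<bar> < e/8"
  proof -
    have "J - 1 = integral I01 (\<lambda>x. poly p x - D x)"
      using J D1 cint Di by (simp add: Henstock_Kurzweil_Integration.integral_diff)
    also have "\<bar>\<dots>\<bar> \<le> integral I01 (\<lambda>x. \<bar>poly p x - D x\<bar>)"
      using integral_norm_bound_integral[of "\<lambda>x. poly p x - D x" I01 "\<lambda>x. \<bar>poly p x - D x\<bar>"]
        dint[of p] cint[of p] Di by (simp add: integrable_diff)
    finally show ?thesis using p(2) by simp
  qed
  define r where "r = smult (1/J) p"
  \<comment> \<open>Rescaling costs \<open>|1/J - 1| * J = |1 - J|\<close>, which is below
    \<open>e/8\<close>.\<close>
  have r1: "integral I01 (\<lambda>x. \<bar>poly r x - D x\<bar>) < e/4"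
  proof -
    have i2: "(\<lambda>x. \<bar>1/J - 1\<bar> * poly p x) integrable_on I01"
    proof -
      have "(\<lambda>x. poly (smult \<bar>1/J - 1\<bar> p) x) integrable_on I01" by (rule cint)
      then show ?thesis by (simp only: poly_smult)
    qed
    have "integral I01 (\<lambda>x. \<bar>poly r x - D x\<bar>) \<le> integral I01 (\<lambda>x. \<bar>poly p x - D x\<bar> + \<bar>1/J - 1\<bar> * poly p x)"
    proof (rule integral_le[OF dint integrable_add[OF dint i2]])
      fix x assume x: "x \<in> I01"
      have "\<bar>1/J - 1\<bar> * poly p x = \<bar>(1/J - 1) * poly p x\<bar>" using p(1)[OF x] by (simp add: abs_mult)
      also have "(1/J - 1) * poly p x = poly r x - poly p x" by (simp add: r_def algebra_simps)
      finally show "\<bar>poly r x - D x\<bar> \<le> \<bar>poly p x - D x\<bar> + \<bar>1/J - 1\<bar> * poly p x" by linarith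
    qed
    also have "\<dots> = integral I01 (\<lambda>x. \<bar>poly p x - D x\<bar>) + \<bar>1/J - 1\<bar> * J"
      using Henstock_Kurzweil_Integration.integral_add[OF dint[of p] i2] J by simp
    also have "\<bar>1/J - 1\<bar> * J = \<bar>(1/J - 1) * J\<bar>" using Jpos by (simp add: abs_mult)
    also have "(1/J - 1) * J = 1 - J" using Jpos by (simp add: field_simps)
    finally show ?thesis using p(2) J1 by linarith
  qed
  define q0 where "q0 = smult (1/J) Q - [:0, 1:]"
  have q0: "poly q0 0 = 0" "poly q0 1 = 0" "pderiv q0 = r - 1"
    using Q Jpos by (simp_all add: q0_def J_def r_def pderiv_diff pderiv_smult pderiv_pCons one_pCons)
  \<comment> \<open>At most \<open>1/2\<close>, which keeps the derivative of the displacement above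
    \<open>-1\<close>, and at most \<open>e/8\<close>, which keeps the change in L1 small.\<close>
  define \<eta> where "\<eta> = min (1/2) (e/8)"
  have \<eta>: "0 < \<eta>" "\<eta> < 1" "\<eta> \<le> e/8" using e by (auto simp: \<eta>_def)
  define q where "q = (if q0 = 0 then smult \<eta> [:0, -1, 1:] else q0)"
  have "q \<noteq> 0 \<and> poly q 0 = 0 \<and> poly q 1 = 0 \<and> (\<forall>x\<in>I01. -1 < poly (pderiv q) x) \<and>
    integral I01 (\<lambda>x. \<bar>1 + poly (pderiv q) x - D x\<bar>) < e/2"
  proof (cases "q0 = 0")
    case False
    have "-1 < poly (pderiv q0) x" if "x \<in> I01" for x
      using p(1)[OF that] Jpos by (simp add: q0(3) r_def)
    moreover have "1 + poly (pderiv q0) x - D x = poly r x - D x" for x by (simp add: q0(3))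
    ultimately show ?thesis using False q0(1,2) r1 e by (simp add: q_def)
  next
    case True
    then have qq: "q = smult \<eta> [:0, -1, 1:]" by (simp add: q_def)
    have dq: "poly (pderiv q) x = \<eta> * (2 * x - 1)" for x by (simp add: qq pderiv_pCons pderiv_smult algebra_simps)
    have b: "\<bar>\<eta> * (2 * x - 1)\<bar> \<le> \<eta>" if "x \<in> I01" for x
    proof -
      have "\<bar>2 * x - 1\<bar> \<le> 1" using that by (simp add: abs_le_iff)
      then show ?thesis using \<eta>(1) by (simp add: abs_mult mult_left_le)
    qed
    have lo: "-1 < poly (pderiv q) x" if "x \<in> I01" for x
      using b[OF that] \<eta>(2) unfolding dq by linarith
    have "r = 1" using q0(3) True by simp
    then have r1': "integral I01 (\<lambda>x. \<bar>1 - D x\<bar>) < e/4" using r1 by simp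
    have i1: "(\<lambda>x. \<bar>1 - D x\<bar>) integrable_on I01" using dint[of 1] by simp
    have "integral I01 (\<lambda>x. \<bar>1 + poly (pderiv q) x - D x\<bar>) \<le> integral I01 (\<lambda>x. \<bar>1 - D x\<bar> + \<eta>)"
    proof (rule integral_le)
      show "(\<lambda>x. \<bar>1 + poly (pderiv q) x - D x\<bar>) integrable_on I01" using dint[of "1 + pderiv q"] by simp
      show "(\<lambda>x. \<bar>1 - D x\<bar> + \<eta>) integrable_on I01" by (intro integrable_add i1) (simp add: integrable_const_ivl)
      fix x assume "x \<in> I01"
      then show "\<bar>1 + poly (pderiv q) x - D x\<bar> \<le> \<bar>1 - D x\<bar> + \<eta>" using b[of x] unfolding dq by linarith
    qed
    also have "\<dots> = integral I01 (\<lambda>x. \<bar>1 - D x\<bar>) + \<eta>"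
      using Henstock_Kurzweil_Integration.integral_add[OF i1, of "\<lambda>x. \<eta>"] by (simp add: integrable_const_ivl)
    also have "\<dots> < e/2" using r1' \<eta>(3) e by linarith
    finally have le: "integral I01 (\<lambda>x. \<bar>1 + poly (pderiv q) x - D x\<bar>) < e/2" .
    have "q \<noteq> 0" using \<eta>(1) by (simp add: qq)
    moreover have "poly q 0 = 0" "poly q 1 = 0" by (simp_all add: qq)
    ultimately show ?thesis using lo le by blast
  qed
  then have q: "q \<noteq> 0" "poly q 0 = 0" "poly q 1 = 0" "\<And>x. x \<in> I01 \<Longrightarrow> -1 < poly (pderiv q) x"
    "integral I01 (\<lambda>x. \<bar>1 + poly (pderiv q) x - D x\<bar>) < e/2" by blast+
  let ?g = "restrict (\<lambda>x. x + poly q x) I01"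
  have e2: "e/2 > 0" using e by simp
  have gH: "?g \<in> H_AC" by (rule C_AC_near_polynomial(1)[OF q(1-4) e2])
  obtain f where f: "f \<in> C_AC" "rho f ?g < e/2" using C_AC_near_polynomial(2)[OF q(1-4) e2] by blast
  have fH: "f \<in> H_AC" using f(1) by (simp add: C_AC_iff)
  have "rho g ?g < e/2" using rho_polynomial[OF g gH N Dd] q(5) by simp
  then have "rho g f < e" using H_AC.triangle[OF g gH fH] f(2) H_AC.commute[of f ?g] by linarith
  then show ?thesis using f(1) by blast
qed

lemma closure_of_C_AC: "H_AC_topology closure_of C_AC = topspace H_AC_topology"
proof -
  have "g \<in> H_AC_topology closure_of C_AC" if g: "g \<in> H_AC" for g
    unfolding H_AC_topology_def H_AC.metric_closure_of
  proof (intro CollectI conjI allI impI g)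
    fix r :: real assume "0 < r"
    then obtain f where "f \<in> C_AC" "rho g f < r" using C_AC_dense[OF g] by blast
    moreover from this have "f \<in> H_AC" unfolding C_AC_iff by blast
    ultimately show "\<exists>y\<in>C_AC. y \<in> H_AC.mball g r" using g by (intro bexI[of _ f]) simp_all
  qed
  then have "topspace H_AC_topology \<subseteq> H_AC_topology closure_of C_AC"
    unfolding topspace_H_AC_topology by (rule subsetI)
  then show ?thesis by (intro subset_antisym closure_of_subset_topspace)
qed

section \<open>Conjugacy on one orbital\<close>

lemma H_plus_fixed_interval:
  assumes f: "f \<in> H_plus" and ab: "a \<in> Fix f" "b \<in> Fix f" and x: "x \<in> {a<..<b}"
  shows "x \<in> I01" "f x \<in> {a<..<b}" "inv_into I01 f x \<in> {a<..<b}"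
proof -
  have aI: "a \<in> I01" "b \<in> I01" "f a = a" "f b = b" using Fix_mem[OF ab(1)] Fix_mem[OF ab(2)] Fix_eq[OF ab(1)] Fix_eq[OF ab(2)] .
  show xI: "x \<in> I01" using aI x by simp
  show "f x \<in> {a<..<b}" using H_plus_less[OF f aI(1) xI] H_plus_less[OF f xI aI(2)] aI(3,4) x by simp
  let ?y = "inv_into I01 f x"
  have y: "?y \<in> I01" "f ?y = x" using H_plus_inv_mem[OF f xI] H_plus_f_inv[OF f xI] by blast+
  show "?y \<in> {a<..<b}" using H_plus_less[OF f aI(1) y(1)] H_plus_less[OF f y(1) aI(2)] aI(3,4) y(2) x by simp
qed

text \<open>Between two fixed points \<open>f\<close> and its inverse are mutually inverse
  bijections, so all integer powers exist. Induction runs from 0 in both directions; for null sets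
  the Lusin condition of \<open>f\<close> serves one direction and that of the inverse the
  other.\<close>

lemma integer_iterates:
  assumes f: "f \<in> H_AC" and ab: "a \<in> Fix f" "b \<in> Fix f"
  obtains F :: "int \<Rightarrow> real \<Rightarrow> real"
  where "\<And>x. F 0 x = x" "\<And>n x. x \<in> {a<..<b} \<Longrightarrow> F n x \<in> {a<..<b}"
    "\<And>n x. x \<in> {a<..<b} \<Longrightarrow> F (n + 1) x = f (F n x)"
    "\<And>m n x. x \<in> {a<..<b} \<Longrightarrow> F m (F n x) = F (m + n) x"
    "\<And>n x y. x \<in> {a<..<b} \<Longrightarrow> y \<in> {a<..<b} \<Longrightarrow> F n x < F n y \<longleftrightarrow> x < y"
    "\<And>n E. E \<subseteq> {a<..<b} \<Longrightarrow> negligible E \<Longrightarrow> negligible (F n ` E)"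
proof -
  let ?J = "{a<..<b}"
  let ?g = "inv_into I01 f"
  have fP: "f \<in> H_plus" using H_AC_H_plus[OF f] .
  have N: "lusin_N f" "lusin_N ?g" using f by (simp_all add: H_AC_iff)
  note J = H_plus_fixed_interval[OF fP ab]
  have gf: "?g (f x) = x" "f (?g x) = x" if "x \<in> ?J" for x
    using H_plus_inv_f[OF fP J(1)[OF that]] H_plus_f_inv[OF fP J(1)[OF that]] .
  define F where "F = (\<lambda>n::int. if 0 \<le> n then f ^^ nat n else ?g ^^ nat (- n))"
  have F0: "F 0 x = x" for x by (simp add: F_def)
  have pow: "(f ^^ k) x \<in> ?J" "(?g ^^ k) x \<in> ?J" if "x \<in> ?J" for k x
    by (induction k) (use that J(2,3) in auto)
  have FJ: "F n x \<in> ?J" if "x \<in> ?J" for n x using pow[OF that] by (simp only: F_def split: if_split) blast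
  have F1: "F (n + 1) x = f (F n x)" if x: "x \<in> ?J" for n x
  proof (cases "0 \<le> n")
    case True
    then have "nat (n + 1) = Suc (nat n)" by simp
    then show ?thesis using True by (simp add: F_def)
  next
    case False
    define k where "k = nat (- n - 1)"
    have k: "nat (- n) = Suc k" using False by (simp add: k_def)
    have "F n x = ?g ((?g ^^ k) x)" using False k by (simp add: F_def)
    then have "f (F n x) = (?g ^^ k) x" using gf(2)[OF pow(2)[OF x]] by simp
    moreover have "F (n + 1) x = (?g ^^ k) x"
    proof (cases "n + 1 = 0")
      case True
      then have "k = 0" by (simp add: k_def)
      then show ?thesis using True by (simp add: F_def)
    next
      case ne: False
      have "nat (- (n + 1)) = k" by (simp add: k_def)
      then show ?thesis using ne False by (simp add: F_def)
    qed
    ultimately show ?thesis by simp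
  qed
  have Fm: "F (n - 1) x = ?g (F n x)" if x: "x \<in> ?J" for n x
    using F1[OF x, of "n - 1"] gf(1)[OF FJ[OF x, of "n - 1"]] by simp
  have Fadd: "F m (F n x) = F (m + n) x" if x: "x \<in> ?J" for m n x
  proof (induction m rule: int_induct[where k=0])
    case base
    then show ?case by (simp add: F0)
  next
    case (step1 i)
    have "F (i + 1) (F n x) = f (F (i + n) x)" using F1[OF FJ[OF x]] step1(2) by simp
    also have "\<dots> = F (i + n + 1) x" using F1[OF x] by simp
    finally show ?case by (simp add: ac_simps)
  next
    case (step2 i)
    have "F (i - 1) (F n x) = ?g (F (i + n) x)" using Fm[OF FJ[OF x]] step2(2) by simp
    also have "\<dots> = F (i + n - 1) x" using Fm[OF x] by simp
    finally show ?case by (simp add: algebra_simps)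
  qed
  have Fless: "F n x < F n y \<longleftrightarrow> x < y" if x: "x \<in> ?J" and y: "y \<in> ?J" for n x y
  proof (induction n rule: int_induct[where k=0])
    case base
    then show ?case by (simp add: F0)
  next
    case (step1 i)
    then show ?case
      unfolding F1[OF x] F1[OF y] using H_plus_less[OF fP J(1)[OF FJ[OF x]] J(1)[OF FJ[OF y]]] by simp
  next
    case (step2 i)
    have "F i x = f (F (i - 1) x)" "F i y = f (F (i - 1) y)" using F1[OF x, of "i - 1"] F1[OF y, of "i - 1"] by simp_all
    then show ?case
      using step2(2) H_plus_less[OF fP J(1)[OF FJ[OF x]] J(1)[OF FJ[OF y]]] by simp
  qed
  have Fneg: "negligible (F n ` E)" if E: "E \<subseteq> ?J" "negligible E" for n E
  proof (induction n rule: int_induct[where k=0])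
    case base
    then show ?case using E(2) by (simp add: F0)
  next
    case (step1 i)
    have "F (i + 1) ` E = f ` (F i ` E)" unfolding image_image using F1 E(1) by (intro image_cong) blast+
    moreover have "F i ` E \<subseteq> I01" using FJ J(1) E(1) by blast
    ultimately show ?case using step1(2) N(1) unfolding lusin_N_def by metis
  next
    case (step2 i)
    have "F (i - 1) ` E = ?g ` (F i ` E)" unfolding image_image using Fm E(1) by (intro image_cong) blast+
    moreover have "F i ` E \<subseteq> I01" using FJ J(1) E(1) by blast
    ultimately show ?case using step2(2) N(2) unfolding lusin_N_def by metis
  qed
  show ?thesis by (rule that[of F, OF F0 FJ F1 Fadd Fless Fneg])
qed

text \<open>If the iterates stayed on one side of \<open>x\<close>, they would converge
  monotonically to a point inside the interval, and continuity would make this limit a fixed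
  point.\<close>

lemma iterates_cover:
  fixes X :: "int \<Rightarrow> real"
  assumes f: "f \<in> H_plus" and ab: "a \<in> Fix f" "b \<in> Fix f"
    and pos: "\<And>x. x \<in> {a<..<b} \<Longrightarrow> x < f x"
    and XJ: "\<And>n. X n \<in> {a<..<b}" and XS: "\<And>n. X (n + 1) = f (X n)"
    and x: "x \<in> {a<..<b}"
  obtains n where "X n \<le> x" "x < X (n + 1)"
proof -
  let ?J = "{a<..<b}"
  have I: "y \<in> I01" if "y \<in> {a..b}" for y using that Fix_mem[OF ab(1)] Fix_mem[OF ab(2)] by simp
  have cont: "f \<midarrow>y\<rightarrow> f y" if "y \<in> ?J" for y
  proof -
    have "continuous_on ?J f" using H_plus_cont[OF f] by (rule continuous_on_subset) (use I in auto)
    then show ?thesis using that by (simp add: continuous_on_eq_continuous_at isCont_def)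
  qed
  have inc: "X n < X (n + 1)" for n using XS pos[OF XJ] by metis
  have up: "\<exists>k::nat. x < X (int k)"
  proof (rule ccontr)
    assume "\<not> ?thesis"
    then have bd: "X (int k) \<le> x" for k by (meson not_le)
    have "incseq (\<lambda>k. X (int k))"
    proof (rule incseq_SucI)
      fix k show "X (int k) \<le> X (int (Suc k))" using inc[of "int k"] by (simp add: add.commute)
    qed
    then obtain L where L: "(\<lambda>k. X (int k)) \<longlonglongrightarrow> L" "\<And>k. X (int k) \<le> L"
      by (rule incseq_convergent[where B=x]) (use bd in auto)
    have "L \<le> x" by (rule LIMSEQ_le_const2[OF L(1)]) (use bd in blast)
    then have LJ: "L \<in> ?J" using L(2)[of 0] XJ[of 0] x by simp
    have "(\<lambda>k. f (X (int k))) \<longlonglongrightarrow> f L"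
      using cont[OF LJ] L(1) isCont_tendsto_compose[of L f] by (simp add: isCont_def)
    moreover have "(\<lambda>k. f (X (int k))) = (\<lambda>k. X (int (Suc k)))"
    proof
      fix k show "f (X (int k)) = X (int (Suc k))" using XS[of "int k"] by (simp add: add.commute)
    qed
    moreover have "(\<lambda>k. X (int (Suc k))) \<longlonglongrightarrow> L" using L(1) by (rule LIMSEQ_Suc)
    ultimately have "f L = L" using LIMSEQ_unique by metis
    then show False using pos[OF LJ] by simp
  qed
  have down: "\<exists>k::nat. X (- int k) \<le> x"
  proof (rule ccontr)
    assume "\<not> ?thesis"
    then have bd: "x \<le> X (- int k)" for k by (meson not_le less_imp_le)
    have "decseq (\<lambda>k. X (- int k))"
    proof (rule decseq_SucI)
      fix k show "X (- int (Suc k)) \<le> X (- int k)" using inc[of "- int (Suc k)"] by simp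
    qed
    then obtain L where L: "(\<lambda>k. X (- int k)) \<longlonglongrightarrow> L" "\<And>k. L \<le> X (- int k)"
      by (rule decseq_convergent[where B=x]) (use bd in auto)
    have "x \<le> L" by (rule LIMSEQ_le_const[OF L(1)]) (use bd in blast)
    then have LJ: "L \<in> ?J" using L(2)[of 0] XJ[of 0] x by simp
    have "(\<lambda>k. f (X (- int (Suc k)))) \<longlonglongrightarrow> f L"
      using cont[OF LJ] LIMSEQ_Suc[OF L(1)] isCont_tendsto_compose[of L f] by (simp add: isCont_def)
    moreover have "(\<lambda>k. f (X (- int (Suc k)))) = (\<lambda>k. X (- int k))"
    proof
      fix k show "f (X (- int (Suc k))) = X (- int k)" using XS[of "- int (Suc k)"] by simp
    qed
    ultimately have "f L = L" using L(1) LIMSEQ_unique by metis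
    then show False using pos[OF LJ] by simp
  qed
  \<comment> \<open>A set of integers need not have a least element, so the count starts at an index
    whose iterate lies at or below \<open>x\<close>.\<close>
  obtain k where k: "X (- int k) \<le> x" using down by blast
  have "\<exists>j::nat. x < X (- int k + int j)"
  proof -
    obtain i where "x < X (int i)" using up by blast
    then show ?thesis by (intro exI[of _ "k + i"]) simp
  qed
  then obtain j where j: "x < X (- int k + int j)" "\<And>i. i < j \<Longrightarrow> \<not> x < X (- int k + int i)"
    using exists_least_iff[of "\<lambda>j. x < X (- int k + int j)"] by blast
  have "j \<noteq> 0" using j(1) k by (metis add.right_neutral not_le of_nat_0)
  then obtain i where i: "j = Suc i" by (metis not0_implies_Suc)
  show ?thesis
  proof (rule that[of "- int k + int i"])
    show "X (- int k + int i) \<le> x" using j(2)[of i] i by simp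
    show "x < X (- int k + int i + 1)" using j(1) i by (simp add: algebra_simps)
  qed
qed

text \<open>\<open>T\<close> solves Abel's functional equation. It maps the fundamental domain
  \<open>[x0, f x0)\<close> affinely onto \<open>[0, 1)\<close>, and the equation determines it
  elsewhere.\<close>

lemma Abel_function:
  assumes f: "f \<in> H_AC" and ab: "a \<in> Fix f" "b \<in> Fix f" "a < b"
    and pos: "\<And>x. x \<in> {a<..<b} \<Longrightarrow> x < f x"
  obtains T :: "real \<Rightarrow> real" where "strict_mono_on {a<..<b} T" "T ` {a<..<b} = UNIV"
    "\<And>x. x \<in> {a<..<b} \<Longrightarrow> T (f x) = T x + 1"
    "\<And>E. E \<subseteq> {a<..<b} \<Longrightarrow> negligible E \<Longrightarrow> negligible (T ` E)"
    "\<And>E. E \<subseteq> {a<..<b} \<Longrightarrow> negligible (T ` E) \<Longrightarrow> negligible E"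
proof -
  let ?J = "{a<..<b}"
  have fP: "f \<in> H_plus" using H_AC_H_plus[OF f] .
  obtain F :: "int \<Rightarrow> real \<Rightarrow> real" where F0: "\<And>x. F 0 x = x" and FJ: "\<And>n x. x \<in> ?J \<Longrightarrow> F n x \<in> ?J"
    and F1: "\<And>n x. x \<in> ?J \<Longrightarrow> F (n + 1) x = f (F n x)"
    and Fadd: "\<And>m n x. x \<in> ?J \<Longrightarrow> F m (F n x) = F (m + n) x"
    and Fless: "\<And>n x y. x \<in> ?J \<Longrightarrow> y \<in> ?J \<Longrightarrow> F n x < F n y \<longleftrightarrow> x < y"
    and Fneg: "\<And>n E. E \<subseteq> ?J \<Longrightarrow> negligible E \<Longrightarrow> negligible (F n ` E)"
    by (rule integer_iterates[OF f ab(1,2)], rule that)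
  have Fle: "F n x \<le> F n y \<longleftrightarrow> x \<le> y" if "x \<in> ?J" "y \<in> ?J" for n x y
    using Fless[OF that(2,1)] by (simp add: not_less[symmetric])
  define x0 where "x0 = (a + b) / 2"
  have x0: "x0 \<in> ?J" using ab(3) by (simp add: x0_def field_simps)
  define X where "X = (\<lambda>n. F n x0)"
  have XJ: "X n \<in> ?J" for n using FJ[OF x0] by (simp add: X_def)
  have XS: "X (n + 1) = f (X n)" for n using F1[OF x0] by (simp add: X_def)
  have inc: "X n < X (n + 1)" for n using XS pos[OF XJ] by metis
  have Xnat: "X n \<le> X (n + int k)" for n k
  proof (induction k)
    case (Suc k)
    then show ?case using inc[of "n + int k"] by (simp add: algebra_simps)
  qed simp
  have Xmono: "X m \<le> X n" if "m \<le> n" for m n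
    using Xnat[of m "nat (n - m)"] that by simp
  define L where "L = f x0 - x0"
  have L: "L > 0" using pos[OF x0] by (simp add: L_def)
  have X01: "F 1 x0 = f x0" using F1[OF x0, of 0] F0 by simp
  define idx where "idx = (\<lambda>x. THE n. X n \<le> x \<and> x < X (n + 1))"
  have idx_eq: "idx x = n" if "X n \<le> x" "x < X (n + 1)" for x n
    unfolding idx_def
  proof (rule the_equality)
    fix m assume m: "X m \<le> x \<and> x < X (m + 1)"
    show "m = n"
    proof (rule ccontr)
      assume "m \<noteq> n"
      then consider "m + 1 \<le> n" | "n + 1 \<le> m" by linarith
      then show False
      proof cases
        case 1
        then show False using Xmono[OF 1] m that by linarith
      next
        case 2
        then show False using Xmono[OF 2] m that by linarith
      qed
    qed
  qed (use that in simp)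
  have idx: "X (idx x) \<le> x" "x < X (idx x + 1)" if x: "x \<in> ?J" for x
  proof -
    obtain n where n: "X n \<le> x" "x < X (n + 1)"
      by (rule iterates_cover[where X=X, OF fP ab(1,2) pos XJ XS x])
    then have "idx x = n" by (rule idx_eq)
    then show "X (idx x) \<le> x" "x < X (idx x + 1)" using n by simp_all
  qed
  \<comment> \<open>The representative of \<open>x\<close> in the fundamental domain.\<close>
  define R where "R = (\<lambda>x. F (- idx x) x)"
  have R: "x0 \<le> R x" "R x < f x0" "R x \<in> ?J" "F (idx x) (R x) = x" if x: "x \<in> ?J" for x
  proof -
    have a1: "F (- idx x) (X (idx x)) = x0" using Fadd[OF x0, of "- idx x" "idx x"] F0 by (simp add: X_def)
    have a2: "F (- idx x) (X (idx x + 1)) = f x0" using Fadd[OF x0, of "- idx x" "idx x + 1"] X01 by (simp add: X_def)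
    show "x0 \<le> R x" using Fle[OF XJ x, of "- idx x" "idx x"] idx(1)[OF x] a1 by (simp add: R_def)
    show "R x < f x0" using Fless[OF x XJ, of "- idx x" "idx x + 1"] idx(2)[OF x] a2 by (simp add: R_def)
    show "R x \<in> ?J" unfolding R_def by (rule FJ[OF x])
    show "F (idx x) (R x) = x" using Fadd[OF x, of "idx x" "- idx x"] F0 by (simp add: R_def)
  qed
  define T where "T = (\<lambda>x. real_of_int (idx x) + (R x - x0) / L)"
  have Tb: "real_of_int (idx x) \<le> T x" "T x < real_of_int (idx x) + 1" if x: "x \<in> ?J" for x
    using R(1,2)[OF x] L by (simp_all add: T_def L_def)
  have Tsm: "strict_mono_on ?J T"
  proof (rule strict_mono_onI)
    fix x y assume x: "x \<in> ?J" and y: "y \<in> ?J" and xy: "x < y"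
    have "idx x \<le> idx y"
    proof (rule ccontr)
      assume "\<not> ?thesis"
      then have "idx y + 1 \<le> idx x" by simp
      then have "X (idx y + 1) \<le> X (idx x)" by (rule Xmono)
      then show False using idx(2)[OF y] idx(1)[OF x] xy by linarith
    qed
    then consider "idx x = idx y" | "idx x + 1 \<le> idx y" by linarith
    then show "T x < T y"
    proof cases
      case 1
      then have "R x < R y" using Fless[OF x y, of "- idx x"] xy by (simp add: R_def)
      then show ?thesis using 1 L by (simp add: T_def divide_strict_right_mono)
    next
      case 2
      then have "real_of_int (idx x) + 1 \<le> real_of_int (idx y)" by (metis of_int_1 of_int_add of_int_le_iff)
      then show ?thesis using Tb(2)[OF x] Tb(1)[OF y] by linarith
    qed
  qed
  \<comment> \<open>An explicit preimage of \<open>t\<close>: the integer part chooses the power of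
    \<open>f\<close>, the fractional part the point of the fundamental domain.\<close>
  have inverse: "x0 + (t - real_of_int \<lfloor>t\<rfloor>) * L \<in> ?J" 
      "idx (F \<lfloor>t\<rfloor> (x0 + (t - real_of_int \<lfloor>t\<rfloor>) * L)) = \<lfloor>t\<rfloor>"
      "T (F \<lfloor>t\<rfloor> (x0 + (t - real_of_int \<lfloor>t\<rfloor>) * L)) = t" for t
  proof -
    let ?n = "\<lfloor>t\<rfloor>" and ?y = "x0 + (t - real_of_int \<lfloor>t\<rfloor>) * L"
    have fr: "0 \<le> t - real_of_int ?n" "t - real_of_int ?n < 1" by linarith+
    have y: "x0 \<le> ?y" "?y < f x0"
    proof -
      show "x0 \<le> ?y" using fr(1) L by simp
      have "(t - real_of_int ?n) * L < 1 * L" using fr(2) L by (rule mult_strict_right_mono)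
      then show "?y < f x0" by (simp add: L_def)
    qed
    have fx0: "f x0 \<in> ?J" using H_plus_fixed_interval(2)[OF fP ab(1,2) x0] .
    show yJ: "?y \<in> ?J" using y x0 fx0 by simp
    have "X ?n \<le> F ?n ?y" using Fle[OF x0 yJ] y(1) by (simp add: X_def)
    moreover have "F ?n ?y < X (?n + 1)"
    proof -
      have "F ?n (f x0) = X (?n + 1)" using Fadd[OF x0, of ?n 1] X01 by (simp add: X_def)
      then show ?thesis using Fless[OF yJ fx0, of ?n] y(2) by simp
    qed
    ultimately show i: "idx (F ?n ?y) = ?n" by (rule idx_eq)
    have "R (F ?n ?y) = ?y" using Fadd[OF yJ, of "- ?n" ?n] F0 by (simp add: R_def i)
    then show "T (F ?n ?y) = t" using L by (simp add: T_def i)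
  qed
  have Tsurj: "T ` ?J = UNIV"
  proof -
    have "t \<in> T ` ?J" for t
    proof -
      have "T (F \<lfloor>t\<rfloor> (x0 + (t - real_of_int \<lfloor>t\<rfloor>) * L)) \<in> T ` ?J"
        by (rule imageI[OF FJ[OF inverse(1)]])
      then show ?thesis unfolding inverse(3) .
    qed
    then show ?thesis by blast
  qed
  have Tf: "T (f x) = T x + 1" if x: "x \<in> ?J" for x
  proof -
    have fx: "f x \<in> ?J" using H_plus_fixed_interval(2)[OF fP ab(1,2) x] .
    have xI: "x \<in> I01" "X n \<in> I01" for n 
      using H_plus_fixed_interval(1)[OF fP ab(1,2) x] H_plus_fixed_interval(1)[OF fP ab(1,2) XJ] .
    have i: "idx (f x) = idx x + 1"
    proof (rule idx_eq)
      show "X (idx x + 1) \<le> f x" unfolding XS using idx(1)[OF x] H_plus_le[OF fP xI(2) xI(1)] by blast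
      show "f x < X (idx x + 1 + 1)" unfolding XS[of "idx x + 1"] using idx(2)[OF x] H_plus_less[OF fP xI(1) xI(2)] by blast
    qed
    have "F 1 x = f x" using F1[OF x, of 0] F0 by simp
    then have "R (f x) = R x" using Fadd[OF x, of "- (idx x + 1)" 1] by (simp add: R_def i)
    then show ?thesis by (simp add: T_def i)
  qed
  have Tneg: "negligible (T ` E)" if E: "E \<subseteq> ?J" "negligible E" for E
  proof -
    \<comment> \<open>Instead of cutting \<open>E\<close> by index, every integer \<open>n\<close>
      is applied to all of \<open>E\<close>; the union is larger but still a countable union of null
      sets.\<close>
    have "T ` E \<subseteq> (\<Union>n::int. (\<lambda>y. (1/L) * y + (real_of_int n - x0 / L)) ` (F (-n) ` E))"
    proof
      fix t assume "t \<in> T ` E"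
      then obtain x where x: "x \<in> E" "t = T x" by blast
      have "t = (1/L) * F (- idx x) x + (real_of_int (idx x) - x0 / L)"
        by (simp add: x(2) T_def R_def diff_divide_distrib)
      then show "t \<in> (\<Union>n::int. (\<lambda>y. (1/L) * y + (real_of_int n - x0 / L)) ` (F (-n) ` E))" using x(1) by blast
    qed
    moreover have "negligible (\<Union>n::int. (\<lambda>y. (1/L) * y + (real_of_int n - x0 / L)) ` (F (-n) ` E))"
    proof (rule negligible_countable_Union)
      show "countable (range (\<lambda>n::int. (\<lambda>y. (1/L) * y + (real_of_int n - x0 / L)) ` (F (-n) ` E)))" by (rule countable_image) simp
      fix S assume "S \<in> range (\<lambda>n::int. (\<lambda>y. (1/L) * y + (real_of_int n - x0 / L)) ` (F (-n) ` E))"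
      then obtain n where n: "S = (\<lambda>y. (1/L) * y + (real_of_int n - x0 / L)) ` (F (-n) ` E)" by blast
      show "negligible S" unfolding n by (rule negligible_affine_image[OF Fneg[OF E]])
    qed
    ultimately show ?thesis by (rule negligible_subset[rotated])
  qed
  have Tneg': "negligible E" if E: "E \<subseteq> ?J" "negligible (T ` E)" for E
  proof -
    \<comment> \<open>The pieces are cut to the interval because \<open>F n\<close> is known to
      preserve null sets only there.\<close>
    let ?S = "\<lambda>n::int. F n ` ((\<lambda>t. L * t + (x0 - real_of_int n * L)) ` (T ` E) \<inter> ?J)"
    have "E \<subseteq> (\<Union>n. ?S n)"
    proof
      fix x assume x: "x \<in> E"
      then have xJ: "x \<in> ?J" using E(1) by blast
      have "R x = L * T x + (x0 - real_of_int (idx x) * L)" 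
      proof -
        have "L * T x = L * real_of_int (idx x) + (R x - x0)" unfolding T_def distrib_left using L by simp
        then show ?thesis by (simp add: mult.commute)
      qed
      then have "R x \<in> (\<lambda>t. L * t + (x0 - real_of_int (idx x) * L)) ` (T ` E) \<inter> ?J" using x R(3)[OF xJ] by blast
      then have "F (idx x) (R x) \<in> ?S (idx x)" by (rule imageI)
      then show "x \<in> (\<Union>n. ?S n)" unfolding R(4)[OF xJ] by blast
    qed
    moreover have "negligible (\<Union>n. ?S n)"
    proof (rule negligible_countable_Union)
      show "countable (range ?S)" by (rule countable_image) simp
      fix S assume "S \<in> range ?S"
      then obtain n where n: "S = ?S n" by blast
      have "negligible ((\<lambda>t. L * t + (x0 - real_of_int n * L)) ` (T ` E) \<inter> ?J)"
        by (rule negligible_subset[OF negligible_affine_image[OF E(2)]]) blast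
      then show "negligible S" unfolding n by (intro Fneg) blast+
    qed
    ultimately show ?thesis by (rule negligible_subset[rotated])
  qed
  show ?thesis by (rule that[of T, OF Tsm Tsurj Tf Tneg Tneg'])
qed

text \<open>Both maps become the same translation under their Abel functions, so \<open>h\<close> is
  the inverse of one of these after the other.\<close>

lemma positive_orbital_conjugacy:
  assumes f: "f \<in> H_AC" "a \<in> Fix f" "b \<in> Fix f" "a < b" "\<And>x. x \<in> {a<..<b} \<Longrightarrow> x < f x"
    and g: "g \<in> H_AC" "c \<in> Fix g" "d \<in> Fix g" "c < d" "\<And>x. x \<in> {c<..<d} \<Longrightarrow> x < g x"
  obtains h :: "real \<Rightarrow> real" where "strict_mono_on {a<..<b} h" "h ` {a<..<b} = {c<..<d}"
    "\<And>x. x \<in> {a<..<b} \<Longrightarrow> h (f x) = g (h x)"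
    "\<And>E. E \<subseteq> {a<..<b} \<Longrightarrow> negligible (h ` E) \<longleftrightarrow> negligible E"
proof -
  obtain T :: "real \<Rightarrow> real" where T: "strict_mono_on {a<..<b} T" "T ` {a<..<b} = UNIV"
    "\<And>x. x \<in> {a<..<b} \<Longrightarrow> T (f x) = T x + 1"
    "\<And>E. E \<subseteq> {a<..<b} \<Longrightarrow> negligible E \<Longrightarrow> negligible (T ` E)"
    "\<And>E. E \<subseteq> {a<..<b} \<Longrightarrow> negligible (T ` E) \<Longrightarrow> negligible E"
    using Abel_function[OF f] by metis
  obtain S :: "real \<Rightarrow> real" where S: "strict_mono_on {c<..<d} S" "S ` {c<..<d} = UNIV"
    "\<And>x. x \<in> {c<..<d} \<Longrightarrow> S (g x) = S x + 1"
    "\<And>E. E \<subseteq> {c<..<d} \<Longrightarrow> negligible E \<Longrightarrow> negligible (S ` E)"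
    "\<And>E. E \<subseteq> {c<..<d} \<Longrightarrow> negligible (S ` E) \<Longrightarrow> negligible E"
    using Abel_function[OF g] by metis
  define h where "h = (\<lambda>x. inv_into {c<..<d} S (T x))"
  have Sh: "S (h x) = T x" "h x \<in> {c<..<d}" for x
  proof -
    have "T x \<in> S ` {c<..<d}" using S(2) by simp
    then show "S (h x) = T x" "h x \<in> {c<..<d}" unfolding h_def by (rule f_inv_into_f, rule inv_into_into)
  qed
  have injS: "x = y" if "x \<in> {c<..<d}" "y \<in> {c<..<d}" "S x = S y" for x y
    using inj_onD[OF strict_mono_on_imp_inj_on[OF S(1)] that(3,1,2)] .
  show ?thesis
  proof (rule that[of h])
    show "strict_mono_on {a<..<b} h"
    proof (rule strict_mono_onI)
      fix x y assume "x \<in> {a<..<b}" "y \<in> {a<..<b}" "x < y"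
      then have "T x < T y" by (rule strict_mono_onD[OF T(1)])
      then have "S (h x) < S (h y)" by (simp add: Sh)
      then show "h x < h y" using strict_mono_on_less[OF S(1) Sh(2) Sh(2)] by blast
    qed
    show "h ` {a<..<b} = {c<..<d}"
    proof (intro equalityI subsetI)
      fix y assume y: "y \<in> {c<..<d}"
      obtain x where x: "x \<in> {a<..<b}" "T x = S y" using T(2) by (metis UNIV_I imageE)
      have "h x = y" by (rule injS[OF Sh(2) y]) (simp add: Sh x(2))
      then show "y \<in> h ` {a<..<b}" using x(1) by blast
    qed (use Sh(2) in blast)
    show "h (f x) = g (h x)" if x: "x \<in> {a<..<b}" for x
    proof (rule injS[OF Sh(2)])
      show "g (h x) \<in> {c<..<d}" using H_plus_fixed_interval(2)[OF H_AC_H_plus[OF g(1)] g(2,3) Sh(2)] .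
      show "S (h (f x)) = S (g (h x))" using T(3)[OF x] S(3)[OF Sh(2)] by (simp add: Sh)
    qed
    show "negligible (h ` E) \<longleftrightarrow> negligible E" if E: "E \<subseteq> {a<..<b}" for E
    proof -
      have "S ` (h ` E) = T ` E" unfolding image_image by (simp add: Sh)
      moreover have "h ` E \<subseteq> {c<..<d}" using Sh(2) by blast
      ultimately show ?thesis using T(4,5)[OF E] S(4,5)[of "h ` E"] by metis
    qed
  qed
qed

text \<open>On negative orbitals the inverse maps move points up. A map that intertwines the
  inverses also intertwines \<open>f\<close> and \<open>g\<close>.\<close>

lemma orbital_conjugacy:
  assumes f: "f \<in> H_AC" "a \<in> Fix f" "b \<in> Fix f" "a < b"
    and g: "g \<in> H_AC" "c \<in> Fix g" "d \<in> Fix g" "c < d"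
    and sign: "(\<forall>x\<in>{a<..<b}. x < f x) \<and> (\<forall>x\<in>{c<..<d}. x < g x) \<or>
      (\<forall>x\<in>{a<..<b}. f x < x) \<and> (\<forall>x\<in>{c<..<d}. g x < x)"
  shows "\<exists>h :: real \<Rightarrow> real. strict_mono_on {a<..<b} h \<and> h ` {a<..<b} = {c<..<d} \<and>
    (\<forall>x\<in>{a<..<b}. h (f x) = g (h x)) \<and>
    (\<forall>E\<subseteq>{a<..<b}. negligible (h ` E) \<longleftrightarrow> negligible E)"
  using sign
proof
  assume "(\<forall>x\<in>{a<..<b}. x < f x) \<and> (\<forall>x\<in>{c<..<d}. x < g x)"
  then have P: "\<And>x. x \<in> {a<..<b} \<Longrightarrow> x < f x" "\<And>x. x \<in> {c<..<d} \<Longrightarrow> x < g x" by blast+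
  obtain h :: "real \<Rightarrow> real" where h: "strict_mono_on {a<..<b} h" "h ` {a<..<b} = {c<..<d}"
    "\<And>x. x \<in> {a<..<b} \<Longrightarrow> h (f x) = g (h x)"
    "\<And>E. E \<subseteq> {a<..<b} \<Longrightarrow> negligible (h ` E) \<longleftrightarrow> negligible E"
    using positive_orbital_conjugacy[OF f P(1) g P(2)] by metis
  show ?thesis
  proof (intro exI[of _ h] conjI ballI allI impI)
    show "strict_mono_on {a<..<b} h" "h ` {a<..<b} = {c<..<d}" by (fact h)+
    show "h (f x) = g (h x)" if "x \<in> {a<..<b}" for x by (rule h(3)[OF that])
    show "negligible (h ` E) \<longleftrightarrow> negligible E" if "E \<subseteq> {a<..<b}" for E by (rule h(4)[OF that])
  qed
next
  assume neg: "(\<forall>x\<in>{a<..<b}. f x < x) \<and> (\<forall>x\<in>{c<..<d}. g x < x)"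
  have inv: "restrict (inv_into I01 k) I01 \<in> H_AC \<and> p \<in> Fix (restrict (inv_into I01 k) I01) \<and> q \<in> Fix (restrict (inv_into I01 k) I01)
      \<and> (\<forall>x\<in>{p<..<q}. x < restrict (inv_into I01 k) I01 x)"
    if k: "k \<in> H_AC" "p \<in> Fix k" "q \<in> Fix k" "\<forall>x\<in>{p<..<q}. k x < x" for k p q
  proof -
    have kP: "k \<in> H_plus" using H_AC_H_plus[OF k(1)] .
    have fx: "x \<in> Fix (restrict (inv_into I01 k) I01)" if "x \<in> Fix k" for x
    proof (rule FixI)
      show "x \<in> I01" using Fix_mem[OF that] .
      then show "restrict (inv_into I01 k) I01 x = x" using H_plus_inv_f[OF kP, of x] Fix_eq[OF that] by simp
    qed
    have "x < restrict (inv_into I01 k) I01 x" if x: "x \<in> {p<..<q}" for x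
    proof -
      have xI: "x \<in> I01" and y: "inv_into I01 k x \<in> {p<..<q}" using H_plus_fixed_interval[OF kP k(2,3) x] by blast+
      have "k (inv_into I01 k x) < inv_into I01 k x" using k(4) y by blast
      then show ?thesis using H_plus_f_inv[OF kP xI] xI by simp
    qed
    then show ?thesis using H_AC_inv[OF k(1)] fx k(2,3) by blast
  qed
  let ?f = "restrict (inv_into I01 f) I01" and ?g = "restrict (inv_into I01 g) I01"
  have F: "?f \<in> H_AC" "a \<in> Fix ?f" "b \<in> Fix ?f" "\<And>x. x \<in> {a<..<b} \<Longrightarrow> x < ?f x"
    using inv[OF f(1-3)] neg by blast+
  have G: "?g \<in> H_AC" "c \<in> Fix ?g" "d \<in> Fix ?g" "\<And>x. x \<in> {c<..<d} \<Longrightarrow> x < ?g x"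
    using inv[OF g(1-3)] neg by blast+
  obtain h :: "real \<Rightarrow> real" where h: "strict_mono_on {a<..<b} h" "h ` {a<..<b} = {c<..<d}"
    "\<And>x. x \<in> {a<..<b} \<Longrightarrow> h (?f x) = ?g (h x)"
    "\<And>E. E \<subseteq> {a<..<b} \<Longrightarrow> negligible (h ` E) \<longleftrightarrow> negligible E"
    using positive_orbital_conjugacy[OF F(1-3) f(4) F(4) G(1-3) g(4) G(4)] by metis
  have fP: "f \<in> H_plus" and gP: "g \<in> H_plus" using H_AC_H_plus f(1) g(1) by blast+
  have comm: "h (f x) = g (h x)" if x: "x \<in> {a<..<b}" for x
  proof -
    have xI: "x \<in> I01" and fx: "f x \<in> {a<..<b}" using H_plus_fixed_interval[OF fP f(2,3) x] by blast+
    have fI: "f x \<in> I01" using H_plus_mem[OF fP xI] .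
    have hfx: "h (f x) \<in> {c<..<d}" using h(2) fx by blast
    have hI: "h (f x) \<in> I01" using H_plus_fixed_interval(1)[OF gP g(2,3) hfx] .
    \<comment> \<open>The relation for the inverses is used at the point \<open>f x\<close>.\<close>
    have "h (?f (f x)) = ?g (h (f x))" using h(3)[OF fx] .
    then have "h x = inv_into I01 g (h (f x))"
      unfolding restrict_apply'[OF fI] restrict_apply'[OF hI] H_plus_inv_f[OF fP xI] .
    then show ?thesis using H_plus_f_inv[OF gP hI] by simp
  qed
  show ?thesis
  proof (intro exI[of _ h] conjI ballI allI impI)
    show "strict_mono_on {a<..<b} h" "h ` {a<..<b} = {c<..<d}" by (fact h)+
    show "h (f x) = g (h x)" if "x \<in> {a<..<b}" for x by (rule comm[OF that])
    show "negligible (h ` E) \<longleftrightarrow> negligible E" if "E \<subseteq> {a<..<b}" for E by (rule h(4)[OF that])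
  qed
qed

section \<open>Back and forth\<close>

text \<open>A dense order without end points in which both colours are dense; \<open>True\<close>
  will stand for positive parity. With the colour included in the end point clauses, every kind of
  gap is filled in a single step.\<close>

definition coloured_dense :: "real set \<Rightarrow> (real \<Rightarrow> bool) \<Rightarrow> bool" where
  "coloured_dense A c \<longleftrightarrow> A \<noteq> {} \<and>
     (\<forall>x\<in>A. \<forall>y\<in>A. x < y \<longrightarrow> (\<forall>k. \<exists>z\<in>A. x < z \<and> z < y \<and> c z = k)) \<and>
     (\<forall>x\<in>A. \<forall>k. \<exists>z\<in>A. z < x \<and> c z = k) \<and> (\<forall>x\<in>A. \<forall>k. \<exists>z\<in>A. x < z \<and> c z = k)"

text \<open>Only the largest element of \<open>L\<close> and the smallest of \<open>U\<close>
  matter; on an empty side the absence of an end point takes their place.\<close>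

lemma coloured_dense_fill_gap:
  assumes A: "coloured_dense A c" and L: "finite L" "L \<subseteq> A" and U: "finite U" "U \<subseteq> A"
    and LU: "\<And>l u. l \<in> L \<Longrightarrow> u \<in> U \<Longrightarrow> l < u"
  obtains z where "z \<in> A" "\<And>l. l \<in> L \<Longrightarrow> l < z" "\<And>u. u \<in> U \<Longrightarrow> z < u" "c z = k"
proof -
  have ne: "A \<noteq> {}"
    and btw: "\<And>x y. x \<in> A \<Longrightarrow> y \<in> A \<Longrightarrow> x < y \<Longrightarrow> \<exists>z\<in>A. x < z \<and> z < y \<and> c z = k"
    and lo: "\<And>x. x \<in> A \<Longrightarrow> \<exists>z\<in>A. z < x \<and> c z = k" and hi: "\<And>x. x \<in> A \<Longrightarrow> \<exists>z\<in>A. x < z \<and> c z = k"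
    using A unfolding coloured_dense_def by blast+
  have maxL: "Max L \<in> A" "\<And>l. l \<in> L \<Longrightarrow> l \<le> Max L" if "L \<noteq> {}"
    using Max_in[OF L(1) that] L(2) Max_ge[OF L(1)] by blast+
  have minU: "Min U \<in> A" "\<And>u. u \<in> U \<Longrightarrow> Min U \<le> u" if "U \<noteq> {}"
    using Min_in[OF U(1) that] U(2) Min_le[OF U(1)] by blast+
  consider "L = {}" "U = {}" | "L = {}" "U \<noteq> {}" | "L \<noteq> {}" "U = {}" | "L \<noteq> {}" "U \<noteq> {}" by blast
  then show ?thesis
  proof cases
    case 1
    obtain a where "a \<in> A" using ne by blast
    then obtain z where "z \<in> A" "c z = k" using lo by blast
    then show ?thesis using 1 that by blast
  next
    case 2
    then obtain z where z: "z \<in> A" "z < Min U" "c z = k" using lo[OF minU(1)] by blast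
    have "z < u" if "u \<in> U" for u using z(2) minU(2)[OF 2(2) that] by linarith
    then show ?thesis using z(1,3) 2(1) that by blast
  next
    case 3
    then obtain z where z: "z \<in> A" "Max L < z" "c z = k" using hi[OF maxL(1)] by blast
    have "l < z" if "l \<in> L" for l using z(2) maxL(2)[OF 3(1) that] by linarith
    then show ?thesis using z(1,3) 3(2) that by blast
  next
    case 4
    have "Max L < Min U" using LU[OF Max_in[OF L(1) 4(1)] Min_in[OF U(1) 4(2)]] .
    then obtain z where z: "z \<in> A" "Max L < z" "z < Min U" "c z = k"
      using btw[OF maxL(1)[OF 4(1)] minU(1)[OF 4(2)]] by blast
    have "l < z" if "l \<in> L" for l using z(2) maxL(2)[OF 4(1) that] by linarith
    moreover have "z < u" if "u \<in> U" for u using z(3) minU(2)[OF 4(2) that] by linarith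
    ultimately show ?thesis using z(1,4) that by blast
  qed
qed

text \<open>The order clause makes \<open>P\<close> the graph of an injective function: if first
  components agree, neither second component is less than the other, and likewise with the roles
  exchanged.\<close>

definition partial_iso :: "real set \<Rightarrow> (real \<Rightarrow> bool) \<Rightarrow> real set \<Rightarrow> (real \<Rightarrow> bool) \<Rightarrow> (real \<times> real) set \<Rightarrow> bool" where
  "partial_iso A c B d P \<longleftrightarrow> finite P \<and> P \<subseteq> A \<times> B \<and> (\<forall>p\<in>P. c (fst p) = d (snd p)) \<and>
     (\<forall>p\<in>P. \<forall>q\<in>P. fst p < fst q \<longleftrightarrow> snd p < snd q)"

text \<open>Reduces the step back to the step forth.\<close>

lemma partial_iso_converse:
  assumes "partial_iso A c B d P"
  shows "partial_iso B d A c (P\<inverse>)"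
proof -
  have P: "finite P" "P \<subseteq> A \<times> B" "\<And>p. p \<in> P \<Longrightarrow> c (fst p) = d (snd p)"
    "\<And>p q. p \<in> P \<Longrightarrow> q \<in> P \<Longrightarrow> fst p < fst q \<longleftrightarrow> snd p < snd q"
    using assms unfolding partial_iso_def by blast+
  have swap: "(snd p, fst p) \<in> P" if "p \<in> P\<inverse>" for p using that by (cases p) simp
  show ?thesis
    unfolding partial_iso_def
  proof (intro conjI ballI)
    show "finite (P\<inverse>)" using P(1) by simp
    show "P\<inverse> \<subseteq> B \<times> A" using P(2) by blast
    show "d (fst p) = c (snd p)" if "p \<in> P\<inverse>" for p using P(3)[OF swap[OF that]] by simp
    show "fst p < fst q \<longleftrightarrow> snd p < snd q" if "p \<in> P\<inverse>" "q \<in> P\<inverse>" for p q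
      using P(4)[OF swap[OF that(1)] swap[OF that(2)]] by simp
  qed
qed

text \<open>The partners of the points below and above \<open>x\<close> form a finite cut in
  \<open>B\<close>; the new partner is chosen inside it with the colour of \<open>x\<close>.\<close>

lemma partial_iso_extend:
  assumes P: "partial_iso A c B d P" and B: "coloured_dense B d" and x: "x \<in> A"
  shows "\<exists>Q. partial_iso A c B d Q \<and> P \<subseteq> Q \<and> x \<in> fst ` Q"
proof (cases "x \<in> fst ` P")
  case True
  then show ?thesis using P by blast
next
  case False
  have fin: "finite P" and sub: "P \<subseteq> A \<times> B" and col: "\<And>p. p \<in> P \<Longrightarrow> c (fst p) = d (snd p)"
    and ord: "\<And>p q. p \<in> P \<Longrightarrow> q \<in> P \<Longrightarrow> fst p < fst q \<longleftrightarrow> snd p < snd q"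
    using P unfolding partial_iso_def by blast+
  define L where "L = snd ` {p \<in> P. fst p < x}"
  define U where "U = snd ` {p \<in> P. x < fst p}"
  have "finite L" "finite U" "L \<subseteq> B" "U \<subseteq> B" using fin sub by (auto simp: L_def U_def)
  moreover have "l < u" if lu: "l \<in> L" "u \<in> U" for l u
  proof -
    obtain p q where p: "p \<in> P" "fst p < x" "l = snd p" and q: "q \<in> P" "x < fst q" "u = snd q"
      using lu unfolding L_def U_def by blast
    then show ?thesis using ord[OF p(1) q(1)] by simp
  qed
  ultimately obtain z where z: "z \<in> B" "\<And>l. l \<in> L \<Longrightarrow> l < z" "\<And>u. u \<in> U \<Longrightarrow> z < u" "d z = c x"
    using coloured_dense_fill_gap[OF B, of L U "c x"] by metis
  have cmp: "fst p < x \<longleftrightarrow> snd p < z" "x < fst p \<longleftrightarrow> z < snd p" if p: "p \<in> P" for p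
  proof -
    have "fst p \<noteq> x" using False p by blast
    then consider "fst p < x" | "x < fst p" by linarith
    then have "fst p < x \<and> snd p < z \<or> x < fst p \<and> z < snd p"
    proof cases
      case 1
      then have "snd p \<in> L" using p unfolding L_def by blast
      then show ?thesis using 1 z(2) by blast
    next
      case 2
      then have "snd p \<in> U" using p unfolding U_def by blast
      then show ?thesis using 2 z(3) by blast
    qed
    then show "fst p < x \<longleftrightarrow> snd p < z" "x < fst p \<longleftrightarrow> z < snd p" by auto
  qed
  have "partial_iso A c B d (insert (x, z) P)"
    unfolding partial_iso_def
  proof (intro conjI)
    show "finite (insert (x, z) P)" using fin by simp
    show "insert (x, z) P \<subseteq> A \<times> B" using sub x z(1) by blast
    show "\<forall>p\<in>insert (x, z) P. c (fst p) = d (snd p)" using col z(4) by simp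
    show "\<forall>p\<in>insert (x, z) P. \<forall>q\<in>insert (x, z) P. fst p < fst q \<longleftrightarrow> snd p < snd q"
      using cmp ord by simp
  qed
  then show ?thesis by (intro exI[of _ "insert (x, z) P"]) auto
qed

text \<open>Cantor's argument with two colours: stage \<open>n\<close> takes the \<open>n\<close>-th
  elements of both enumerations into the finite partial isomorphism, and the union is the graph of
  the isomorphism.\<close>

lemma back_and_forth:
  assumes A: "countable A" "coloured_dense A c" and B: "countable B" "coloured_dense B d"
  obtains \<pi> where "\<pi> ` A = B" "strict_mono_on A \<pi>" "\<And>x. x \<in> A \<Longrightarrow> d (\<pi> x) = c x"
proof -
  have ne: "A \<noteq> {}" "B \<noteq> {}" using A(2) B(2) by (simp_all add: coloured_dense_def)
  define a where "a = from_nat_into A"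
  define b where "b = from_nat_into B"
  have a: "range a = A" "\<And>n. a n \<in> A" using range_from_nat_into[OF ne(1) A(1)] from_nat_into[OF ne(1)] by (simp_all add: a_def)
  have b: "range b = B" "\<And>n. b n \<in> B" using range_from_nat_into[OF ne(2) B(1)] from_nat_into[OF ne(2)] by (simp_all add: b_def)
  have step: "\<exists>Q. partial_iso A c B d Q \<and> P \<subseteq> Q \<and> a n \<in> fst ` Q \<and> b n \<in> snd ` Q" if P: "partial_iso A c B d P" for P n
  proof -
    obtain Q where Q: "partial_iso A c B d Q" "P \<subseteq> Q" "a n \<in> fst ` Q" using partial_iso_extend[OF P B(2) a(2)] by blast
    obtain R where R: "partial_iso B d A c R" "Q\<inverse> \<subseteq> R" "b n \<in> fst ` R"
      using partial_iso_extend[OF partial_iso_converse[OF Q(1)] A(2) b(2)] by blast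
    have "partial_iso A c B d (R\<inverse>)" using partial_iso_converse[OF R(1)] .
    moreover have QR: "Q \<subseteq> R\<inverse>"
    proof
      fix p assume "p \<in> Q"
      then have "(snd p, fst p) \<in> Q\<inverse>" by (cases p) simp
      then have "(snd p, fst p) \<in> R" using R(2) by blast
      then show "p \<in> R\<inverse>" by (cases p) simp
    qed
    moreover have "b n \<in> snd ` (R\<inverse>)" using R(3) by force
    moreover have "a n \<in> fst ` (R\<inverse>)" using Q(3) QR by blast
    ultimately show ?thesis using Q(2) by blast
  qed
  have "\<exists>P. \<forall>n. partial_iso A c B d (P n) \<and> (P n \<subseteq> P (Suc n) \<and> a n \<in> fst ` P (Suc n) \<and> b n \<in> snd ` P (Suc n))"
  proof (rule dependent_nat_choice)
    show "\<exists>P. partial_iso A c B d P" by (intro exI[of _ "{}"]) (simp add: partial_iso_def)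
  qed (use step in blast)
  then obtain P where P: "\<And>n. partial_iso A c B d (P n)" "\<And>n. P n \<subseteq> P (Suc n)"
    "\<And>n. a n \<in> fst ` P (Suc n)" "\<And>n. b n \<in> snd ` P (Suc n)" by blast
  have mono: "P m \<subseteq> P n" if "m \<le> n" for m n using lift_Suc_mono_le[of P, OF P(2) that] .
  define R where "R = (\<Union>n. P n)"
  have R2: "\<exists>n. p \<in> P n \<and> q \<in> P n" if w: "p \<in> R" "q \<in> R" for p q
  proof -
    obtain m where "p \<in> P m" using w(1) unfolding R_def by blast
    moreover obtain n where "q \<in> P n" using w(2) unfolding R_def by blast
    ultimately have "p \<in> P m \<and> q \<in> P n" by blast
    then show ?thesis using mono[of m "max m n"] mono[of n "max m n"] by (intro exI[of _ "max m n"]) auto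
  qed
  have ord: "fst p < fst q \<longleftrightarrow> snd p < snd q" if "p \<in> R" "q \<in> R" for p q
    using R2[OF that] P(1) unfolding partial_iso_def by blast
  have sub: "fst p \<in> A" "snd p \<in> B" "c (fst p) = d (snd p)" if w: "p \<in> R" for p
  proof -
    obtain n where n: "p \<in> P n" using w unfolding R_def by blast
    have "P n \<subseteq> A \<times> B" "\<forall>p\<in>P n. c (fst p) = d (snd p)" using P(1)[of n] unfolding partial_iso_def by blast+
    then have "p \<in> A \<times> B" "c (fst p) = d (snd p)" using n by blast+
    then show "fst p \<in> A" "snd p \<in> B" "c (fst p) = d (snd p)" by (simp_all add: mem_Times_iff)
  qed
  have "\<exists>y. (x, y) \<in> R" if "x \<in> A" for x
  proof -
    obtain n where "x = a n" using a(1) \<open>x \<in> A\<close> by blast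
    then have "x \<in> fst ` P (Suc n)" using P(3) by blast
    then obtain p where "p \<in> P (Suc n)" "x = fst p" by blast
    then show ?thesis unfolding R_def by (intro exI[of _ "snd p"]) auto
  qed
  then obtain \<pi> where \<pi>: "\<And>x. x \<in> A \<Longrightarrow> (x, \<pi> x) \<in> R" by metis
  show ?thesis
  proof (rule that[of \<pi>])
    show "\<pi> ` A = B"
    proof (intro equalityI subsetI)
      fix y assume "y \<in> \<pi> ` A"
      then obtain x where "x \<in> A" "y = \<pi> x" by blast
      then show "y \<in> B" using sub(2)[OF \<pi>] by simp
    next
      fix y assume "y \<in> B"
      then obtain n where "y = b n" using b(1) by blast
      then have "y \<in> snd ` P (Suc n)" using P(4) by blast
      then obtain p where p: "p \<in> P (Suc n)" "y = snd p" by blast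
      have pR: "p \<in> R" using p(1) unfolding R_def by blast
      have x: "fst p \<in> A" using sub(1)[OF pR] .
      \<comment> \<open>Pairs of \<open>R\<close> with the same first component agree, by the order
        clause applied in both directions.\<close>
      have "\<pi> (fst p) = y" using ord[OF \<pi>[OF x] pR] ord[OF pR \<pi>[OF x]] p(2) by auto
      then show "y \<in> \<pi> ` A" using x by blast
    qed
    show "strict_mono_on A \<pi>"
    proof (rule strict_mono_onI)
      fix x y assume "x \<in> A" "y \<in> A" "x < y"
      then show "\<pi> x < \<pi> y" using ord[OF \<pi> \<pi>, of x y] by simp
    qed
    show "d (\<pi> x) = c x" if "x \<in> A" for x using sub(3)[OF \<pi>[OF that]] by simp
  qed
qed

text \<open>The extension is the supremum of the values of \<open>h\<close> to the left. Density of
  \<open>U\<close> makes it strictly increasing, density of \<open>V\<close> leaves no gap in its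
  range, and continuity then comes from \<open>H_plusI\<close>.\<close>

lemma extend_dense_isomorphism:
  fixes h :: "real \<Rightarrow> real"
  assumes U: "U \<subseteq> I01" "\<And>x y. x \<in> I01 \<Longrightarrow> y \<in> I01 \<Longrightarrow> x < y \<Longrightarrow> \<exists>u\<in>U. x < u \<and> u < y"
    and V: "V \<subseteq> I01" "\<And>x y. x \<in> I01 \<Longrightarrow> y \<in> I01 \<Longrightarrow> x < y \<Longrightarrow> \<exists>v\<in>V. x < v \<and> v < y"
    and h: "strict_mono_on U h" "h ` U = V"
  obtains H where "H \<in> H_plus" "\<And>u. u \<in> U \<Longrightarrow> H u = h u"
proof -
  \<comment> \<open>The inserted 0 keeps the set non-empty when no point of \<open>U\<close> lies at
    or below \<open>x\<close>, as may happen at 0.\<close>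
  define S where "S = (\<lambda>x. insert 0 (h ` {u \<in> U. u \<le> x}))"
  define H0 where "H0 = (\<lambda>x. Sup (S x))"
  have hV: "0 \<le> h u" "h u \<le> 1" if "u \<in> U" for u
  proof -
    have "h u \<in> I01" using h(2) V(1) that by blast
    then show "0 \<le> h u" "h u \<le> 1" by simp_all
  qed
  have S1: "s \<le> 1" "0 \<le> s" if "s \<in> S x" for s x using that hV unfolding S_def by auto
  have bdd: "bdd_above (S x)" for x using S1 by (intro bdd_aboveI[of _ 1])
  have S0: "0 \<in> S x" for x by (simp add: S_def)
  have H0: "0 \<le> H0 x" "H0 x \<le> 1" for x
  proof -
    show "0 \<le> H0 x" unfolding H0_def by (rule cSup_upper[OF S0 bdd])
    show "H0 x \<le> 1" unfolding H0_def by (rule cSup_least) (use S0 S1 in blast)+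
  qed
  have upper: "h u \<le> H0 x" if "u \<in> U" "u \<le> x" for u x
    unfolding H0_def by (rule cSup_upper[OF _ bdd]) (use that in \<open>simp add: S_def\<close>)
  have least: "H0 x \<le> t" if "0 \<le> t" "\<And>u. u \<in> U \<Longrightarrow> u \<le> x \<Longrightarrow> h u \<le> t" for x t
    unfolding H0_def by (rule cSup_least) (use that S0 in \<open>auto simp: S_def\<close>)
  have hle: "h u \<le> h v" if "u \<in> U" "v \<in> U" "u \<le> v" for u v
    using strict_mono_on_leD[OF h(1) that] .
  have Hh: "H0 u = h u" if u: "u \<in> U" for u
  proof (rule antisym)
    show "H0 u \<le> h u" by (rule least) (use hV[OF u] hle u in auto)
    show "h u \<le> H0 u" by (rule upper[OF u]) simp
  qed
  have sm: "strict_mono_on I01 H0"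
  proof (rule strict_mono_onI)
    fix x y assume xy: "x \<in> I01" "y \<in> I01" "x < y"
    obtain u1 where u1: "u1 \<in> U" "x < u1" "u1 < y" using U(2)[OF xy] by blast
    have u1I: "u1 \<in> I01" using u1(1) U(1) by blast
    \<comment> \<open>A second point is needed for strictness: one alone gives only
      \<open>H0 x \<le> h u1 \<le> H0 y\<close>.\<close>
    obtain u2 where u2: "u2 \<in> U" "u1 < u2" "u2 < y" using U(2)[OF u1I xy(2) u1(3)] by blast
    have "H0 x \<le> h u1"
    proof (rule least)
      show "h u \<le> h u1" if "u \<in> U" "u \<le> x" for u using hle[OF that(1) u1(1)] that(2) u1(2) by simp
    qed (use hV u1 in simp)
    moreover have "h u1 < h u2" using strict_mono_onD[OF h(1) u1(1) u2(1,2)] .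
    moreover have "h u2 \<le> H0 y" using upper[OF u2(1)] u2(3) by simp
    ultimately show "H0 x < H0 y" by linarith
  qed
  have surj: "y \<in> H0 ` I01" if y: "y \<in> I01" for y
  proof -
    define x where "x = Sup (insert 0 {u \<in> U. h u \<le> y})"
    have U01: "0 \<le> u" "u \<le> 1" if "u \<in> U" for u using U(1) that by auto
    have bd: "bdd_above (insert 0 {u \<in> U. h u \<le> y})" by (intro bdd_aboveI[of _ 1]) (use U01 in auto)
    have ux: "u \<le> x" if "u \<in> U" "h u \<le> y" for u unfolding x_def by (rule cSup_upper[OF _ bd]) (use that in simp)
    have x0: "0 \<le> x" unfolding x_def by (rule cSup_upper[OF _ bd]) simp
    have xle: "x \<le> t" if "0 \<le> t" "\<And>u. u \<in> U \<Longrightarrow> h u \<le> y \<Longrightarrow> u \<le> t" for t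
      unfolding x_def by (rule cSup_least) (use that in auto)
    have xI: "x \<in> I01" using x0 xle[of 1] U01 by simp
    have "\<not> H0 x < y"
    proof
      assume lt: "H0 x < y"
      have "H0 x \<in> I01" using H0 by simp
      then obtain v where v: "v \<in> V" "H0 x < v" "v < y" using V(2)[OF _ y lt] by blast
      then obtain u where u: "u \<in> U" "v = h u" using h(2) by blast
      have "u \<le> x" using ux[OF u(1)] u(2) v(3) by simp
      then show False using upper[OF u(1), of x] u(2) v(2) by simp
    qed
    moreover have "\<not> y < H0 x"
    proof
      assume lt: "y < H0 x"
      have "H0 x \<in> I01" using H0 by simp
      then obtain v where v: "v \<in> V" "y < v" "v < H0 x" using V(2)[OF y _ lt] by blast
      then obtain u where u: "u \<in> U" "v = h u" using h(2) by blast
      have "x \<le> u"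
      proof (rule xle)
        show "w \<le> u" if w: "w \<in> U" "h w \<le> y" for w
        proof (rule ccontr)
          assume "\<not> w \<le> u"
          then have "h u \<le> h w" using hle[OF u(1) w(1)] by simp
          then show False using w(2) u(2) v(2) by simp
        qed
      qed (use U01 u in simp)
      moreover have "u \<in> I01" using U(1) u(1) by blast
      ultimately have "H0 x \<le> H0 u" using strict_mono_on_leD[OF sm xI] by blast
      then show False using Hh[OF u(1)] u(2) v(3) by simp
    qed
    ultimately have "H0 x = y" by linarith
    then show ?thesis using xI by blast
  qed
  have "restrict H0 I01 \<in> H_plus"
  proof (rule H_plusI)
    show "strict_mono_on I01 (restrict H0 I01)"
      by (rule strict_mono_onI) (use strict_mono_onD[OF sm] in simp)
    have "H0 ` I01 = I01" using surj H0 by (intro equalityI subsetI) (auto simp del: atLeastAtMost_iff, simp)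
    then show "restrict H0 I01 ` I01 = I01" by simp
  qed simp
  moreover have "restrict H0 I01 u = h u" if "u \<in> U" for u
    using Hh[OF that] U(1) that by (metis restrict_apply' subsetD)
  ultimately show ?thesis by (rule that)
qed

section \<open>Conjugating two elements\<close>

lemma orbital_no_Fix:
  assumes f: "f \<in> H_plus" and x: "x \<in> I01" "f x \<noteq> x" and y: "y \<in> orbital f x"
  shows "\<not> (\<exists>z\<in>Fix f. x < z \<and> z < y)" "\<not> (\<exists>z\<in>Fix f. y < z \<and> z < x)"
proof -
  obtain a b where ab: "a < x" "x < b" "orbital f x = {a<..<b}" "{a<..<b} \<inter> Fix f = {}"
    using orbital_interval[OF f x] by metis
  have yab: "a < y" "y < b" using y unfolding ab(3) by simp_all
  have no: "z \<notin> Fix f" if "a < z" "z < b" for z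
  proof -
    have "z \<in> {a<..<b}" using that by simp
    then show ?thesis using ab(4) by blast
  qed
  show "\<not> (\<exists>z\<in>Fix f. x < z \<and> z < y)" using no yab ab(1,2) by (meson less_trans)
  show "\<not> (\<exists>z\<in>Fix f. y < z \<and> z < x)" using no yab ab(1,2) by (meson less_trans)
qed

lemma orbital_sign:
  assumes f: "f \<in> H_plus" and x: "x \<in> I01" "f x \<noteq> x" and y: "y \<in> orbital f x"
  shows "x < f x \<longleftrightarrow> y < f y"
proof -
  have "y \<in> I01" "f y \<noteq> y" using orbital_eq(2,3)[OF f x y] .
  then have "(f x - x) * (f y - y) > 0"
    using same_sign[OF f x(1) _ x(2)] orbital_no_Fix[OF f x y] by blast
  then show ?thesis by (auto simp: zero_less_mult_iff)
qed

lemma orbital_trichotomy: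
  assumes f: "f \<in> H_plus" and x: "x \<in> I01" "f x \<noteq> x" and y: "y \<in> I01" "f y \<noteq> y" and xy: "x < y"
  shows "orbital f y = orbital f x \<or> (\<exists>z\<in>Fix f. x < z \<and> z < y)"
proof -
  obtain a b where ab: "b \<in> Fix f" "a < x" "x < b" "orbital f x = {a<..<b}"
    using orbital_interval[OF f x] by metis
  have "y \<noteq> b" using y(2) Fix_eq[OF ab(1)] by blast
  then consider "y < b" | "b < y" by linarith
  then show ?thesis
  proof cases
    case 1
    then have "y \<in> orbital f x" unfolding ab(4) using ab(2) xy by simp
    then show ?thesis using orbital_eq(1)[OF f x] by blast
  next
    case 2
    then show ?thesis using ab(1,3) by blast
  qed
qed

text \<open>Separation by a fixed point is a relation between orbitals, independent of the chosen
  points.\<close>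

lemma separated_orbitals:
  assumes f: "f \<in> H_plus" and x: "x \<in> I01" "f x \<noteq> x" and y: "y \<in> I01" "f y \<noteq> y"
    and sep: "\<exists>z\<in>Fix f. x < z \<and> z < y" and x': "x' \<in> orbital f x" and y': "y' \<in> orbital f y"
  shows "\<exists>z\<in>Fix f. x' < z \<and> z < y'"
  using sep orbital_less_iff[OF f x y] orbital_less_iff[OF f orbital_eq(2,3)[OF f x x'] orbital_eq(2,3)[OF f y y']]
    orbital_eq(1)[OF f x x'] orbital_eq(1)[OF f y y'] by simp

text \<open>The choice depends on \<open>x\<close> only through its orbital, so all points of an
  orbital share one representative; rationality makes the representatives countable.\<close>

definition orbital_rep :: "(real \<Rightarrow> real) \<Rightarrow> real \<Rightarrow> real" where
  "orbital_rep f x = (SOME r. r \<in> \<rat> \<inter> orbital f x)"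

definition orbital_reps :: "(real \<Rightarrow> real) \<Rightarrow> real set" where
  "orbital_reps f = orbital_rep f ` {x \<in> I01. f x \<noteq> x}"

lemma orbital_rep:
  assumes f: "f \<in> H_plus" and x: "x \<in> I01" "f x \<noteq> x"
  shows "orbital_rep f x \<in> \<rat>" "orbital_rep f x \<in> orbital f x"
    "orbital f (orbital_rep f x) = orbital f x" "orbital_rep f x \<in> I01" "f (orbital_rep f x) \<noteq> orbital_rep f x"
proof -
  obtain a b where ab: "a < x" "x < b" "orbital f x = {a<..<b}" using orbital_interval[OF f x] by metis
  obtain r where "r \<in> \<rat>" "a < r" "r < b" using Rats_dense_in_real[of a b] ab(1,2) by auto
  then have "r \<in> \<rat> \<inter> orbital f x" unfolding ab(3) by simp
  then have "orbital_rep f x \<in> \<rat> \<inter> orbital f x" unfolding orbital_rep_def by (rule someI)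
  then show 1: "orbital_rep f x \<in> \<rat>" "orbital_rep f x \<in> orbital f x" by blast+
  show "orbital f (orbital_rep f x) = orbital f x" "orbital_rep f x \<in> I01" "f (orbital_rep f x) \<noteq> orbital_rep f x"
    using orbital_eq[OF f x 1(2)] by blast+
qed

lemma orbital_reps_props:
  assumes f: "f \<in> H_plus" and a: "a \<in> orbital_reps f"
  shows "a \<in> I01" "f a \<noteq> a" "orbital_rep f a = a"
proof -
  obtain x where x: "x \<in> I01" "f x \<noteq> x" "a = orbital_rep f x" using a unfolding orbital_reps_def by blast
  show "a \<in> I01" "f a \<noteq> a" using orbital_rep(4,5)[OF f x(1,2)] unfolding x(3) .
  show "orbital_rep f a = a" unfolding x(3) using orbital_rep(3)[OF f x(1,2)] by (simp add: orbital_rep_def)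
qed

lemma orbital_reps_separated:
  assumes f: "f \<in> H_plus" and "a \<in> orbital_reps f" "b \<in> orbital_reps f" "a < b"
  shows "\<exists>z\<in>Fix f. a < z \<and> z < b"
proof -
  note A = orbital_reps_props[OF f assms(2)] and B = orbital_reps_props[OF f assms(3)]
  have "orbital f b \<noteq> orbital f a"
  proof
    assume "orbital f b = orbital f a"
    then have "orbital_rep f b = orbital_rep f a" by (simp add: orbital_rep_def)
    then show False using A(3) B(3) assms(4) by simp
  qed
  then show ?thesis using orbital_trichotomy[OF f A(1,2) B(1,2) assms(4)] by blast
qed

lemma countable_orbital_reps:
  assumes "f \<in> H_plus" shows "countable (orbital_reps f)"
proof (rule countable_subset[OF _ countable_rat])
  show "orbital_reps f \<subseteq> \<rat>" unfolding orbital_reps_def using orbital_rep(1)[OF assms] by blast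
qed

text \<open>Representatives are real numbers in their usual order, so back and forth applies to them
  in place of orbitals; the two parities become the two colours.\<close>

lemma coloured_dense_orbital_reps:
  assumes C: "f \<in> C_set"
  shows "coloured_dense (orbital_reps f) (\<lambda>x. x < f x)"
proof -
  have f: "f \<in> H_plus" and ne: "\<exists>x\<in>I01. f x \<noteq> x"
    and dense: "\<And>x y. x \<in> I01 \<Longrightarrow> y \<in> I01 \<Longrightarrow> f x \<noteq> x \<Longrightarrow> f y \<noteq> y \<Longrightarrow> \<exists>z\<in>Fix f. x < z \<and> z < y \<Longrightarrow>
        (\<exists>p\<in>I01. p < f p \<and> (\<exists>z\<in>Fix f. x < z \<and> z < p) \<and> (\<exists>z\<in>Fix f. p < z \<and> z < y)) \<and>
        (\<exists>p\<in>I01. f p < p \<and> (\<exists>z\<in>Fix f. x < z \<and> z < p) \<and> (\<exists>z\<in>Fix f. p < z \<and> z < y))"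
    and below: "\<And>x. x \<in> I01 \<Longrightarrow> f x \<noteq> x \<Longrightarrow> \<exists>y\<in>I01. f y \<noteq> y \<and> (\<exists>z\<in>Fix f. y < z \<and> z < x)"
    and above: "\<And>x. x \<in> I01 \<Longrightarrow> f x \<noteq> x \<Longrightarrow> \<exists>y\<in>I01. f y \<noteq> y \<and> (\<exists>z\<in>Fix f. x < z \<and> z < y)"
    using C by (simp_all add: C_set_iff)
  let ?A = "orbital_reps f"
  \<comment> \<open>Stated for arbitrary non-fixed points, since the neighbours supplied by
    \<open>below\<close> and \<open>above\<close> need not be representatives.\<close>
  have btw: "\<exists>z\<in>?A. x < z \<and> z < y \<and> (z < f z) = k"
    if x: "x \<in> I01" "f x \<noteq> x" and y: "y \<in> I01" "f y \<noteq> y" and xy: "\<exists>z\<in>Fix f. x < z \<and> z < y" for x y k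
  proof -
    have "\<exists>p\<in>I01. f p \<noteq> p \<and> (p < f p) = k \<and> (\<exists>z\<in>Fix f. x < z \<and> z < p) \<and> (\<exists>z\<in>Fix f. p < z \<and> z < y)"
    proof (cases k)
      case True
      obtain p where p: "p \<in> I01" "p < f p" "\<exists>z\<in>Fix f. x < z \<and> z < p" "\<exists>z\<in>Fix f. p < z \<and> z < y"
        using dense[OF x(1) y(1) x(2) y(2) xy] by blast
      show ?thesis by (intro bexI[OF _ p(1)] conjI p(3,4)) (use p(2) True in simp_all)
    next
      case False
      obtain p where p: "p \<in> I01" "f p < p" "\<exists>z\<in>Fix f. x < z \<and> z < p" "\<exists>z\<in>Fix f. p < z \<and> z < y"
        using dense[OF x(1) y(1) x(2) y(2) xy] by blast
      show ?thesis by (intro bexI[OF _ p(1)] conjI p(3,4)) (use p(2) False in simp_all)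
    qed
    then obtain p where p: "p \<in> I01" "f p \<noteq> p" "(p < f p) = k" "\<exists>z\<in>Fix f. x < z \<and> z < p" "\<exists>z\<in>Fix f. p < z \<and> z < y"
      by blast
    let ?z = "orbital_rep f p"
    note z = orbital_rep[OF f p(1,2)]
    have "?z \<in> ?A" using p(1,2) unfolding orbital_reps_def by blast
    moreover have "x < ?z"
      using separated_orbitals[OF f x p(1,2) p(4) orbital_self[OF f x] z(2)] less_trans by blast
    moreover have "?z < y"
      using separated_orbitals[OF f p(1,2) y p(5) z(2) orbital_self[OF f y]] less_trans by blast
    moreover have "(?z < f ?z) = k" using orbital_sign[OF f p(1,2) z(2)] p(3) by simp
    ultimately show ?thesis by blast
  qed
  show ?thesis
    unfolding coloured_dense_def
  proof (intro conjI ballI allI impI)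
    show "?A \<noteq> {}" using ne unfolding orbital_reps_def by blast
    show "\<exists>z\<in>?A. x < z \<and> z < y \<and> (z < f z) = k" if a: "x \<in> ?A" "y \<in> ?A" "x < y" for x y k
      using btw[OF orbital_reps_props(1,2)[OF f a(1)] orbital_reps_props(1,2)[OF f a(2)] orbital_reps_separated[OF f a]] .
    show "\<exists>z\<in>?A. z < x \<and> (z < f z) = k" if a: "x \<in> ?A" for x k
    proof -
      note x = orbital_reps_props(1,2)[OF f a]
      obtain y where y: "y \<in> I01" "f y \<noteq> y" "\<exists>z\<in>Fix f. y < z \<and> z < x" using below[OF x] by blast
      show ?thesis using btw[OF y(1,2) x y(3), of k] by blast
    qed
    show "\<exists>z\<in>?A. x < z \<and> (z < f z) = k" if a: "x \<in> ?A" for x k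
    proof -
      note x = orbital_reps_props(1,2)[OF f a]
      obtain y where y: "y \<in> I01" "f y \<noteq> y" "\<exists>z\<in>Fix f. x < z \<and> z < y" using above[OF x] by blast
      show ?thesis using btw[OF x y(1,2) y(3), of k] by blast
    qed
  qed
qed

lemma nonfixed_dense:
  assumes "negligible (Fix f)" "x \<in> I01" "y \<in> I01" "x < y"
  shows "\<exists>u\<in>{t \<in> I01. f t \<noteq> t}. x < u \<and> u < y"
proof -
  have "{x<..<y} \<subseteq> I01" using assms(2,3) by auto
  then obtain u where "x < u" "u < y" "f u \<noteq> u" "u \<in> I01" using nonfixed_in_interval[OF assms(1,4)] by metis
  then show ?thesis by blast
qed

text \<open>The orbital pieces are assembled along an isomorphism of representatives. The result is
  an order isomorphism between the non-fixed points of \<open>f\<close> and those of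
  \<open>g\<close>, and both sets are dense because their complements are null.\<close>

lemma C_AC_conjugator:
  assumes f: "f \<in> C_AC" and g: "g \<in> C_AC"
  shows "\<exists>H\<in>H_AC. \<forall>x\<in>I01. H (f x) = g (H x)"
proof -
  have fH: "f \<in> H_AC" and gH: "g \<in> H_AC" and nullf: "negligible (Fix f)" and nullg: "negligible (Fix g)"
    using f g unfolding C_AC_iff by blast+
  have fC: "f \<in> C_set" and gC: "g \<in> C_set" using f g unfolding C_AC_def by blast+
  have fP: "f \<in> H_plus" and gP: "g \<in> H_plus" using H_AC_H_plus fH gH by blast+
  let ?A = "orbital_reps f" and ?B = "orbital_reps g"
  obtain \<pi> where \<pi>: "\<pi> ` ?A = ?B" "strict_mono_on ?A \<pi>" "\<And>x. x \<in> ?A \<Longrightarrow> (\<pi> x < g (\<pi> x)) = (x < f x)"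
    using back_and_forth[OF countable_orbital_reps[OF fP] coloured_dense_orbital_reps[OF fC]
      countable_orbital_reps[OF gP] coloured_dense_orbital_reps[OF gC]] by metis
  have piB: "\<pi> a \<in> ?B" if "a \<in> ?A" for a using \<pi>(1) that by blast
  \<comment> \<open>Bundles the requirements on one piece, so that the pieces for all
    representatives can be chosen at once.\<close>
  define conj_on where "conj_on = (\<lambda>a (h :: real \<Rightarrow> real). strict_mono_on (orbital f a) h \<and> h ` orbital f a = orbital g (\<pi> a) \<and>
    (\<forall>x\<in>orbital f a. h (f x) = g (h x)) \<and>
    (\<forall>E\<subseteq>orbital f a. negligible (h ` E) \<longleftrightarrow> negligible E))"
  have "\<exists>h. conj_on a h" if a: "a \<in> ?A" for a
  proof -
    note A = orbital_reps_props(1,2)[OF fP a] and B = orbital_reps_props(1,2)[OF gP piB[OF a]]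
    obtain l r where lr: "l \<in> Fix f" "r \<in> Fix f" "l < a" "a < r" "orbital f a = {l<..<r}"
      using orbital_interval[OF fP A] by metis
    obtain l' r' where lr': "l' \<in> Fix g" "r' \<in> Fix g" "l' < \<pi> a" "\<pi> a < r'" "orbital g (\<pi> a) = {l'<..<r'}"
      using orbital_interval[OF gP B] by metis
    have sf: "(x < f x) = (a < f a)" "f x \<noteq> x" if "x \<in> {l<..<r}" for x
      using orbital_sign[OF fP A, of x] orbital_eq(3)[OF fP A, of x] that unfolding lr(5) by blast+
    have sg: "(x < g x) = (\<pi> a < g (\<pi> a))" "g x \<noteq> x" if "x \<in> {l'<..<r'}" for x
      using orbital_sign[OF gP B, of x] orbital_eq(3)[OF gP B, of x] that unfolding lr'(5) by blast+
    have "(\<forall>x\<in>{l<..<r}. x < f x) \<and> (\<forall>x\<in>{l'<..<r'}. x < g x) \<or>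
      (\<forall>x\<in>{l<..<r}. f x < x) \<and> (\<forall>x\<in>{l'<..<r'}. g x < x)"
    proof (cases "a < f a")
      case True
      then have "\<pi> a < g (\<pi> a)" using \<pi>(3)[OF a] by simp
      then show ?thesis using sf(1) sg(1) True by blast
    next
      case False
      then have no: "\<not> \<pi> a < g (\<pi> a)" using \<pi>(3)[OF a] by simp
      have "f x < x" if "x \<in> {l<..<r}" for x using sf[OF that] False by (simp add: not_less less_le)
      moreover have "g x < x" if "x \<in> {l'<..<r'}" for x using sg[OF that] no by (simp add: not_less less_le)
      ultimately show ?thesis by blast
    qed
    moreover have "l < r" "l' < r'" using lr lr' by linarith+
    ultimately show ?thesis
      unfolding conj_on_def lr(5) lr'(5) using orbital_conjugacy[OF fH lr(1,2) _ gH lr'(1,2)] by blast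
  qed
  then obtain hh where "\<And>a. a \<in> ?A \<Longrightarrow> conj_on a (hh a)" by metis
  then have hh: "\<And>a. a \<in> ?A \<Longrightarrow> strict_mono_on (orbital f a) (hh a)"
    "\<And>a. a \<in> ?A \<Longrightarrow> hh a ` orbital f a = orbital g (\<pi> a)"
    "\<And>a x. a \<in> ?A \<Longrightarrow> x \<in> orbital f a \<Longrightarrow> hh a (f x) = g (hh a x)"
    "\<And>a E. a \<in> ?A \<Longrightarrow> E \<subseteq> orbital f a \<Longrightarrow> negligible (hh a ` E) \<longleftrightarrow> negligible E"
    unfolding conj_on_def by blast+
  define U where "U = {x \<in> I01. f x \<noteq> x}"
  define V where "V = {x \<in> I01. g x \<noteq> x}"
  have U: "x \<in> I01" "f x \<noteq> x" if "x \<in> U" for x using that unfolding U_def by blast+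
  define rp where "rp = orbital_rep f"
  define h where "h = (\<lambda>x. hh (rp x) x)"
  have rp: "rp x \<in> ?A" "x \<in> orbital f (rp x)" if "x \<in> U" for x
  proof -
    show "rp x \<in> ?A" using that unfolding U_def orbital_reps_def rp_def by blast
    show "x \<in> orbital f (rp x)" using orbital_rep(3)[OF fP U[OF that]] orbital_self[OF fP U[OF that]] by (simp add: rp_def)
  qed
  have rp_eq: "rp x = a" "x \<in> U" if a: "a \<in> ?A" and x: "x \<in> orbital f a" for a x
  proof -
    note A = orbital_reps_props[OF fP a]
    have "orbital f x = orbital f a" using orbital_eq(1)[OF fP A(1,2) x] .
    then have "rp x = orbital_rep f a" by (simp add: rp_def orbital_rep_def)
    then show "rp x = a" using A(3) by simp
    show "x \<in> U" unfolding U_def using orbital_eq(2,3)[OF fP A(1,2) x] by blast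
  qed
  have hx: "h x \<in> orbital g (\<pi> (rp x))" if "x \<in> U" for x
    using hh(2)[OF rp(1)[OF that]] rp(2)[OF that] unfolding h_def by blast
  have hV: "h ` U = V"
  proof (intro equalityI subsetI)
    fix y assume "y \<in> h ` U"
    then obtain x where x: "x \<in> U" "y = h x" by blast
    note B = orbital_reps_props(1,2)[OF gP piB[OF rp(1)[OF x(1)]]]
    show "y \<in> V" unfolding x(2) V_def using orbital_eq(2,3)[OF gP B hx[OF x(1)]] by blast
  next
    fix y assume "y \<in> V"
    then have y: "y \<in> I01" "g y \<noteq> y" unfolding V_def by blast+
    have "orbital_rep g y \<in> ?B" using y unfolding orbital_reps_def by blast
    then obtain a where a: "a \<in> ?A" "orbital_rep g y = \<pi> a" using \<pi>(1) by (metis imageE)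
    have "y \<in> orbital g (\<pi> a)" using orbital_rep(3)[OF gP y] orbital_self[OF gP y] a(2) by simp
    then obtain x where x: "x \<in> orbital f a" "y = hh a x" using hh(2)[OF a(1)] by blast
    have "h x = y" unfolding h_def rp_eq(1)[OF a(1) x(1)] x(2) by simp
    then show "y \<in> h ` U" using rp_eq(2)[OF a(1) x(1)] by blast
  qed
  have hsm: "strict_mono_on U h"
  proof (rule strict_mono_onI)
    fix x y assume x: "x \<in> U" and y: "y \<in> U" and xy: "x < y"
    show "h x < h y"
    proof (cases "rp x = rp y")
      case True
      then show ?thesis
        using strict_mono_onD[OF hh(1)[OF rp(1)[OF x]] rp(2)[OF x] _ xy] rp(2)[OF y] unfolding h_def by simp
    next
      case False
      have "orbital f y \<noteq> orbital f x"
      proof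
        assume "orbital f y = orbital f x"
        then have "rp y = rp x" by (simp add: rp_def orbital_rep_def)
        then show False using False by simp
      qed
      then have "\<exists>z\<in>Fix f. x < z \<and> z < y" using orbital_trichotomy[OF fP U[OF x] U[OF y] xy] by blast
      \<comment> \<open>Order across orbitals travels as separation: from the points to their
        representatives, through \<open>\<pi>\<close>, and back to points of the image
        orbitals.\<close>
      then have "\<exists>z\<in>Fix f. rp x < z \<and> z < rp y"
        using separated_orbitals[OF fP U[OF x] U[OF y]] orbital_rep(2)[OF fP U[OF x]] orbital_rep(2)[OF fP U[OF y]]
        unfolding rp_def by blast
      then have "rp x < rp y" by force
      then have "\<pi> (rp x) < \<pi> (rp y)" using strict_mono_onD[OF \<pi>(2) rp(1)[OF x] rp(1)[OF y]] by blast
      then have "\<exists>z\<in>Fix g. \<pi> (rp x) < z \<and> z < \<pi> (rp y)"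
        using orbital_reps_separated[OF gP piB[OF rp(1)[OF x]] piB[OF rp(1)[OF y]]] by blast
      then have "\<exists>z\<in>Fix g. h x < z \<and> z < h y"
        using separated_orbitals[OF gP orbital_reps_props(1,2)[OF gP piB[OF rp(1)[OF x]]]
          orbital_reps_props(1,2)[OF gP piB[OF rp(1)[OF y]]] _ hx[OF x] hx[OF y]] by blast
      then show ?thesis by force
    qed
  qed
  have UI: "U \<subseteq> I01" "V \<subseteq> I01" unfolding U_def V_def by blast+
  have dU: "\<exists>u\<in>U. x < u \<and> u < y" if "x \<in> I01" "y \<in> I01" "x < y" for x y
    unfolding U_def by (rule nonfixed_dense[OF nullf that])
  have dV: "\<exists>u\<in>V. x < u \<and> u < y" if "x \<in> I01" "y \<in> I01" "x < y" for x y
    unfolding V_def by (rule nonfixed_dense[OF nullg that])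
  obtain H where HP: "H \<in> H_plus" and Hh: "\<And>u. u \<in> U \<Longrightarrow> H u = h u"
    by (rule extend_dense_isomorphism[OF UI(1) _ UI(2) _ hsm hV]) (use dU dV in blast)+
  \<comment> \<open>The non-fixed points of \<open>f\<close> already fill \<open>V\<close> under
    \<open>H\<close>, so by injectivity no fixed point of \<open>f\<close> can be sent
    there.\<close>
  have HFix: "H x \<in> Fix g" if x: "x \<in> Fix f" for x
  proof (rule ccontr)
    assume n: "H x \<notin> Fix g"
    have xI: "x \<in> I01" using Fix_mem[OF x] .
    have "H x \<in> V" using H_plus_mem[OF HP xI] n FixI unfolding V_def by blast
    then obtain u where u: "u \<in> U" "H x = H u" using hV Hh by (metis imageE)
    have "x = u" using inj_onD[OF H_plus_inj[OF HP] u(2) xI] u(1) UI(1) by blast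
    then show False using U(2)[OF u(1)] Fix_eq[OF x] by blast
  qed
  have comm: "H (f x) = g (H x)" if xI: "x \<in> I01" for x
  proof (cases "x \<in> U")
    case True
    obtain a b where ab: "a \<in> Fix f" "b \<in> Fix f" "a < x" "x < b" "orbital f x = {a<..<b}"
      using orbital_interval[OF fP U[OF True]] by metis
    have "f x \<in> orbital f x" unfolding ab(5) using H_plus_fixed_interval(2)[OF fP ab(1,2)] ab(3,4) by simp
    then have "f x \<in> orbital f (rp x)" using orbital_rep(3)[OF fP U[OF True]] by (simp add: rp_def)
    note fx = rp_eq[OF rp(1)[OF True] this]
    have "H (f x) = hh (rp x) (f x)" unfolding Hh[OF fx(2)] h_def fx(1) ..
    also have "\<dots> = g (hh (rp x) x)" by (rule hh(3)[OF rp[OF True]])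
    also have "hh (rp x) x = H x" unfolding Hh[OF True] h_def ..
    finally show ?thesis .
  next
    case False
    then have fx: "f x = x" using xI unfolding U_def by blast
    then have "H x \<in> Fix g" using HFix[OF FixI[OF xI]] by blast
    then show ?thesis using Fix_eq[of "H x" g] fx by simp
  qed
  have cA: "countable ?A" by (rule countable_orbital_reps[OF fP])
  have Horb: "H ` E = hh a ` E" if "a \<in> ?A" "E \<subseteq> orbital f a" for a E
  proof (rule image_cong[OF refl])
    fix x assume "x \<in> E"
    then have x: "x \<in> orbital f a" using that(2) by blast
    show "H x = hh a x" using Hh[OF rp_eq(2)[OF that(1) x]] rp_eq(1)[OF that(1) x] unfolding h_def by simp
  qed
  have N1: "lusin_N H"
    unfolding lusin_N_def
  proof (intro allI impI)
    fix E assume E: "E \<subseteq> I01" "negligible E"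
    \<comment> \<open>The image of the fixed part of \<open>E\<close> is absorbed by the null set
      \<open>Fix g\<close>; the rest is spread over countably many orbitals.\<close>
    have "H ` E \<subseteq> Fix g \<union> (\<Union>a\<in>?A. H ` (E \<inter> orbital f a))"
    proof
      fix y assume "y \<in> H ` E"
      then obtain x where x: "x \<in> E" "y = H x" by blast
      show "y \<in> Fix g \<union> (\<Union>a\<in>?A. H ` (E \<inter> orbital f a))"
      proof (cases "x \<in> U")
        case True
        then show ?thesis using rp[OF True] x by blast
      next
        case False
        then have "f x = x" using E(1) x(1) unfolding U_def by blast
        then have "x \<in> Fix f" using E(1) x(1) by (intro FixI) blast+
        then show ?thesis using HFix x(2) by blast
      qed
    qed
    moreover have "negligible (\<Union>a\<in>?A. H ` (E \<inter> orbital f a))"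
    proof (rule negligible_countable_Union)
      show "countable ((\<lambda>a. H ` (E \<inter> orbital f a)) ` ?A)" using cA by (rule countable_image)
      fix S assume "S \<in> (\<lambda>a. H ` (E \<inter> orbital f a)) ` ?A"
      then obtain a where a: "a \<in> ?A" "S = H ` (E \<inter> orbital f a)" by blast
      have "negligible (E \<inter> orbital f a)" by (rule negligible_subset[OF E(2)]) blast
      then show "negligible S" unfolding a(2) Horb[OF a(1) Int_lower2] using hh(4)[OF a(1) Int_lower2] by blast
    qed
    ultimately show "negligible (H ` E)"
      by (rule negligible_subset[OF negligible_Un[OF nullg], rotated])
  qed
  let ?G = "inv_into I01 H"
  have N2: "lusin_N ?G"
    unfolding lusin_N_def
  proof (intro allI impI)
    fix E assume E: "E \<subseteq> I01" "negligible E"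
    have "?G ` E \<subseteq> Fix f \<union> (\<Union>a\<in>?A. ?G ` E \<inter> orbital f a)"
    proof
      fix x assume x: "x \<in> ?G ` E"
      then have xI: "x \<in> I01" using H_plus_inv_mem[OF HP] E(1) by blast
      show "x \<in> Fix f \<union> (\<Union>a\<in>?A. ?G ` E \<inter> orbital f a)"
      proof (cases "x \<in> U")
        case True
        then show ?thesis using rp[OF True] x by blast
      next
        case False
        then have "f x = x" using xI unfolding U_def by blast
        then show ?thesis using FixI[OF xI] by blast
      qed
    qed
    moreover have "negligible (\<Union>a\<in>?A. ?G ` E \<inter> orbital f a)"
    proof (rule negligible_countable_Union)
      show "countable ((\<lambda>a. ?G ` E \<inter> orbital f a) ` ?A)" using cA by (rule countable_image)
      fix S assume "S \<in> (\<lambda>a. ?G ` E \<inter> orbital f a) ` ?A"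
      then obtain a where a: "a \<in> ?A" "S = ?G ` E \<inter> orbital f a" by blast
      \<comment> \<open>The equivalence for null sets on an orbital is used in the other direction:
        this piece of the preimage is null because its image lies in \<open>E\<close>.\<close>
      have "H ` S \<subseteq> E"
      proof
        fix y assume "y \<in> H ` S"
        then obtain e where e: "e \<in> E" "y = H (?G e)" unfolding a(2) by blast
        then show "y \<in> E" using H_plus_f_inv[OF HP, of e] E(1) by (metis subsetD)
      qed
      then have "negligible (H ` S)" by (rule negligible_subset[OF E(2)])
      moreover have S: "S \<subseteq> orbital f a" unfolding a(2) by (rule Int_lower2)
      ultimately show "negligible S" using hh(4)[OF a(1) S] unfolding Horb[OF a(1) S] by blast
    qed
    ultimately show "negligible (?G ` E)"
      by (rule negligible_subset[OF negligible_Un[OF nullf], rotated])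
  qed
  have "H \<in> H_AC" unfolding H_AC_iff using HP N1 N2 by blast
  then show ?thesis using comm by blast
qed

theorem theorem13:
  shows "gdelta_in H_AC_topology C_AC
       \<and> H_AC_topology closure_of C_AC = topspace H_AC_topology
       \<and> (\<exists>f\<in>carrier H_AC_group. C_AC = conjugacy_class H_AC_group f)"
proof (intro conjI gdelta_C_AC closure_of_C_AC)
  \<comment> \<open>Density near any one element, here the identity, shows that \<open>C_AC\<close>
    is non-empty and so provides the element whose class it is.\<close>
  have "\<exists>f\<in>C_AC. rho (\<lambda>x\<in>I01. x) f < 1" by (rule C_AC_dense[OF H_AC_id]) simp
  then obtain f where f: "f \<in> C_AC" by blast
  then have "f \<in> H_AC" unfolding C_AC_iff by blast
  then have "f \<in> carrier H_AC_group" by (simp add: H_AC_group_def)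
  moreover have "C_AC = conjugacy_class H_AC_group f"
    by (rule conjugacy_class_C_AC[OF f]) (rule C_AC_conjugator[OF f])
  ultimately show "\<exists>f\<in>carrier H_AC_group. C_AC = conjugacy_class H_AC_group f" by blast
qed

end
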